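(* Let $T>0$, $g\in C^2_b(\mathbb{R})$, $G\in\mathcal{L}^2(U,H)$, and for $x\in H$ let $X^x\in L^2(\Omega;E)$, $E:=C([0,T];H)\cap L^2(0,T;V)$, be the unique variational solution of $$dX+AX\,dt=g(X)\,dt+G\,dW,\qquad X(0)=x.$$ Then the solution map $x\mapsto X^x:H\to L^2(\Omega;E)$ is continuously Fréchet differentiable with bounded derivative. Moreover, for any $h\in H$, setting $Y_h:=(DX)h$ (the Fréchet derivative of the solution map at $x$ applied to $h$), one has $$Y_h'+AY_h=g'(X^x)Y_h,\qquad Y_h(0)=h,$$ in the variational sense.
   Context: $D\subseteq\mathbb{R}^n$ is a smooth bounded domain, $H:=L^2(D)$ with norm $\|\cdot\|$ and scalar product $\langle\cdot,\cdot\rangle$. $V$ is a separable Hilbert space densely, continuously and compactly embedded in $H$; $V\subset H\subset V'$ (with $H$ identified with its dual) and $\langle\cdot,\cdot\rangle$ also denotes the duality between $V'$ and $V$. $\mathcal{L}(E,F)$ and $\mathcal{L}^2(E,F)$ are the spaces of bounded linear and Hilbert-Schmidt operators. Assumptions on $A\in\mathcal{L}(V,V')$: (i) there is $c_A>0$ with $\langle Av,v\rangle\ge c_A\|v\|_V^2$ for all $v\in V$; (ii) the part of $A$ in $H$ extends uniquely to an $m$-accretive operator $A_1$ on $L^1(D)$; (iii) for every $\delta>0$ the resolvent $(I+\delta A_1)^{-1}$ is sub-Markovian: if $f\in L^1(D)$, $0\le f\le1$ a.e., then $0\le(I+\delta A_1)^{-1}f\le1$ a.e.; (iv) there is $m\in\mathbb{N}$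 such that $(I+\delta A_1)^{-m}\in\mathcal{L}(L^1(D),L^\infty(D))$ for every $\delta>0$. $U$ is a separable Hilbert space and $W$ a cylindrical Wiener process on $U$ on a filtered probability space $(\Omega,\mathcal{F},(\mathcal{F}_t)_{t\in[0,T]},\mathbb{P})$ satisfying the usual conditions. $C^2_b(\mathbb{R})$: twice continuously differentiable functions with bounded first and second derivatives. "In the variational sense" means: the process is adapted, belongs to $L^2(\Omega;E)$, and satisfies the corresponding integral equation in $V'$ for all $t\in[0,T]$, $\mathbb{P}$-a.s. (e.g. $X(t)+\int_0^tAX(s)\,ds=x+\int_0^tg(X(s))\,ds+\int_0^tG\,dW(s)$); $g(X)$ and $g'(X)Y$ are pointwise on $D$. *)

theory Defs
  imports "HOL-Probability.Probability"
begin

section \<open>Smooth bounded domains\<close>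

fun C_k_on :: "nat \<Rightarrow> 'a::euclidean_space set \<Rightarrow> ('a \<Rightarrow> real) \<Rightarrow> bool" where
  "C_k_on 0 S f = continuous_on S f"
| "C_k_on (Suc k) S f = ((\<forall>x\<in>S. f differentiable (at x)) \<and>
     (\<forall>b\<in>Basis. C_k_on k S (\<lambda>x. frechet_derivative f (at x) b)))"

definition smooth_on :: "'a::euclidean_space set \<Rightarrow> ('a \<Rightarrow> real) \<Rightarrow> bool" where
  "smooth_on S f \<longleftrightarrow> (\<forall>k. C_k_on k S f)"

text \<open>The boundary is smooth in the sense of local defining functions: near each boundary point,
  the domain is a strict sublevel set of a smooth function with nonvanishing gradient.\<close>

definition smooth_bounded_domain :: "'a::euclidean_space set \<Rightarrow> bool" where
  "smooth_bounded_domain D \<longleftrightarrow> D \<noteq> {} \<and> open D \<and> connected D \<and> bounded D \<and>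
     (\<forall>p\<in>frontier D. \<exists>N \<rho>. open N \<and> p \<in> N \<and> smooth_on N \<rho> \<and>
        (\<forall>x\<in>N. \<exists>b\<in>Basis. frechet_derivative \<rho> (at x) b \<noteq> 0) \<and>
        D \<inter> N = {x\<in>N. \<rho> x < 0})"


section \<open>Function spaces\<close>

text \<open>The spaces \<open>L\<^sup>p(M; B)\<close> depend on a measure, hence cannot be HOL types with their norm as a type
  class instance. Instead a normed space \<open>'l\<close> is said to be \<open>L\<^sup>p(M; B)\<close> via \<open>rep\<close> if \<open>rep\<close> picks a
  representative of each class and induces a linear isometry of \<open>'l\<close> onto the (Bochner) space of
  classes modulo almost everywhere equality. This determines \<open>'l\<close> up to isometric isomorphism.
  (If the norm of \<open>'l\<close> comes from an inner product, that is then the \<open>L\<^sup>2\<close> scalar product, by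
  polarization.)\<close>

definition is_Lp_space ::
  "nat \<Rightarrow> 'x measure \<Rightarrow> ('l::real_normed_vector \<Rightarrow> 'x \<Rightarrow> 'b::{banach, second_countable_topology}) \<Rightarrow> bool"
  where
  "is_Lp_space p M rep \<longleftrightarrow>
     (\<forall>u. rep u \<in> borel_measurable M \<and> integrable M (\<lambda>x. norm (rep u x) ^ p) \<and>
          norm u ^ p = (LINT x|M. norm (rep u x) ^ p)) \<and>
     (\<forall>u v. AE x in M. rep (u + v) x = rep u x + rep v x) \<and>
     (\<forall>c u. AE x in M. rep (c *\<^sub>R u) x = c *\<^sub>R rep u x) \<and>
     (\<forall>f\<in>borel_measurable M. integrable M (\<lambda>x. norm (f x) ^ p) \<longrightarrow>
          (\<exists>u. AE x in M. rep u x = f x))"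

text \<open>The element represented by a given function; used to form \<open>g(u)\<close> and \<open>g'(u) y\<close> in \<open>L\<^sup>2(D)\<close>.\<close>

definition class_of :: "'x measure \<Rightarrow> ('l \<Rightarrow> 'x \<Rightarrow> 'b) \<Rightarrow> ('x \<Rightarrow> 'b) \<Rightarrow> 'l" where
  "class_of M rep f = (THE u. AE x in M. rep u x = f x)"

text \<open>Dense, continuous and compact embedding \<open>j\<close> of \<open>V\<close> in \<open>H\<close>.\<close>

definition dense_compact_embedding ::
  "('v::real_normed_vector \<Rightarrow> 'h::real_normed_vector) \<Rightarrow> bool" where
  "dense_compact_embedding j \<longleftrightarrow> bounded_linear j \<and> inj j \<and> closure (range j) = UNIV \<and>
     (\<forall>B. bounded B \<longrightarrow> compact (closure (j ` B)))"

text \<open>Paths in \<open>C([0,T];H) \<inter> L\<^sup>2(0,T;V)\<close>. Since the Lebesgue measure is complete, the value of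
  \<open>inv j\<close> on the null set of times where the path is not in \<open>V\<close> is irrelevant.\<close>

definition path_in_E :: "real \<Rightarrow> ('v::{real_inner, banach, second_countable_topology} \<Rightarrow> 'h::real_inner)
    \<Rightarrow> (real \<Rightarrow> 'h) \<Rightarrow> bool" where
  "path_in_E T j u \<longleftrightarrow> continuous_on {0..T} u \<and>
     (AE t in lebesgue_on {0..T}. u t \<in> range j) \<and>
     (\<lambda>t. inv j (u t)) \<in> borel_measurable (lebesgue_on {0..T}) \<and>
     integrable (lebesgue_on {0..T}) (\<lambda>t. (norm (inv j (u t)))\<^sup>2)"

text \<open>The normed space \<open>'e\<close> is \<open>E = C([0,T];H) \<inter> L\<^sup>2(0,T;V)\<close>, with evaluation \<open>evE u t = u(t)\<close>.\<close>

definition is_E_space :: "real \<Rightarrow> ('v::{real_inner, banach, second_countable_topology} \<Rightarrow> 'h::real_inner)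
    \<Rightarrow> ('e::real_normed_vector \<Rightarrow> real \<Rightarrow> 'h) \<Rightarrow> bool" where
  "is_E_space T j evE \<longleftrightarrow>
     (\<forall>u. path_in_E T j (evE u) \<and>
          norm u = (SUP t\<in>{0..T}. norm (evE u t)) +
                   sqrt (LINT t|lebesgue_on {0..T}. (norm (inv j (evE u t)))\<^sup>2)) \<and>
     (\<forall>u v. \<forall>t\<in>{0..T}. evE (u + v) t = evE u t + evE v t) \<and>
     (\<forall>c u. \<forall>t\<in>{0..T}. evE (c *\<^sub>R u) t = c *\<^sub>R evE u t) \<and>
     (\<forall>\<phi>. path_in_E T j \<phi> \<longrightarrow> (\<exists>u. \<forall>t\<in>{0..T}. evE u t = \<phi> t))"


section \<open>The operator\<close>

text \<open>Unbounded operators are given by their graphs.\<close>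

definition m_accretive :: "('b::real_normed_vector \<times> 'b) set \<Rightarrow> bool" where
  "m_accretive B \<longleftrightarrow> subspace B \<and> single_valued B \<and>
     (\<forall>\<delta>>0. \<forall>(x, y)\<in>B. \<forall>(x', y')\<in>B. norm (x - x') \<le> norm (x - x' + \<delta> *\<^sub>R (y - y'))) \<and>
     (\<forall>\<delta>>0. \<forall>f. \<exists>(x, y)\<in>B. x + \<delta> *\<^sub>R y = f)"

text \<open>\<open>(I + \<delta>B)\<^sup>-\<^sup>1 f\<close>\<close>

definition resolvent :: "('b::real_normed_vector \<times> 'b) set \<Rightarrow> real \<Rightarrow> 'b \<Rightarrow> 'b" where
  "resolvent B \<delta> f = (THE x. \<exists>y. (x, y) \<in> B \<and> x + \<delta> *\<^sub>R y = f)"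

text \<open>The graph of the part of \<open>A\<close> in \<open>H = L\<^sup>2(D)\<close>, that is, of \<open>v \<mapsto> A v\<close> on
  \<open>{v \<in> V. A v \<in> H}\<close>, as a subset of \<open>L\<^sup>1(D) \<times> L\<^sup>1(D)\<close>.\<close>

definition part_graph_L1 :: "'a::euclidean_space set \<Rightarrow> ('h::real_inner \<Rightarrow> 'a \<Rightarrow> real) \<Rightarrow> ('l \<Rightarrow> 'a \<Rightarrow> real)
    \<Rightarrow> ('v::real_normed_vector \<Rightarrow> 'h) \<Rightarrow> ('v \<Rightarrow>\<^sub>L ('v \<Rightarrow>\<^sub>L real)) \<Rightarrow> ('l \<times> 'l) set" where
  "part_graph_L1 D repH rep1 j A = {(a, b). \<exists>v f. (\<forall>w. blinfun_apply (blinfun_apply A v) w = f \<bullet> j w) \<and>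
     (AE x in lebesgue_on D. rep1 a x = repH (j v) x) \<and>
     (AE x in lebesgue_on D. rep1 b x = repH f x)}"

definition coercive :: "('v::real_normed_vector \<Rightarrow>\<^sub>L ('v \<Rightarrow>\<^sub>L real)) \<Rightarrow> bool" where
  "coercive A \<longleftrightarrow> (\<exists>c>0. \<forall>v. blinfun_apply (blinfun_apply A v) v \<ge> c * (norm v)\<^sup>2)"

definition sub_Markovian :: "'a::euclidean_space set \<Rightarrow> ('l \<Rightarrow> 'a \<Rightarrow> real) \<Rightarrow> ('l \<Rightarrow> 'l) \<Rightarrow> bool" where
  "sub_Markovian D rep1 R \<longleftrightarrow>
     (\<forall>f. (AE x in lebesgue_on D. 0 \<le> rep1 f x \<and> rep1 f x \<le> 1) \<longrightarrow>
          (AE x in lebesgue_on D. 0 \<le> rep1 (R f) x \<and> rep1 (R f) x \<le> 1))"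

text \<open>Boundedness from \<open>L\<^sup>1(D)\<close> to \<open>L\<^sup>\<infinity>(D)\<close>, for linear \<open>R\<close>.\<close>

definition bounded_L1_Linf :: "'a::euclidean_space set \<Rightarrow> ('l::real_normed_vector \<Rightarrow> 'a \<Rightarrow> real) \<Rightarrow> ('l \<Rightarrow> 'l) \<Rightarrow> bool"
  where
  "bounded_L1_Linf D rep1 R \<longleftrightarrow>
     (\<exists>C. \<forall>f. AE x in lebesgue_on D. \<bar>rep1 (R f) x\<bar> \<le> C * norm f)"


section \<open>The noise\<close>

definition usual_conditions :: "'w measure \<Rightarrow> real \<Rightarrow> (real \<Rightarrow> 'w measure) \<Rightarrow> bool" where
  "usual_conditions M T F \<longleftrightarrow>
     (\<forall>t\<in>{0..T}. subalgebra M (F t)) \<and>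
     (\<forall>s\<in>{0..T}. \<forall>t\<in>{s..T}. sets (F s) \<subseteq> sets (F t)) \<and>
     (\<forall>t\<in>{0..<T}. sets (F t) = (\<Inter>s\<in>{t<..T}. sets (F s))) \<and>
     (\<forall>N\<in>null_sets M. \<forall>S\<subseteq>N. S \<in> sets (F 0))"

text \<open>\<open>W t u\<close> is the action of \<open>W(t)\<close> on \<open>u \<in> U\<close>. By linearity in \<open>u\<close>, the Gaussian increments
  have covariance \<open>(t - s) \<langle>u, v\<rangle>\<close> and are jointly independent of the past.\<close>

definition cylindrical_Wiener_process ::
  "'w measure \<Rightarrow> real \<Rightarrow> (real \<Rightarrow> 'w measure) \<Rightarrow> (real \<Rightarrow> 'u::real_inner \<Rightarrow> 'w \<Rightarrow> real) \<Rightarrow> bool" where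
  "cylindrical_Wiener_process M T F W \<longleftrightarrow>
     (\<forall>t\<in>{0..T}. \<forall>u. W t u \<in> borel_measurable (F t)) \<and>
     (\<forall>t\<in>{0..T}. \<forall>a b u v. AE \<omega> in M. W t (a *\<^sub>R u + b *\<^sub>R v) \<omega> = a * W t u \<omega> + b * W t v \<omega>) \<and>
     (\<forall>u. AE \<omega> in M. W 0 u \<omega> = 0) \<and>
     (\<forall>u. AE \<omega> in M. continuous_on {0..T} (\<lambda>t. W t u \<omega>)) \<and>
     (\<forall>s t u. 0 \<le> s \<and> s < t \<and> t \<le> T \<and> u \<noteq> 0 \<longrightarrow>
        distributed M lborel (\<lambda>\<omega>. W t u \<omega> - W s u \<omega>) (normal_density 0 (sqrt (t - s) * norm u)) \<and>
        prob_space.indep_set M (sets (F s))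
          (sets (vimage_algebra (space M) (\<lambda>\<omega>. W t u \<omega> - W s u \<omega>) borel)))"

definition orthonormal_basis :: "'u::real_inner set \<Rightarrow> bool" where
  "orthonormal_basis B \<longleftrightarrow> pairwise orthogonal B \<and> (\<forall>e\<in>B. norm e = 1) \<and> closure (span B) = UNIV"

definition Hilbert_Schmidt :: "('u::real_inner \<Rightarrow>\<^sub>L 'h::real_inner) \<Rightarrow> bool" where
  "Hilbert_Schmidt G \<longleftrightarrow>
     (\<exists>B. orthonormal_basis B \<and> (\<lambda>e. (norm (blinfun_apply G e))\<^sup>2) summable_on B)"

text \<open>\<open>I\<close> is a continuous version of the stochastic integral \<open>\<integral>\<^sub>0\<^sup>t G dW(s) = \<Sum>\<^sub>e W(t)e \<cdot> G e\<close> of the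
  constant integrand \<open>G\<close>; the series over an orthonormal basis of \<open>U\<close> converges in \<open>L\<^sup>2(\<Omega>;H)\<close>, and
  its sum does not depend on the basis.\<close>

definition stochastic_integral :: "'w measure \<Rightarrow> real \<Rightarrow> (real \<Rightarrow> 'w measure)
    \<Rightarrow> (real \<Rightarrow> 'u::real_inner \<Rightarrow> 'w \<Rightarrow> real) \<Rightarrow> ('u \<Rightarrow>\<^sub>L 'h::real_inner) \<Rightarrow> (real \<Rightarrow> 'w \<Rightarrow> 'h) \<Rightarrow> bool" where
  "stochastic_integral M T F W G I \<longleftrightarrow>
     (\<forall>t\<in>{0..T}. I t \<in> borel_measurable (F t)) \<and>
     (AE \<omega> in M. continuous_on {0..T} (\<lambda>t. I t \<omega>)) \<and>
     (\<exists>B. orthonormal_basis B \<and> (\<forall>t\<in>{0..T}.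
        ((\<lambda>S. \<integral>\<^sup>+\<omega>. ennreal ((norm (I t \<omega> - (\<Sum>e\<in>S. W t e \<omega> *\<^sub>R blinfun_apply G e)))\<^sup>2) \<partial>M) \<longlongrightarrow> 0)
          (finite_subsets_at_top B)))"


section \<open>Variational solutions\<close>

definition C2_b :: "(real \<Rightarrow> real) \<Rightarrow> bool" where
  "C2_b g \<longleftrightarrow> (\<forall>r. g field_differentiable (at r)) \<and> (\<forall>r. deriv g field_differentiable (at r)) \<and>
     continuous_on UNIV (deriv (deriv g)) \<and>
     bounded (range (deriv g)) \<and> bounded (range (deriv (deriv g)))"

text \<open>The embedding \<open>H \<subseteq> V'\<close>.\<close>

definition to_dual :: "('v::real_normed_vector \<Rightarrow> 'h::real_inner) \<Rightarrow> 'h \<Rightarrow> ('v \<Rightarrow>\<^sub>L real)" where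
  "to_dual j h = Blinfun (\<lambda>v. h \<bullet> j v)"

text \<open>The integral over \<open>[0,t]\<close> of a \<open>V'\<close>-valued function, characterized by its action on \<open>V\<close>; for
  Bochner integrable functions, such as those below, it is the Bochner integral. (The library's
  Bochner integral needs a second countable codomain, which is not available for \<open>\<Rightarrow>\<^sub>L\<close> here.)\<close>

definition dual_integral :: "real \<Rightarrow> (real \<Rightarrow> ('v::real_normed_vector \<Rightarrow>\<^sub>L real)) \<Rightarrow> ('v \<Rightarrow>\<^sub>L real)" where
  "dual_integral t f = Blinfun (\<lambda>v. LINT s|lebesgue_on {0..t}. blinfun_apply (f s) v)"

text \<open>The \<open>E\<close>-valued random variable \<open>Z\<close> is adapted and satisfies, almost surely for all \<open>t\<close>,
  \<open>Z(t) + \<integral>\<^sub>0\<^sup>t A Z(s) ds = x + \<integral>\<^sub>0\<^sup>t f(Z(s)) ds + I(t)\<close> in \<open>V'\<close>; here \<open>f\<close> may depend on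
  \<open>\<omega>\<close> and \<open>s\<close>.\<close>

definition variational_solution :: "'w measure \<Rightarrow> real \<Rightarrow> (real \<Rightarrow> 'w measure)
    \<Rightarrow> ('v::{real_inner, banach, second_countable_topology} \<Rightarrow> 'h::real_inner) \<Rightarrow> ('v \<Rightarrow>\<^sub>L ('v \<Rightarrow>\<^sub>L real))
    \<Rightarrow> ('e \<Rightarrow> real \<Rightarrow> 'h) \<Rightarrow> ('w \<Rightarrow> real \<Rightarrow> 'h \<Rightarrow> 'h) \<Rightarrow> (real \<Rightarrow> 'w \<Rightarrow> 'h) \<Rightarrow> 'h \<Rightarrow> ('w \<Rightarrow> 'e) \<Rightarrow> bool" where
  "variational_solution M T F j A evE f I x Z \<longleftrightarrow>
     (\<forall>t\<in>{0..T}. (\<lambda>\<omega>. evE (Z \<omega>) t) \<in> borel_measurable (F t)) \<and>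
     (AE \<omega> in M. \<forall>t\<in>{0..T}.
        to_dual j (evE (Z \<omega>) t) + dual_integral t (\<lambda>s. blinfun_apply A (inv j (evE (Z \<omega>) s)))
        = to_dual j x + dual_integral t (\<lambda>s. to_dual j (f \<omega> s (evE (Z \<omega>) s))) + to_dual j (I t \<omega>))"

end

theory Submission
  imports Defs
begin

text \<open>
  The noise is additive, so the difference of two solutions with the same noise path solves a
  parabolic equation without noise, and everything can be estimated for one \<open>\<omega>\<close> at a time, with constants that
  do not depend on \<open>\<omega>\<close>. Testing with the difference, coercivity of \<open>A\<close> and Gronwall's inequality bound it in
  \<open>E = C([0,T]; H) \<inter> L\<^sup>2(0,T; V)\<close> by its initial value and by the inhomogeneous part of its forcing
  (\<open>parabolic_a_priori_estimate\<close>). In particular the solution map is Lipschitz.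

  The difficulty is that \<open>u \<mapsto> g(u)\<close> is in general only Gateaux differentiable in \<open>L\<^sup>2(D)\<close>: the error of the
  linearization of a difference quotient, \<open>(g(u + \<epsilon>w) - g(u)) / \<epsilon> - g'(u) w\<close>, is bounded by
  \<open>min (2L) (K\<epsilon>\<bar>w\<bar>) \<bar>w\<bar>\<close>. It tends to \<open>0\<close> in \<open>L\<^sup>2(D)\<close> for every \<open>w\<close>, and uniformly on families of \<open>w\<close> with
  uniformly integrable squares (\<open>norm_N_quot_diff_le\<close>). The compact embedding of \<open>V\<close> in \<open>H\<close> supplies such
  families. A path that is bounded in \<open>E\<close> takes its values in a bounded subset of \<open>V\<close>, which is relatively compact in \<open>H\<close>, except
  for a set of times of small measure, on which it is still bounded in \<open>H\<close>. Therefore the squares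
  of all paths in a ball of \<open>E\<close> are uniformly integrable on \<open>[0,T] \<times> D\<close> (\<open>tail_embedding_small\<close>,
  \<open>tail_path_integral_le\<close>).

  The quotients \<open>(X\<^bsup>x + \<epsilon>h\<^esup> - X\<^bsup>x\<^esup>) / \<epsilon>\<close> with \<open>norm h \<le> 1\<close> are bounded in \<open>E\<close> by the Lipschitz estimate. Two of them,
  for different \<open>\<epsilon>\<close>, solve the same linear equation up to such errors, so they form a Cauchy family as \<open>\<epsilon>\<close> tends to \<open>0\<close>,
  uniformly in \<open>x\<close>, \<open>h\<close> and \<open>\<omega>\<close> (\<open>quotients_uniformly_Cauchy\<close>). For a Lipschitz map, this
  uniformity alone implies continuous Frechet differentiability with bounded derivative
  (\<open>uniformly_Cauchy_quotients_imp_C1\<close>). The existence of solutions of the linearized equation comes out of it as well: the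
  limits of the quotients are such solutions (\<open>linearized_limit\<close>).
\<close>

section \<open>Gronwall's inequality and averages over short intervals\<close>

text \<open>The function \<open>exp (- b * t) * (a + b * integral {0..t} \<phi>)\<close> is nonincreasing.\<close>

lemma gronwall:
  fixes \<phi> :: "real \<Rightarrow> real"
  assumes cont: "continuous_on {0..T} \<phi>" and b: "b \<ge> 0"
    and le: "\<And>t. t \<in> {0..T} \<Longrightarrow> \<phi> t \<le> a + b * integral {0..t} \<phi>"
    and t: "t \<in> {0..T}"
  shows "\<phi> t \<le> a * exp (b * t)"
proof -
  define I where "I s = integral {0..s} \<phi>" for s
  define \<psi> where "\<psi> s = exp (- (b * s)) * (a + b * I s)" for s
  have I: "(I has_real_derivative \<phi> s) (at s within {0..T})" if "s \<in> {0..T}" for s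
    unfolding I_def has_real_derivative_iff_has_vector_derivative
    by (rule integral_has_vector_derivative[OF cont that])
  have \<psi>: "(\<psi> has_real_derivative exp (- (b * s)) * (b * (\<phi> s - (a + b * I s)))) (at s within {0..T})"
    if "s \<in> {0..T}" for s
    unfolding \<psi>_def by (rule derivative_eq_intros I[OF that] refl)+ (simp add: algebra_simps)
  have "\<psi> t \<le> \<psi> 0"
  proof (rule DERIV_nonpos_imp_decreasing_open[of 0 t \<psi>])
    fix s assume s: "0 < s" "s < t"
    with t have s': "s \<in> {0..T}" "s \<in> {0<..<T}" by auto
    have "(\<psi> has_real_derivative exp (- (b * s)) * (b * (\<phi> s - (a + b * I s)))) (at s)"
      using \<psi>[OF s'(1)] s'(2) at_within_Icc_at[of 0 s T] by simp
    moreover have "exp (- (b * s)) * (b * (\<phi> s - (a + b * I s))) \<le> 0"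
      using le[OF s'(1)] b by (simp add: I_def mult_nonneg_nonpos)
    ultimately show "\<exists>y. (\<psi> has_real_derivative y) (at s) \<and> y \<le> 0" by blast
  next
    have "continuous_on {0..T} \<psi>" using \<psi> by (rule DERIV_continuous_on)
    then show "continuous_on {0..t} \<psi>" by (rule continuous_on_subset) (use t in auto)
  qed (use t in auto)
  then have "a + b * I t \<le> a * exp (b * t)"
    by (simp add: \<psi>_def I_def exp_minus field_simps)
  with le[OF t] show ?thesis by (simp add: I_def)
qed

lemma integral_average_tendsto:
  fixes z :: "real \<Rightarrow> 'h::banach"
  assumes cont: "continuous_on {a..b} z" and t: "t \<in> {a..b}"
    and h: "\<And>n. h n > 0" "\<And>n. t + h n \<le> b" "h \<longlonglongrightarrow> 0"
  shows "(\<lambda>n. integral {t..t + h n} z /\<^sub>R h n) \<longlonglongrightarrow> z t"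
proof (rule LIMSEQ_I)
  fix e :: real assume e: "e > 0"
  obtain d where d: "d > 0" "\<And>s. s \<in> {a..b} \<Longrightarrow> dist s t < d \<Longrightarrow> dist (z s) (z t) < e / 2"
    using cont t e unfolding continuous_on_iff by (metis half_gt_zero)
  obtain n0 where n0: "\<And>n. n \<ge> n0 \<Longrightarrow> norm (h n - 0) < d"
    using LIMSEQ_D[OF h(3) d(1)] by blast
  show "\<exists>n0. \<forall>n\<ge>n0. norm (integral {t..t + h n} z /\<^sub>R h n - z t) < e"
  proof (intro exI allI impI)
    fix n assume "n \<ge> n0"
    then have hn: "h n < d" using n0[of n] h(1)[of n] by simp
    have c: "continuous_on {t..t + h n} z"
      by (rule continuous_on_subset[OF cont]) (use t h(2)[of n] in auto)
    have "norm (integral {t..t + h n} (\<lambda>s. z s - z t)) \<le> (e / 2) * (t + h n - t)"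
    proof (rule integral_bound)
      fix s assume "s \<in> {t..t + h n}"
      then have "s \<in> {a..b}" "dist s t < d" using t h(2)[of n] hn by (auto simp: dist_real_def)
      from d(2)[OF this] show "norm (z s - z t) \<le> e / 2" by (simp add: dist_norm)
    qed (use h(1)[of n] c in \<open>auto intro!: continuous_intros\<close>)
    also have "integral {t..t + h n} (\<lambda>s. z s - z t) = integral {t..t + h n} z - h n *\<^sub>R z t"
      using c h(1)[of n] by (subst integral_diff) (auto intro: integrable_continuous_real)
    finally have le: "norm (integral {t..t + h n} z - h n *\<^sub>R z t) \<le> e / 2 * h n" by simp
    have "integral {t..t + h n} z /\<^sub>R h n - z t = (integral {t..t + h n} z - h n *\<^sub>R z t) /\<^sub>R h n"
      using h(1)[of n] by (simp add: scaleR_diff_right)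
    also have "norm \<dots> = norm (integral {t..t + h n} z - h n *\<^sub>R z t) / h n"
      using h(1)[of n] by (simp add: divide_inverse_commute)
    also have "\<dots> \<le> e / 2" using le h(1)[of n] by (simp add: divide_le_eq)
    also have "\<dots> < e" using e by simp
    finally show "norm (integral {t..t + h n} z /\<^sub>R h n - z t) < e" .
  qed
qed

text \<open>Lebesgue's differentiation theorem for Bochner integrable functions. The scalar theorem, applied to
  the functions \<open>u \<mapsto> norm (f u - d)\<close> with \<open>d\<close> in a countable dense set, gives one null set outside of
  which the averages of \<open>f\<close> end up within \<open>2 * norm (f s - d)\<close> of \<open>f s\<close>, and \<open>d\<close> can be taken close to \<open>f s\<close>.\<close>

lemma AE_average_tendsto:
  fixes f :: "real \<Rightarrow> 'v::{banach, second_countable_topology}"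
  assumes f: "integrable lebesgue f"
    and h: "\<And>n. h n > (0::real)" "h \<longlonglongrightarrow> 0"
  shows "AE s in lebesgue. (\<lambda>n. (LINT u|lebesgue_on {s..s + h n}. f u) /\<^sub>R h n) \<longlonglongrightarrow> f s"
proof -
  obtain D :: "'v set" where D: "countable D" "\<And>X. open X \<Longrightarrow> X \<noteq> {} \<Longrightarrow> \<exists>d\<in>D. d \<in> X"
    using countable_dense_exists by blast
  have intf: "integrable (lebesgue_on {a..b}) f" for a b
    using f by (auto simp: integrable_restrict_space set_integrable_def intro!: integrable_mult_indicator)
  have int: "integrable (lebesgue_on {a..b}) (\<lambda>u. norm (f u - d))" for a b d
    by (intro integrable_norm Bochner_Integration.integrable_diff intf finite_measure.integrable_const
        finite_measure_lebesgue_on) simp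
  have "AE s in lebesgue. (\<lambda>n. (LINT u|lebesgue_on {s..s + h n}. norm (f u - d)) / h n) \<longlonglongrightarrow> norm (f s - d)" for d
  proof -
    have "\<And>a b::real. (\<lambda>u. norm (f u - d)) integrable_on cbox a b"
      using integrable_on_lebesgue_on[OF int] by simp
    from integrable_ccontinuous_explicit[OF this] obtain N where N: "negligible N"
      "\<And>x e. x \<notin> N \<Longrightarrow> 0 < e \<Longrightarrow> \<exists>d'>0. \<forall>h. 0 < h \<and> h < d' \<longrightarrow>
          norm (integral (cbox x (x + h *\<^sub>R One)) (\<lambda>u. norm (f u - d)) /\<^sub>R h ^ DIM(real) - norm (f x - d)) < e"
      by blast
    have "(\<lambda>n. (LINT u|lebesgue_on {s..s + h n}. norm (f u - d)) / h n) \<longlonglongrightarrow> norm (f s - d)" if s: "s \<notin> N" for s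
    proof (rule LIMSEQ_I)
      fix e :: real assume "e > 0"
      from N(2)[OF s this] obtain d' where d': "d' > 0"
        "\<And>h. 0 < h \<Longrightarrow> h < d' \<Longrightarrow> norm (integral {s..s + h} (\<lambda>u. norm (f u - d)) /\<^sub>R h - norm (f s - d)) < e"
        by auto
      obtain n0 where n0: "\<And>n. n \<ge> n0 \<Longrightarrow> norm (h n - 0) < d'"
        using LIMSEQ_D[OF h(2) d'(1)] by blast
      show "\<exists>n0. \<forall>n\<ge>n0. norm ((LINT u|lebesgue_on {s..s + h n}. norm (f u - d)) / h n - norm (f s - d)) < e"
      proof (intro exI allI impI)
        fix n assume "n \<ge> n0"
        then have "h n < d'" using n0[of n] by simp
        with d'(2)[OF h(1)[of n]] show "norm ((LINT u|lebesgue_on {s..s + h n}. norm (f u - d)) / h n - norm (f s - d)) < e"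
          by (subst lebesgue_integral_eq_integral[OF int]) (auto simp: divide_inverse_commute)
      qed
    qed
    with N(1) show ?thesis
      unfolding negligible_iff_null_sets by (intro AE_I'[of N]) auto
  qed
  then have "AE s in lebesgue. \<forall>d\<in>D. (\<lambda>n. (LINT u|lebesgue_on {s..s + h n}. norm (f u - d)) / h n) \<longlonglongrightarrow> norm (f s - d)"
    using D(1) by (subst AE_ball_countable) auto
  then show ?thesis
  proof (eventually_elim)
    fix s assume s: "\<forall>d\<in>D. (\<lambda>n. (LINT u|lebesgue_on {s..s + h n}. norm (f u - d)) / h n) \<longlonglongrightarrow> norm (f s - d)"
    show "(\<lambda>n. (LINT u|lebesgue_on {s..s + h n}. f u) /\<^sub>R h n) \<longlonglongrightarrow> f s"
    proof (rule LIMSEQ_I)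
      fix e :: real assume e: "e > 0"
      have "\<exists>d\<in>D. d \<in> ball (f s) (e / 3)"
        using e by (intro D(2)) auto
      then obtain d where d: "d \<in> D" "norm (f s - d) < e / 3"
        by (auto simp: dist_norm)
      from s d(1) have "(\<lambda>n. (LINT u|lebesgue_on {s..s + h n}. norm (f u - d)) / h n) \<longlonglongrightarrow> norm (f s - d)" by blast
      from LIMSEQ_D[OF this, of "e / 3"] e obtain n0 where
        n0: "\<And>n. n \<ge> n0 \<Longrightarrow> norm ((LINT u|lebesgue_on {s..s + h n}. norm (f u - d)) / h n - norm (f s - d)) < e / 3"
        by auto
      show "\<exists>n0. \<forall>n\<ge>n0. norm ((LINT u|lebesgue_on {s..s + h n}. f u) /\<^sub>R h n - f s) < e"
      proof (intro exI allI impI)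
        fix n assume n: "n \<ge> n0"
        let ?m = "lebesgue_on {s..s + h n}"
        have m: "measure ?m {s..s + h n} = h n"
          using h(1)[of n] by (simp add: measure_restrict_space)
        have "(LINT u|?m. f u - d) = (LINT u|?m. f u) - h n *\<^sub>R d"
          using intf by (subst Bochner_Integration.integral_diff) (auto simp: m)
        then have "norm ((LINT u|?m. f u) - h n *\<^sub>R d) \<le> (LINT u|?m. norm (f u - d))"
          by (metis integral_norm_bound)
        then have "norm ((LINT u|?m. f u) - h n *\<^sub>R d) / h n \<le> (LINT u|?m. norm (f u - d)) / h n"
          using h(1)[of n] by (simp add: divide_right_mono)
        also have "\<dots> < 2 * e / 3" using n0[OF n] d(2) unfolding real_norm_def by linarith
        finally have 1: "norm ((LINT u|?m. f u) - h n *\<^sub>R d) / h n < 2 * e / 3" .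
        have "(LINT u|?m. f u) /\<^sub>R h n - f s = ((LINT u|?m. f u) - h n *\<^sub>R d) /\<^sub>R h n + (d - f s)"
          using h(1)[of n] by (simp add: scaleR_diff_right)
        also have "norm \<dots> \<le> norm ((LINT u|?m. f u) - h n *\<^sub>R d) / h n + norm (d - f s)"
          using norm_triangle_ineq[of "((LINT u|?m. f u) - h n *\<^sub>R d) /\<^sub>R h n" "d - f s"] h(1)[of n]
          by (simp add: divide_inverse_commute)
        also have "\<dots> < e" using 1 d(2) norm_minus_commute[of d "f s"] by linarith
        finally show "norm ((LINT u|?m. f u) /\<^sub>R h n - f s) < e" .
      qed
    qed
  qed
qed

section \<open>The energy inequality for parabolic equations\<close>

text \<open>With the primitive \<open>Q\<close> of \<open>q\<close> the average is \<open>(Q (s + h) - Q s) / h\<close>. Its integral is the difference of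
  two averages of the nondecreasing function \<open>Q \<ge> 0\<close>, the first of which is at most \<open>Q (t + h)\<close>. This bounds
  integrals of averages without an exchange of the order of integration.\<close>

lemma integral_of_averages_le:
  fixes q :: "real \<Rightarrow> real"
  assumes cont: "continuous_on {0..T} q" and nn: "\<And>s. s \<in> {0..T} \<Longrightarrow> q s \<ge> 0"
    and t: "0 \<le> t" "h > 0" "t + h \<le> T"
  shows "(\<lambda>s. integral {s..s + h} q / h) integrable_on {0..t}"
    and "integral {0..t} (\<lambda>s. integral {s..s + h} q / h) \<le> integral {0..t + h} q"
    and "continuous_on {0..t} (\<lambda>s. integral {s..s + h} q / h)"
proof -
  define Q where "Q s = integral {0..s} q" for s
  have qi: "q integrable_on {a..b}" if "0 \<le> a" "b \<le> T" for a b
    using that by (intro integrable_continuous_real continuous_on_subset[OF cont]) auto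
  have Qc: "continuous_on {0..T} Q"
    unfolding Q_def using qi[of 0 T] by (intro indefinite_integral_continuous_1) auto
  have Qmono: "Q a \<le> Q b" if "0 \<le> a" "a \<le> b" "b \<le> T" for a b
    unfolding Q_def using that nn by (intro integral_subset_le qi) auto
  have eq: "integral {s..s + h} q = Q (s + h) - Q s" if "s \<in> {0..t}" for s
    using Henstock_Kurzweil_Integration.integral_combine[of 0 s "s + h" q] that t qi[of 0 "s + h"]
    by (simp add: Q_def)
  have c1: "continuous_on {0..t} (\<lambda>s. Q (s + h))"
    by (rule continuous_on_compose2[OF Qc]) (use t in \<open>auto intro!: continuous_intros\<close>)
  have c2: "continuous_on {0..t} Q"
    by (rule continuous_on_subset[OF Qc]) (use t in auto)
  have c3: "continuous_on {0..t} (\<lambda>s. (Q (s + h) - Q s) / h)"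
    using c1 c2 t by (intro continuous_intros) auto
  then show c: "continuous_on {0..t} (\<lambda>s. integral {s..s + h} q / h)"
    by (rule continuous_on_eq) (simp add: eq)
  then show "(\<lambda>s. integral {s..s + h} q / h) integrable_on {0..t}"
    by (rule integrable_continuous_real)
  have Qi: "Q integrable_on {a..b}" if "0 \<le> a" "b \<le> T" for a b
    using that by (intro integrable_continuous_real continuous_on_subset[OF Qc]) auto
  have shift: "integral {0..t} (\<lambda>s. Q (s + h)) = integral {h..t + h} Q"
    using integral_shift_Icc_real[of 0 t Q h] by (simp add: o_def add.commute)
  have "integral {0..t} (\<lambda>s. integral {s..s + h} q / h) = integral {0..t} (\<lambda>s. (Q (s + h) - Q s) / h)"
    by (rule Henstock_Kurzweil_Integration.integral_cong) (simp add: eq)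
  also have "\<dots> = (integral {0..t} (\<lambda>s. Q (s + h)) - integral {0..t} Q) / h"
    using c1 c2 by (simp add: Henstock_Kurzweil_Integration.integral_diff integrable_continuous_real)
  also have "\<dots> = (integral {h..t + h} Q - integral {0..t} Q) / h" using shift by simp
  also have "integral {h..t + h} Q - integral {0..t} Q = integral {t..t + h} Q - integral {0..h} Q"
    using Henstock_Kurzweil_Integration.integral_combine[of 0 h "t + h" Q] 
      Henstock_Kurzweil_Integration.integral_combine[of 0 t "t + h" Q] t Qi[of 0 "t + h"] by simp
  also have "integral {t..t + h} Q - integral {0..h} Q \<le> integral {t..t + h} Q"
  proof -
    have "0 \<le> integral {0..h} Q"
    proof (rule Henstock_Kurzweil_Integration.integral_nonneg)
      show "0 \<le> Q s" if "s \<in> {0..h}" for s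
        using Qmono[of 0 s] that t by (simp add: Q_def)
    qed (use Qi[of 0 h] t in auto)
    then show ?thesis by simp
  qed
  also have "integral {t..t + h} Q \<le> integral {t..t + h} (\<lambda>s. Q (t + h))"
    using t Qmono by (intro integral_le Qi) auto
  also have "\<dots> = h * Q (t + h)" using t by simp
  finally show "integral {0..t} (\<lambda>s. integral {s..s + h} q / h) \<le> integral {0..t + h} q"
    using t by (simp add: divide_right_mono Q_def)
qed

lemma integral_combine_increment:
  fixes k :: "real \<Rightarrow> real"
  assumes "integrable (lebesgue_on {0..T}) k" "0 \<le> s" "s \<le> t" "t \<le> T"
  shows "(LINT u|lebesgue_on {0..t}. k u) - (LINT u|lebesgue_on {0..s}. k u) = (LINT u|lebesgue_on {s..t}. k u)"
proof -
  have i: "integrable (lebesgue_on {a..b}) k" if "0 \<le> a" "b \<le> T" for a b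
    by (rule integrable_subinterval[of 0 T]) (use assms that in auto)
  then have hk: "k integrable_on {0..t}" using assms by (intro integrable_on_lebesgue_on) auto
  show ?thesis
    using Henstock_Kurzweil_Integration.integral_combine[of 0 s t k] assms hk
    by (simp add: lebesgue_integral_eq_integral i)
qed

lemma integrable_lebesgue_on_subset:
  fixes f :: "'a::euclidean_space \<Rightarrow> 'b::{banach, second_countable_topology}"
  assumes "integrable (lebesgue_on S) f" "R \<subseteq> S" "R \<in> sets lebesgue" "S \<in> sets lebesgue"
  shows "integrable (lebesgue_on R) f"
  using set_integrable_subset[of lebesgue S f R] assms
  by (simp add: integrable_restrict_space set_integrable_def)

text \<open>The energy inequality for \<open>z' + A z = f\<close> in the dual of \<open>'v\<close>. The product \<open>z' \<bullet> z\<close> has no meaning for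
  such \<open>z\<close>, but it has for the Steklov averages \<open>w s\<close> of \<open>z\<close> over \<open>{s..s + h}\<close>: they are continuously
  differentiable in \<open>'h\<close> and they are the images under \<open>j\<close> of the averages \<open>\<omega> s\<close> of \<open>\<zeta>\<close>. Since \<open>A\<close> is linear
  and does not depend on time, averaging the equation gives \<open>w' \<bullet> w = - A \<omega> \<omega> + \<dots>\<close>, so that coercivity
  applies directly. As \<open>h\<close> tends to \<open>0\<close>, \<open>w\<close> converges to \<open>z\<close>, and Fatou's lemma keeps
  the integral of \<open>(norm \<zeta>)\<^sup>2\<close>, because \<open>\<omega>\<close> converges to \<open>\<zeta>\<close> almost everywhere. The averages reach beyond
  \<open>t\<close>, hence \<open>t < T\<close> here.\<close>

lemma parabolic_energy_inequality_interior:
  fixes j :: "'v::{banach, second_countable_topology} \<Rightarrow> 'h::{real_inner, banach, second_countable_topology}"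
    and A :: "'v \<Rightarrow> 'v \<Rightarrow> real" and T :: real
  assumes j: "bounded_linear j" and A: "bounded_bilinear A" and c: "c > 0" "\<And>v. A v v \<ge> c * (norm v)\<^sup>2"
    and z: "continuous_on {0..T} z"
    and \<zeta>: "integrable (lebesgue_on {0..T}) \<zeta>" "AE s in lebesgue_on {0..T}. j (\<zeta> s) = z s"
    and f: "\<And>v. integrable (lebesgue_on {0..T}) (\<lambda>s. f s \<bullet> j v)"
    and eq: "\<And>s t v. 0 \<le> s \<Longrightarrow> s \<le> t \<Longrightarrow> t \<le> T \<Longrightarrow>
      (z t - z s) \<bullet> j v = (LINT u|lebesgue_on {s..t}. f u \<bullet> j v - A (\<zeta> u) v)"
    and r: "continuous_on {0..T} r" "\<And>s. s \<in> {0..T} \<Longrightarrow> norm (f s) \<le> L * norm (z s) + r s" and L: "L \<ge> 0"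
    and t: "0 \<le> t" "t < T"
  defines "q \<equiv> \<lambda>s. (2 * L + 1) * (norm (z s))\<^sup>2 + (r s)\<^sup>2"
  shows "(norm (z t))\<^sup>2 + 2 * c * (LINT s|lebesgue_on {0..t}. (norm (\<zeta> s))\<^sup>2) \<le> (norm (z 0))\<^sup>2 + integral {0..t} q"
proof -
  \<comment> \<open>The widths are such that an average that starts before \<open>t\<close> ends before \<open>T\<close>.\<close>
  define h where "h n = (T - t) / real (Suc n)" for n
  have h: "h n > 0" "t + h n \<le> T" for n
    using t by (auto simp: h_def field_simps intro!: mult_right_mono)
  have h0: "h \<longlonglongrightarrow> 0"
    using tendsto_mult[OF tendsto_const[of "T - t"] LIMSEQ_inverse_real_of_nat]
    by (simp add: h_def[abs_def] divide_inverse)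
  define w where "w n s = integral {s..s + h n} z /\<^sub>R h n" for n s
  define \<omega> where "\<omega> n s = (LINT u|lebesgue_on {s..s + h n}. \<zeta> u) /\<^sub>R h n" for n s
  have \<zeta>i: "integrable (lebesgue_on {a..b}) \<zeta>" if "0 \<le> a" "b \<le> T" for a b
    by (rule integrable_lebesgue_on_subset[of "{0..T}"]) (use \<zeta> that in auto)
  have fi: "integrable (lebesgue_on {a..b}) (\<lambda>s. f s \<bullet> j v)" if "0 \<le> a" "b \<le> T" for a b v
    by (rule integrable_lebesgue_on_subset[of "{0..T}"]) (use f that in auto)
  have zc: "continuous_on {a..b} z" if "0 \<le> a" "b \<le> T" for a b
    by (rule continuous_on_subset[OF z]) (use that in auto)
  have zi: "z integrable_on {a..b}" if "0 \<le> a" "b \<le> T" for a b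
    using zc[OF that] by (rule integrable_continuous_real)
  have jz: "AE s in lebesgue_on {a..b}. j (\<zeta> s) = z s" if "0 \<le> a" "b \<le> T" for a b
    using \<zeta>(2) that by (auto simp: AE_restrict_space_iff elim!: eventually_mono)
  have winner: "w n s \<bullet> x = integral {s..s + h n} (\<lambda>u. z u \<bullet> x) / h n" if "s \<in> {0..t}" for n s x
  proof -
    have "integral {s..s + h n} z \<bullet> x = integral {s..s + h n} (\<lambda>u. z u \<bullet> x)"
      using integral_linear[OF zi bounded_linear_inner_left[of x], of s "s + h n"] that h(2)[of n]
      by (simp add: o_def)
    then show ?thesis by (simp add: w_def divide_inverse_commute)
  qed
  have j\<omega>: "j (\<omega> n s) = w n s" if s: "s \<in> {0..t}" for n s
  proof -
    have b: "0 \<le> s" "s + h n \<le> T" using s h(2)[of n] by auto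
    have "j (\<omega> n s) \<bullet> x = w n s \<bullet> x" for x
    proof -
      have bl: "bounded_linear (\<lambda>v. j v \<bullet> x)"
        using bounded_linear_compose[OF bounded_linear_inner_left j] .
      have "j (\<omega> n s) \<bullet> x = (LINT u|lebesgue_on {s..s + h n}. j (\<zeta> u) \<bullet> x) / h n"
        using integral_bounded_linear[OF bl \<zeta>i[OF b]] linear_simps(5)[OF j]
        by (simp add: \<omega>_def divide_inverse_commute)
      also have "(LINT u|lebesgue_on {s..s + h n}. j (\<zeta> u) \<bullet> x) = (LINT u|lebesgue_on {s..s + h n}. z u \<bullet> x)"
      proof (rule integral_cong_AE)
        show "(\<lambda>u. j (\<zeta> u) \<bullet> x) \<in> borel_measurable (lebesgue_on {s..s + h n})"
          using integrable_bounded_linear[OF bl \<zeta>i[OF b]] by simp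
        show "(\<lambda>u. z u \<bullet> x) \<in> borel_measurable (lebesgue_on {s..s + h n})"
          using zc[OF b] by (intro continuous_imp_measurable_on_sets_lebesgue continuous_intros) auto
        show "AE u in lebesgue_on {s..s + h n}. j (\<zeta> u) \<bullet> x = z u \<bullet> x"
          using jz[OF b] by eventually_elim simp
      qed
      also have "\<dots> = integral {s..s + h n} (\<lambda>u. z u \<bullet> x)"
        using zc[OF b] by (intro lebesgue_integral_eq_integral integrable_continuous_real
            continuous_imp_integrable_real continuous_intros) auto
      finally show ?thesis using winner[OF s] by simp
    qed
    then show ?thesis using vector_eq_rdot by blast
  qed
  define w' where "w' n s = (z (s + h n) - z s) /\<^sub>R h n" for n s
  have q: "continuous_on {0..T} q"
    unfolding q_def using z r(1) by (intro continuous_intros)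
  have qi: "q integrable_on {a..b}" if "0 \<le> a" "b \<le> T" for a b
    using that by (intro integrable_continuous_real continuous_on_subset[OF q]) auto
  have wder: "(w n has_vector_derivative w' n s) (at s within {0..t})" if s: "s \<in> {0..t}" for n s
  proof -
    define Z where "Z s = integral {0..s} z" for s
    have Z: "(Z has_vector_derivative z s) (at s within {0..T})" if "s \<in> {0..T}" for s
      unfolding Z_def by (rule integral_has_vector_derivative[OF z that])
    have 1: "(Z has_vector_derivative z s) (at s within {0..t})"
      by (rule has_vector_derivative_within_subset[OF Z]) (use s t in auto)
    have "((Z \<circ> (\<lambda>s. s + h n)) has_vector_derivative 1 *\<^sub>R z (s + h n)) (at s within {0..t})"
    proof (rule vector_diff_chain_within)
      show "((\<lambda>s. s + h n) has_vector_derivative 1) (at s within {0..t})"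
        by (auto intro!: derivative_eq_intros)
      show "(Z has_vector_derivative z (s + h n)) (at (s + h n) within (\<lambda>s. s + h n) ` {0..t})"
        by (rule has_vector_derivative_within_subset[OF Z]) (use s h[of n] in auto)
    qed
    from has_vector_derivative_diff[OF this 1]
    have "((\<lambda>s. Z (s + h n) - Z s) has_vector_derivative (z (s + h n) - z s)) (at s within {0..t})"
      by (simp add: o_def)
    from has_vector_derivative_scaleR[OF DERIV_const[of "inverse (h n)"] this]
    have "((\<lambda>s. (Z (s + h n) - Z s) /\<^sub>R h n) has_vector_derivative w' n s) (at s within {0..t})"
      by (simp add: w'_def)
    then show ?thesis
    proof (rule has_vector_derivative_transform[OF s, rotated])
      fix x assume "x \<in> {0..t}"
      then show "w n x = (Z (x + h n) - Z x) /\<^sub>R h n"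
        using Henstock_Kurzweil_Integration.integral_combine[of 0 x "x + h n" z] zi[of 0 "x + h n"] h[of n]
        by (auto simp: w_def Z_def simp flip: scaleR_add_right scaleR_diff_right) (metis add_diff_cancel_left')
    qed
  qed
  have wc: "continuous_on {0..t} (w n)" for n
    using wder has_vector_derivative_continuous continuous_on_eq_continuous_within by blast
  have w'c: "continuous_on {0..t} (w' n)" for n
    unfolding w'_def
    by (intro continuous_intros continuous_on_compose2[OF z]) (use t h[of n] in auto)
  have FTC: "((\<lambda>s. 2 * (w' n s \<bullet> w n s)) has_integral (norm (w n t))\<^sup>2 - (norm (w n 0))\<^sup>2) {0..t}" for n
  proof -
    have "((\<lambda>s. w n s \<bullet> w n s) has_vector_derivative 2 * (w' n s \<bullet> w n s)) (at s within {0..t})"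
      if "s \<in> {0..t}" for s
      using bounded_bilinear.has_vector_derivative[OF bounded_bilinear_inner wder[OF that] wder[OF that], of n n]
      by (simp add: inner_commute)
    from fundamental_theorem_of_calculus[OF t(1) this]
    show ?thesis by (simp add: power2_norm_eq_inner)
  qed
  have pointwise: "2 * (w' n s \<bullet> w n s) + 2 * c * (norm (\<omega> n s))\<^sup>2 \<le> integral {s..s + h n} q / h n"
    if s: "s \<in> {0..t}" for n s
  proof -
    have b: "0 \<le> s" "s \<le> s + h n" "s + h n \<le> T" using s h[of n] by auto
    have bl: "bounded_linear (\<lambda>v. A v (\<omega> n s))"
      by (rule bounded_bilinear.bounded_linear_left[OF A])
    have Ai: "integrable (lebesgue_on {s..s + h n}) (\<lambda>u. A (\<zeta> u) (\<omega> n s))"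
      by (rule integrable_bounded_linear[OF bl \<zeta>i]) (use b in auto)
    have fi': "integrable (lebesgue_on {s..s + h n}) (\<lambda>u. f u \<bullet> w n s)"
      using fi[of s "s + h n" "\<omega> n s"] b j\<omega>[OF s] by simp
    have "w' n s \<bullet> w n s * h n = (z (s + h n) - z s) \<bullet> j (\<omega> n s)"
      using h(1)[of n] by (simp add: w'_def j\<omega>[OF s])
    also have "\<dots> = (LINT u|lebesgue_on {s..s + h n}. f u \<bullet> w n s) - (LINT u|lebesgue_on {s..s + h n}. A (\<zeta> u) (\<omega> n s))"
      using eq[OF b, of "\<omega> n s"] Ai fi' by (simp add: j\<omega>[OF s])
    also have "(LINT u|lebesgue_on {s..s + h n}. A (\<zeta> u) (\<omega> n s)) = h n * A (\<omega> n s) (\<omega> n s)"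
      using integral_bounded_linear[OF bl \<zeta>i[OF b(1,3)]] h(1)[of n]
      by (simp add: \<omega>_def bounded_bilinear.scaleR_left[OF A])
    finally have 1: "w' n s \<bullet> w n s * h n = (LINT u|lebesgue_on {s..s + h n}. f u \<bullet> w n s) - h n * A (\<omega> n s) (\<omega> n s)" .
    \<comment> \<open>Jensen for the average, from \<open>2 z \<bullet> w \<le> (norm z)\<^sup>2 + (norm w)\<^sup>2\<close>.\<close>
    have w2: "(norm (w n s))\<^sup>2 * h n \<le> integral {s..s + h n} (\<lambda>u. (norm (z u))\<^sup>2)"
    proof -
      have "(norm (w n s))\<^sup>2 * h n = integral {s..s + h n} (\<lambda>u. z u \<bullet> w n s)"
        using winner[OF s, of n "w n s"] h(1)[of n] by (simp add: power2_norm_eq_inner)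
      also have "\<dots> \<le> integral {s..s + h n} (\<lambda>u. (norm (z u))\<^sup>2 / 2 + (norm (w n s))\<^sup>2 / 2)"
      proof (rule integral_le)
        fix u
        have "0 \<le> (z u - w n s) \<bullet> (z u - w n s)" by simp
        then show "z u \<bullet> w n s \<le> (norm (z u))\<^sup>2 / 2 + (norm (w n s))\<^sup>2 / 2"
          by (simp add: power2_norm_eq_inner inner_diff_left inner_diff_right inner_commute)
      qed (use zc[of s "s + h n"] b in \<open>auto intro!: integrable_continuous_real continuous_intros\<close>)
      also have "\<dots> = integral {s..s + h n} (\<lambda>u. (norm (z u))\<^sup>2) / 2 + (norm (w n s))\<^sup>2 / 2 * h n"
        using zc[of s "s + h n"] b h(1)[of n]
        by (subst Henstock_Kurzweil_Integration.integral_add)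
           (auto intro!: integrable_continuous_real continuous_intros)
      finally show ?thesis by simp
    qed
    have "2 * (LINT u|lebesgue_on {s..s + h n}. f u \<bullet> w n s) = (LINT u|lebesgue_on {s..s + h n}. 2 * (f u \<bullet> w n s))"
      by simp
    also have "\<dots> = integral {s..s + h n} (\<lambda>u. 2 * (f u \<bullet> w n s))"
      using fi' by (intro lebesgue_integral_eq_integral) auto
    also have "\<dots> \<le> integral {s..s + h n} (\<lambda>u. L * (norm (z u))\<^sup>2 + (r u)\<^sup>2 + (L + 1) * (norm (w n s))\<^sup>2)"
    proof (rule integral_le)
      show "(\<lambda>u. 2 * (f u \<bullet> w n s)) integrable_on {s..s + h n}"
        using fi' by (intro integrable_on_lebesgue_on) auto
      show "(\<lambda>u. L * (norm (z u))\<^sup>2 + (r u)\<^sup>2 + (L + 1) * (norm (w n s))\<^sup>2) integrable_on {s..s + h n}"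
        using zc[of s "s + h n"] b continuous_on_subset[OF r(1), of "{s..s + h n}"]
        by (auto intro!: integrable_continuous_real continuous_intros)
      fix u assume u: "u \<in> {s..s + h n}"
      have "2 * (f u \<bullet> w n s) \<le> 2 * (norm (f u) * norm (w n s))"
        by (simp add: norm_cauchy_schwarz)
      also have "\<dots> \<le> 2 * ((L * norm (z u) + r u) * norm (w n s))"
        using r(2)[of u] u b by (intro mult_left_mono mult_right_mono) auto
      also have "\<dots> = L * (2 * norm (z u) * norm (w n s)) + 2 * r u * norm (w n s)"
        by (simp add: algebra_simps)
      also have "\<dots> \<le> L * ((norm (z u))\<^sup>2 + (norm (w n s))\<^sup>2) + ((r u)\<^sup>2 + (norm (w n s))\<^sup>2)"
        using L by (intro add_mono mult_left_mono sum_squares_bound) auto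
      finally show "2 * (f u \<bullet> w n s) \<le> L * (norm (z u))\<^sup>2 + (r u)\<^sup>2 + (L + 1) * (norm (w n s))\<^sup>2"
        by (simp add: algebra_simps)
    qed
    also have "\<dots> = integral {s..s + h n} (\<lambda>u. L * (norm (z u))\<^sup>2 + (r u)\<^sup>2) + (L + 1) * ((norm (w n s))\<^sup>2 * h n)"
      using zc[of s "s + h n"] b continuous_on_subset[OF r(1), of "{s..s + h n}"]
      by (subst Henstock_Kurzweil_Integration.integral_add)
         (auto intro!: integrable_continuous_real continuous_intros)
    also have "\<dots> \<le> integral {s..s + h n} (\<lambda>u. L * (norm (z u))\<^sup>2 + (r u)\<^sup>2) + (L + 1) * integral {s..s + h n} (\<lambda>u. (norm (z u))\<^sup>2)"
      using w2 L by (intro add_left_mono mult_left_mono) auto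
    also have "\<dots> = integral {s..s + h n} q"
      unfolding q_def integral_mult_right[symmetric]
      using zc[of s "s + h n"] b continuous_on_subset[OF r(1), of "{s..s + h n}"]
      by (subst Henstock_Kurzweil_Integration.integral_add[symmetric])
         (auto intro!: integrable_continuous_real continuous_intros simp: algebra_simps)
    finally have "2 * (w' n s \<bullet> w n s * h n) \<le> integral {s..s + h n} q - 2 * (h n * A (\<omega> n s) (\<omega> n s))"
      using 1 by simp
    moreover have "h n * A (\<omega> n s) (\<omega> n s) \<ge> h n * (c * (norm (\<omega> n s))\<^sup>2)"
      using c(2) h(1)[of n] by (intro mult_left_mono) auto
    ultimately have "(2 * (w' n s \<bullet> w n s) + 2 * c * (norm (\<omega> n s))\<^sup>2) * h n \<le> integral {s..s + h n} q"
      by (simp add: algebra_simps)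
    then show ?thesis using h(1)[of n] by (simp add: le_divide_eq)
  qed
  \<comment> \<open>\<open>D n\<close> is continuous and bounds \<open>2 * c * (norm (\<omega> n s))\<^sup>2\<close> from above, so Fatou can be applied to it.\<close>
  define D where "D n s = integral {s..s + h n} q / h n - 2 * (w' n s \<bullet> w n s)" for n s
  have qn: "q s \<ge> 0" for s using L by (simp add: q_def)
  note avg = integral_of_averages_le[OF q qn t(1) h]
  have Dc: "continuous_on {0..t} (D n)" for n
    unfolding D_def
    by (intro continuous_on_diff[OF avg(3)] continuous_on_mult_left continuous_on_inner wc w'c)
  have Dge: "2 * c * (norm (\<omega> n s))\<^sup>2 \<le> D n s" if "s \<in> {0..t}" for n s
    using pointwise[OF that, of n] by (simp add: D_def)
  have Dn: "0 \<le> D n s" if "s \<in> {0..t}" for n s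
    by (rule order_trans[OF _ Dge[OF that]]) (use c in simp)
  have Dint: "integral {0..t} (D n) \<le> integral {0..t + h n} q - (norm (w n t))\<^sup>2 + (norm (w n 0))\<^sup>2" for n
  proof -
    have "integral {0..t} (D n) = integral {0..t} (\<lambda>s. integral {s..s + h n} q / h n) - ((norm (w n t))\<^sup>2 - (norm (w n 0))\<^sup>2)"
      unfolding D_def using avg(1)[of n] FTC[of n]
      by (subst Henstock_Kurzweil_Integration.integral_diff) (auto simp: has_integral_integrable_integral)
    then show ?thesis using avg(2)[of n] by simp
  qed
  define B where "B = integral {0..t} q - (norm (z t))\<^sup>2 + (norm (z 0))\<^sup>2"
  have lim: "(\<lambda>n. integral {0..t + h n} q - (norm (w n t))\<^sup>2 + (norm (w n 0))\<^sup>2) \<longlonglongrightarrow> B"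
  proof -
    have "(\<lambda>n. integral {0..t + h n} q) \<longlonglongrightarrow> integral {0..t} q"
    proof (rule continuous_on_tendsto_compose[of "{0..T}" "\<lambda>x. integral {0..x} q"])
      show "continuous_on {0..T} (\<lambda>x. integral {0..x} q)"
        using qi[of 0 T] by (intro indefinite_integral_continuous_1) auto
      show "(\<lambda>n. t + h n) \<longlonglongrightarrow> t" using tendsto_add[OF tendsto_const h0, of t] by simp
    next
      have "t + h n \<in> {0..T}" for n using t(1) h[of n] by auto
      then show "\<forall>\<^sub>F n in sequentially. t + h n \<in> {0..T}" by simp
    qed (use t in auto)
    moreover have "(\<lambda>n. w n s) \<longlonglongrightarrow> z s" if "s \<in> {0..t}" for s
      unfolding w_def
    proof (rule integral_average_tendsto[OF z _ h(1) _ h0])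
      show "s + h n \<le> T" for n using that h(2)[of n] by auto
    qed (use that t in auto)
    ultimately show ?thesis
      unfolding B_def using t by (intro tendsto_intros) auto
  qed
  have avg\<zeta>: "AE s in lebesgue_on {0..t}. (\<lambda>n. \<omega> n s) \<longlonglongrightarrow> \<zeta> s"
  proof -
    let ?f = "\<lambda>s. indicator {0..T} s *\<^sub>R \<zeta> s"
    have "integrable lebesgue ?f"
      using \<zeta>(1) by (simp add: integrable_restrict_space set_integrable_def)
    from AE_average_tendsto[OF this h(1) h0]
    have "AE s in lebesgue. s \<in> {0..t} \<longrightarrow> (\<lambda>n. \<omega> n s) \<longlonglongrightarrow> \<zeta> s"
    proof eventually_elim
      fix s assume lims: "(\<lambda>n. (LINT u|lebesgue_on {s..s + h n}. ?f u) /\<^sub>R h n) \<longlonglongrightarrow> ?f s"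
      show "s \<in> {0..t} \<longrightarrow> (\<lambda>n. \<omega> n s) \<longlonglongrightarrow> \<zeta> s"
      proof
        assume s: "s \<in> {0..t}"
        have "(LINT u|lebesgue_on {s..s + h n}. ?f u) = (LINT u|lebesgue_on {s..s + h n}. \<zeta> u)" for n
          by (rule Bochner_Integration.integral_cong) (use s h(2)[of n] in auto)
        with lims s t show "(\<lambda>n. \<omega> n s) \<longlonglongrightarrow> \<zeta> s" by (simp add: \<omega>_def)
      qed
    qed
    then show ?thesis by (simp add: AE_restrict_space_iff)
  qed
  have meas: "(\<lambda>s. (norm (\<zeta> s))\<^sup>2) \<in> borel_measurable (lebesgue_on {0..t})"
    using \<zeta>i[of 0 t] t by (intro borel_measurable_power borel_measurable_norm) auto
  have "(\<integral>\<^sup>+s. ennreal (2 * c * (norm (\<zeta> s))\<^sup>2) \<partial>lebesgue_on {0..t}) \<le> (\<integral>\<^sup>+s. liminf (\<lambda>n. ennreal (D n s)) \<partial>lebesgue_on {0..t})"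
  proof (rule nn_integral_mono_AE)
    show "AE s in lebesgue_on {0..t}. ennreal (2 * c * (norm (\<zeta> s))\<^sup>2) \<le> liminf (\<lambda>n. ennreal (D n s))"
      using avg\<zeta> AE_space[of "lebesgue_on {0..t}"]
    proof eventually_elim
      fix s assume l: "(\<lambda>n. \<omega> n s) \<longlonglongrightarrow> \<zeta> s" and "s \<in> space (lebesgue_on {0..t})"
      then have s: "s \<in> {0..t}" by simp
      have "(\<lambda>n. ennreal (2 * c * (norm (\<omega> n s))\<^sup>2)) \<longlonglongrightarrow> ennreal (2 * c * (norm (\<zeta> s))\<^sup>2)"
        using l by (intro tendsto_ennrealI tendsto_intros)
      then have "ennreal (2 * c * (norm (\<zeta> s))\<^sup>2) = liminf (\<lambda>n. ennreal (2 * c * (norm (\<omega> n s))\<^sup>2))"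
        using lim_imp_Liminf[OF trivial_limit_sequentially] by metis
      also have "\<dots> \<le> liminf (\<lambda>n. ennreal (D n s))"
        by (intro Liminf_mono always_eventually allI ennreal_leI Dge s)
      finally show "ennreal (2 * c * (norm (\<zeta> s))\<^sup>2) \<le> liminf (\<lambda>n. ennreal (D n s))" .
    qed
  qed
  also have "\<dots> \<le> liminf (\<lambda>n. \<integral>\<^sup>+s. ennreal (D n s) \<partial>lebesgue_on {0..t})"
  proof (rule nn_integral_liminf)
    show "(\<lambda>s. ennreal (D n s)) \<in> borel_measurable (lebesgue_on {0..t})" for n
      using Dc[of n] by (intro measurable_compose[OF _ measurable_ennreal] continuous_imp_measurable_on_sets_lebesgue) auto
  qed
  also have "\<dots> \<le> liminf (\<lambda>n. ennreal (integral {0..t + h n} q - (norm (w n t))\<^sup>2 + (norm (w n 0))\<^sup>2))"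
  proof (intro Liminf_mono always_eventually allI)
    fix n
    have "(\<integral>\<^sup>+s. ennreal (D n s) \<partial>lebesgue_on {0..t}) = ennreal (LINT s|lebesgue_on {0..t}. D n s)"
      using Dc[of n] Dn[of _ n] by (intro nn_integral_eq_integral continuous_imp_integrable_real) (auto intro!: AE_I2)
    also have "(LINT s|lebesgue_on {0..t}. D n s) = integral {0..t} (D n)"
      using Dc[of n] by (intro lebesgue_integral_eq_integral continuous_imp_integrable_real) auto
    finally show "(\<integral>\<^sup>+s. ennreal (D n s) \<partial>lebesgue_on {0..t}) \<le> ennreal (integral {0..t + h n} q - (norm (w n t))\<^sup>2 + (norm (w n 0))\<^sup>2)"
      using Dint[of n] by (simp add: ennreal_leI)
  qed
  also have "\<dots> = ennreal B"
    using lim by (intro lim_imp_Liminf tendsto_ennrealI) auto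
  finally have le: "(\<integral>\<^sup>+s. ennreal (2 * c * (norm (\<zeta> s))\<^sup>2) \<partial>lebesgue_on {0..t}) \<le> ennreal B" .
  have B: "B \<ge> 0"
  proof (rule LIMSEQ_le_const[OF lim])
    have "0 \<le> integral {0..t} (D n)" for n
      using Dc[of n] Dn[of _ n] by (intro Henstock_Kurzweil_Integration.integral_nonneg integrable_continuous_real) auto
    then show "\<exists>N. \<forall>n\<ge>N. 0 \<le> integral {0..t + h n} q - (norm (w n t))\<^sup>2 + (norm (w n 0))\<^sup>2"
      using Dint order_trans by blast
  qed
  have int: "integrable (lebesgue_on {0..t}) (\<lambda>s. 2 * c * (norm (\<zeta> s))\<^sup>2)"
    using meas c(1) le by (intro integrableI_nonneg) (auto intro: le_less_trans)
  have "ennreal (LINT s|lebesgue_on {0..t}. 2 * c * (norm (\<zeta> s))\<^sup>2) \<le> ennreal B"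
    using le int c(1) by (subst nn_integral_eq_integral[symmetric]) auto
  then have "2 * c * (LINT s|lebesgue_on {0..t}. (norm (\<zeta> s))\<^sup>2) \<le> B"
    using B by (simp add: ennreal_le_iff)
  then show ?thesis by (simp add: B_def)
qed

text \<open>Both sides of the inequality are continuous in \<open>t\<close>, so it extends from \<open>{0..<T}\<close> to \<open>T\<close>.\<close>

lemma parabolic_energy_inequality:
  fixes j :: "'v::{banach, second_countable_topology} \<Rightarrow> 'h::{real_inner, banach, second_countable_topology}"
    and A :: "'v \<Rightarrow> 'v \<Rightarrow> real" and T :: real
  assumes j: "bounded_linear j" and A: "bounded_bilinear A" and c: "c > 0" "\<And>v. A v v \<ge> c * (norm v)\<^sup>2"
    and z: "continuous_on {0..T} z"
    and \<zeta>: "integrable (lebesgue_on {0..T}) \<zeta>" "AE s in lebesgue_on {0..T}. j (\<zeta> s) = z s"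
      "integrable (lebesgue_on {0..T}) (\<lambda>s. (norm (\<zeta> s))\<^sup>2)"
    and f: "\<And>v. integrable (lebesgue_on {0..T}) (\<lambda>s. f s \<bullet> j v)"
    and eq: "\<And>s t v. 0 \<le> s \<Longrightarrow> s \<le> t \<Longrightarrow> t \<le> T \<Longrightarrow>
      (z t - z s) \<bullet> j v = (LINT u|lebesgue_on {s..t}. f u \<bullet> j v - A (\<zeta> u) v)"
    and r: "continuous_on {0..T} r" "\<And>s. s \<in> {0..T} \<Longrightarrow> norm (f s) \<le> L * norm (z s) + r s" and L: "L \<ge> 0"
    and t: "t \<in> {0..T}" and T: "T > 0"
  shows "(norm (z t))\<^sup>2 + 2 * c * integral {0..t} (\<lambda>s. (norm (\<zeta> s))\<^sup>2)
    \<le> (norm (z 0))\<^sup>2 + integral {0..t} (\<lambda>s. (2 * L + 1) * (norm (z s))\<^sup>2 + (r s)\<^sup>2)"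
proof -
  define F where "F t = (norm (z t))\<^sup>2 + 2 * c * integral {0..t} (\<lambda>s. (norm (\<zeta> s))\<^sup>2)
    - integral {0..t} (\<lambda>s. (2 * L + 1) * (norm (z s))\<^sup>2 + (r s)\<^sup>2)" for t
  have "F t \<le> (norm (z 0))\<^sup>2"
  proof (rule continuous_le_on_closure[of "{0..<T}" F])
    have "(\<lambda>s. (norm (\<zeta> s))\<^sup>2) integrable_on {0..T}"
      using \<zeta>(3) by (intro integrable_on_lebesgue_on) auto
    moreover have "(\<lambda>s. (2 * L + 1) * (norm (z s))\<^sup>2 + (r s)\<^sup>2) integrable_on {0..T}"
      using z r(1) by (intro integrable_continuous_real continuous_intros)
    ultimately have "continuous_on {0..T} F"
      unfolding F_def using z by (intro continuous_intros indefinite_integral_continuous_1)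
    then show "continuous_on (closure {0..<T}) F" using T by simp
    show "t \<in> closure {0..<T}" using t T by simp
    fix t assume t: "t \<in> {0..<T}"
    have "integrable (lebesgue_on {0..t}) (\<lambda>s. (norm (\<zeta> s))\<^sup>2)"
      by (rule integrable_subinterval[OF \<zeta>(3)]) (use t in auto)
    then have "(LINT s|lebesgue_on {0..t}. (norm (\<zeta> s))\<^sup>2) = integral {0..t} (\<lambda>s. (norm (\<zeta> s))\<^sup>2)"
      by (intro lebesgue_integral_eq_integral) auto
    then show "F t \<le> (norm (z 0))\<^sup>2"
      using parabolic_energy_inequality_interior[OF j A c z \<zeta>(1,2) f eq r L, of t] t
      by (simp add: F_def)
  qed
  then show ?thesis by (simp add: F_def)
qed

text \<open>The two summands are the factors that Gronwall's inequality gives in the bounds for the square of the supremum of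
  \<open>norm (z t)\<close> and for the integral of \<open>(norm (\<zeta> s))\<^sup>2\<close>.\<close>

definition parabolic_const :: "real \<Rightarrow> real \<Rightarrow> real \<Rightarrow> real" where
  "parabolic_const T c L = exp ((2 * L + 1) * T) + (1 + (2 * L + 1) * T * exp ((2 * L + 1) * T)) / (2 * c)"

text \<open>A forcing of linear growth in \<open>z\<close> is absorbed by Gronwall's inequality; only its inhomogeneous part \<open>r\<close>
  enters the bound, through its \<open>L\<^sup>2\<close> norm.\<close>

lemma parabolic_a_priori_estimate:
  fixes j :: "'v::{banach, second_countable_topology} \<Rightarrow> 'h::{real_inner, banach, second_countable_topology}"
    and A :: "'v \<Rightarrow> 'v \<Rightarrow> real" and T :: real
  assumes j: "bounded_linear j" and A: "bounded_bilinear A" and c: "c > 0" "\<And>v. A v v \<ge> c * (norm v)\<^sup>2"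
    and z: "continuous_on {0..T} z"
    and \<zeta>: "integrable (lebesgue_on {0..T}) \<zeta>" "AE s in lebesgue_on {0..T}. j (\<zeta> s) = z s"
      "integrable (lebesgue_on {0..T}) (\<lambda>s. (norm (\<zeta> s))\<^sup>2)"
    and f: "\<And>v. integrable (lebesgue_on {0..T}) (\<lambda>s. f s \<bullet> j v)"
    and eq: "\<And>s t v. 0 \<le> s \<Longrightarrow> s \<le> t \<Longrightarrow> t \<le> T \<Longrightarrow>
      (z t - z s) \<bullet> j v = (LINT u|lebesgue_on {s..t}. f u \<bullet> j v - A (\<zeta> u) v)"
    and r: "continuous_on {0..T} r" "\<And>s. s \<in> {0..T} \<Longrightarrow> norm (f s) \<le> L * norm (z s) + r s" and L: "L \<ge> 0"
    and T: "T > 0"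
  defines "B \<equiv> (norm (z 0))\<^sup>2 + integral {0..T} (\<lambda>s. (r s)\<^sup>2)"
  shows "t \<in> {0..T} \<Longrightarrow> (norm (z t))\<^sup>2 \<le> parabolic_const T c L * B"
    and "(LINT s|lebesgue_on {0..T}. (norm (\<zeta> s))\<^sup>2) \<le> parabolic_const T c L * B"
proof -
  define b where "b = 2 * L + 1"
  have b: "b > 0" using L by (simp add: b_def)
  have zc: "continuous_on {0..t} (\<lambda>s. (norm (z s))\<^sup>2)" "continuous_on {0..t} (\<lambda>s. (r s)\<^sup>2)" if "t \<le> T" for t
    using continuous_on_subset[OF z, of "{0..t}"] continuous_on_subset[OF r(1), of "{0..t}"] that
    by (auto intro!: continuous_intros)
  have en: "(norm (z t))\<^sup>2 + 2 * c * integral {0..t} (\<lambda>s. (norm (\<zeta> s))\<^sup>2) \<le> B + b * integral {0..t} (\<lambda>s. (norm (z s))\<^sup>2)"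
    if t: "t \<in> {0..T}" for t
  proof -
    have "integral {0..t} (\<lambda>s. b * (norm (z s))\<^sup>2 + (r s)\<^sup>2) = b * integral {0..t} (\<lambda>s. (norm (z s))\<^sup>2) + integral {0..t} (\<lambda>s. (r s)\<^sup>2)"
      using zc[of t] t by (subst Henstock_Kurzweil_Integration.integral_add)
        (auto intro!: integrable_continuous_real continuous_intros)
    moreover have "integral {0..t} (\<lambda>s. (r s)\<^sup>2) \<le> integral {0..T} (\<lambda>s. (r s)\<^sup>2)"
      using zc t by (intro integral_subset_le integrable_continuous_real) auto
    ultimately show ?thesis
      using parabolic_energy_inequality[OF j A c z \<zeta> f eq r L t T] by (simp add: B_def b_def)
  qed
  have nn: "0 \<le> integral {0..t} (\<lambda>s. (norm (\<zeta> s))\<^sup>2)" if "t \<in> {0..T}" for t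
  proof (rule Henstock_Kurzweil_Integration.integral_nonneg)
    show "(\<lambda>s. (norm (\<zeta> s))\<^sup>2) integrable_on {0..t}"
      using integrable_subinterval[OF \<zeta>(3), of 0 t] that by (intro integrable_on_lebesgue_on) auto
  qed simp
  have gr: "(norm (z t))\<^sup>2 \<le> B * exp (b * t)" if t: "t \<in> {0..T}" for t
  proof (rule gronwall[OF zc(1)[OF order_refl] _ _ t])
    fix t assume t: "t \<in> {0..T}"
    have "0 \<le> 2 * c * integral {0..t} (\<lambda>s. (norm (\<zeta> s))\<^sup>2)" using c(1) nn[OF t] by simp
    then show "(norm (z t))\<^sup>2 \<le> B + b * integral {0..t} (\<lambda>s. (norm (z s))\<^sup>2)"
      using en[OF t] by linarith
  qed (use b in simp)
  have B: "B \<ge> 0"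
    unfolding B_def using zc[of T]
    by (intro add_nonneg_nonneg Henstock_Kurzweil_Integration.integral_nonneg integrable_continuous_real) auto
  have gr': "(norm (z t))\<^sup>2 \<le> B * exp (b * T)" if t: "t \<in> {0..T}" for t
    using gr[OF t] by (rule order_trans) (use B b t in \<open>auto intro!: mult_left_mono\<close>)
  have pc: "parabolic_const T c L * B = exp (b * T) * B + (1 + b * T * exp (b * T)) / (2 * c) * B"
    by (simp only: parabolic_const_def b_def distrib_right)
  show "(norm (z t))\<^sup>2 \<le> parabolic_const T c L * B" if t: "t \<in> {0..T}"
  proof -
    have "0 \<le> (1 + b * T * exp (b * T)) / (2 * c) * B" using b T c(1) B by simp
    then show ?thesis using gr'[OF t] unfolding pc mult.commute[of "exp (b * T)" B] by linarith
  qed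
  have "integral {0..T} (\<lambda>s. (norm (z s))\<^sup>2) \<le> integral {0..T} (\<lambda>s. B * exp (b * T))"
    using gr' zc[of T] by (intro integral_le integrable_continuous_real) auto
  also have "\<dots> = T * (B * exp (b * T))" using T by simp
  finally have "b * integral {0..T} (\<lambda>s. (norm (z s))\<^sup>2) \<le> b * (T * (B * exp (b * T)))"
    using b by (intro mult_left_mono) auto
  moreover have "0 \<le> (norm (z T))\<^sup>2" and T': "T \<in> {0..T}" using T by simp_all
  ultimately have "2 * c * integral {0..T} (\<lambda>s. (norm (\<zeta> s))\<^sup>2) \<le> B + b * (T * (B * exp (b * T)))"
    using en[OF T'] by linarith
  then have "integral {0..T} (\<lambda>s. (norm (\<zeta> s))\<^sup>2) \<le> (1 + b * T * exp (b * T)) / (2 * c) * B"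
    using c(1) by (simp add: field_simps)
  also have "\<dots> \<le> parabolic_const T c L * B"
    using B unfolding pc by simp
  finally show "(LINT s|lebesgue_on {0..T}. (norm (\<zeta> s))\<^sup>2) \<le> parabolic_const T c L * B"
    using \<zeta>(3) by (simp add: lebesgue_integral_eq_integral)
qed

section \<open>Nemytskii operators and truncation in an \<open>L\<^sup>2\<close> space\<close>

locale L2_class = finite_measure M for M :: "'x measure" +
  fixes rep :: "'h::real_normed_vector \<Rightarrow> 'x \<Rightarrow> real"
  assumes Lp: "is_Lp_space 2 M rep"
begin

lemma rep_measurable [measurable]: "rep u \<in> borel_measurable M"
  and rep_integrable: "integrable M (\<lambda>x. (rep u x)\<^sup>2)"
  and norm_sq: "(norm u)\<^sup>2 = (LINT x|M. (rep u x)\<^sup>2)"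
  and rep_add: "AE x in M. rep (u + v) x = rep u x + rep v x"
  and rep_scale: "AE x in M. rep (c *\<^sub>R u) x = c * rep u x"
  using Lp unfolding is_Lp_space_def by (simp_all add: power2_abs)

lemma rep_diff: "AE x in M. rep (u - v) x = rep u x - rep v x"
  using rep_add[of "u - v" v] by eventually_elim simp

lemma norm_mono:
  assumes "AE x in M. \<bar>rep u x\<bar> \<le> \<bar>rep v x\<bar>"
  shows "norm u \<le> norm v"
proof -
  have "(LINT x|M. (rep u x)\<^sup>2) \<le> (LINT x|M. (rep v x)\<^sup>2)"
    using assms by (intro integral_mono_AE rep_integrable) (auto simp: abs_le_square_iff)
  then show ?thesis by (simp flip: norm_sq add: power2_le_iff_abs_le)
qed

lemma rep_inject:
  assumes "AE x in M. rep u x = rep v x"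
  shows "u = v"
proof -
  have "(norm (u - v))\<^sup>2 = (LINT x|M. (rep (u - v) x)\<^sup>2)" by (rule norm_sq)
  also have "\<dots> = (LINT x|M. 0)"
    using assms rep_diff[of u v] by (intro integral_cong_AE) (auto elim!: eventually_elim2)
  finally show ?thesis by simp
qed

lemma rep_class_of:
  assumes "f \<in> borel_measurable M" "integrable M (\<lambda>x. (f x)\<^sup>2)"
  shows "AE x in M. rep (class_of M rep f) x = f x"
proof -
  have "\<exists>u. AE x in M. rep u x = f x"
    using Lp assms unfolding is_Lp_space_def by simp
  then have "\<exists>!u. AE x in M. rep u x = f x"
  proof (rule ex_ex1I)
    fix u v assume "AE x in M. rep u x = f x" "AE x in M. rep v x = f x"
    then have "AE x in M. rep u x = rep v x" by eventually_elim simp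
    then show "u = v" by (rule rep_inject)
  qed
  then show ?thesis unfolding class_of_def by (rule theI')
qed

text \<open>Minkowski's inequality, from the triangle inequality for the classes of \<open>\<bar>rep u\<bar>\<close> and \<open>\<bar>rep w\<bar>\<close>.\<close>

lemma norm_le_combination:
  assumes "0 \<le> a" "0 \<le> b" "AE x in M. \<bar>rep q x\<bar> \<le> a * \<bar>rep u x\<bar> + b * \<bar>rep w x\<bar>"
  shows "norm q \<le> a * norm u + b * norm w"
proof -
  define modulus where "modulus u = class_of M rep (\<lambda>x. \<bar>rep u x\<bar>)" for u
  have rep_modulus: "AE x in M. rep (modulus u) x = \<bar>rep u x\<bar>" for u
    unfolding modulus_def by (rule rep_class_of) (simp_all add: rep_integrable)
  have norm_modulus: "norm (modulus u) \<le> norm u" for u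
    by (rule norm_mono) (use rep_modulus[of u] in eventually_elim, simp)
  have "AE x in M. \<bar>rep q x\<bar> \<le> \<bar>rep (a *\<^sub>R modulus u + b *\<^sub>R modulus w) x\<bar>"
    using assms(3) rep_modulus[of u] rep_modulus[of w] rep_scale[of a "modulus u"] rep_scale[of b "modulus w"]
      rep_add[of "a *\<^sub>R modulus u" "b *\<^sub>R modulus w"]
    by eventually_elim (use assms(1,2) in simp)
  then have "norm q \<le> norm (a *\<^sub>R modulus u + b *\<^sub>R modulus w)" by (rule norm_mono)
  also have "\<dots> \<le> a * norm (modulus u) + b * norm (modulus w)"
    using norm_triangle_ineq[of "a *\<^sub>R modulus u" "b *\<^sub>R modulus w"] assms(1,2) by simp
  also have "\<dots> \<le> a * norm u + b * norm w"
    using assms(1,2) norm_modulus by (intro add_mono mult_left_mono)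
  finally show ?thesis .
qed

definition nemytskii :: "(real \<Rightarrow> real) \<Rightarrow> 'h \<Rightarrow> 'h" where
  "nemytskii \<phi> u = class_of M rep (\<lambda>x. \<phi> (rep u x))"

lemma rep_nemytskii:
  assumes lip: "\<And>r s. \<bar>\<phi> r - \<phi> s\<bar> \<le> K * \<bar>r - s\<bar>"
  shows "AE x in M. rep (nemytskii \<phi> u) x = \<phi> (rep u x)"
  unfolding nemytskii_def
proof (rule rep_class_of)
  have K: "0 \<le> K" using order_trans[OF abs_ge_zero lip[of 1 0]] by simp
  have "continuous_on UNIV \<phi>"
    by (rule lipschitz_on_continuous_on[of K]) (use lip K in \<open>auto simp: lipschitz_on_def dist_real_def\<close>)
  then have [measurable]: "\<phi> \<in> borel_measurable borel"
    by (rule borel_measurable_continuous_onI)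
  show "(\<lambda>x. \<phi> (rep u x)) \<in> borel_measurable M" by measurable
  have bound: "(\<phi> r)\<^sup>2 \<le> 2 * K\<^sup>2 * r\<^sup>2 + 2 * (\<phi> 0)\<^sup>2" for r
  proof -
    have "\<bar>\<phi> r\<bar> \<le> K * \<bar>r\<bar> + \<bar>\<phi> 0\<bar>" using lip[of r 0] by simp
    then have "(\<phi> r)\<^sup>2 \<le> (K * \<bar>r\<bar> + \<bar>\<phi> 0\<bar>)\<^sup>2" by (simp add: abs_le_square_iff[symmetric])
    also have "\<dots> \<le> 2 * (K * \<bar>r\<bar>)\<^sup>2 + 2 * \<bar>\<phi> 0\<bar>\<^sup>2"
      using sum_squares_bound[of "K * \<bar>r\<bar>" "\<bar>\<phi> 0\<bar>"] by (simp add: power2_sum)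
    finally show ?thesis by (simp add: power_mult_distrib)
  qed
  show "integrable M (\<lambda>x. (\<phi> (rep u x))\<^sup>2)"
  proof (rule Bochner_Integration.integrable_bound)
    show "integrable M (\<lambda>x. 2 * K\<^sup>2 * (rep u x)\<^sup>2 + 2 * (\<phi> 0)\<^sup>2)"
      by (simp add: rep_integrable)
  qed (use bound in auto)
qed

lemma nemytskii_lipschitz:
  assumes lip: "\<And>r s. \<bar>\<phi> r - \<phi> s\<bar> \<le> K * \<bar>r - s\<bar>"
  shows "norm (nemytskii \<phi> u - nemytskii \<phi> v) \<le> K * norm (u - v)"
proof -
  have K: "0 \<le> K" using order_trans[OF abs_ge_zero lip[of 1 0]] by simp
  have "AE x in M. \<bar>rep (nemytskii \<phi> u - nemytskii \<phi> v) x\<bar> \<le> K * \<bar>rep (u - v) x\<bar> + 0 * \<bar>rep u x\<bar>"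
    using rep_nemytskii[of \<phi> K u, OF lip] rep_nemytskii[of \<phi> K v, OF lip] rep_diff[of u v]
      rep_diff[of "nemytskii \<phi> u" "nemytskii \<phi> v"]
    by eventually_elim (simp add: lip)
  from norm_le_combination[OF K order_refl this] show ?thesis by simp
qed

text \<open>What remains of \<open>r\<close> after truncation at level \<open>k\<close>. Unlike the restriction of a function to the set
  where it exceeds \<open>k\<close>, this operation is Lipschitz, so that smallness on a finite net passes to a compact set.\<close>

definition excess :: "real \<Rightarrow> real \<Rightarrow> real" where
  "excess k r = r - max (- k) (min k r)"

definition tail :: "real \<Rightarrow> 'h \<Rightarrow> 'h" where
  "tail k = nemytskii (excess k)"

lemma excess_lipschitz: "\<bar>excess k r - excess k s\<bar> \<le> 1 * \<bar>r - s\<bar>" if "0 \<le> k" for k r s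
  using that by (auto simp: excess_def max_def min_def abs_if)

lemma rep_tail: "AE x in M. rep (tail k u) x = excess k (rep u x)" if "0 \<le> k"
  unfolding tail_def by (rule rep_nemytskii[of _ 1]) (rule excess_lipschitz[OF that])

lemma tail_lipschitz: "norm (tail k u - tail k v) \<le> norm (u - v)" if "0 \<le> k"
  using nemytskii_lipschitz[of "excess k" 1, OF excess_lipschitz[OF that]] by (simp add: tail_def)

lemma tail_le: "norm (tail k u) \<le> norm u" if "0 \<le> k"
proof (rule norm_mono)
  from rep_tail[OF that, of u] show "AE x in M. \<bar>rep (tail k u) x\<bar> \<le> \<bar>rep u x\<bar>"
    by eventually_elim (use that in \<open>auto simp: excess_def max_def min_def abs_if\<close>)
qed

lemma tail_tendsto_0: "(\<lambda>n. norm (tail (real n) u)) \<longlonglongrightarrow> 0"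
proof -
  have "(\<lambda>n. LINT x|M. (rep (tail (real n) u) x)\<^sup>2) \<longlonglongrightarrow> (LINT x|M. 0)"
  proof (rule integral_dominated_convergence[where w="\<lambda>x. (rep u x)\<^sup>2"])
    have all: "AE x in M. \<forall>n. rep (tail (real n) u) x = excess (real n) (rep u x)"
      by (subst AE_all_countable) (simp add: rep_tail)
    then show "AE x in M. (\<lambda>n. (rep (tail (real n) u) x)\<^sup>2) \<longlonglongrightarrow> 0"
    proof eventually_elim
      fix x assume x: "\<forall>n. rep (tail (real n) u) x = excess (real n) (rep u x)"
      have "eventually (\<lambda>n. real n \<ge> \<bar>rep u x\<bar>) sequentially"
        by (rule eventually_sequentiallyI[of "nat \<lceil>\<bar>rep u x\<bar>\<rceil>"]) linarith
      then have "eventually (\<lambda>n. (rep (tail (real n) u) x)\<^sup>2 = 0) sequentially"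
        by eventually_elim (auto simp: x excess_def max_def min_def abs_if split: if_splits)
      then show "(\<lambda>n. (rep (tail (real n) u) x)\<^sup>2) \<longlonglongrightarrow> 0" by (rule tendsto_eventually)
    qed
    fix n
    show "AE x in M. norm ((rep (tail (real n) u) x)\<^sup>2) \<le> (rep u x)\<^sup>2"
      using all
    proof eventually_elim
      fix x assume "\<forall>n. rep (tail (real n) u) x = excess (real n) (rep u x)"
      moreover have "\<bar>excess (real n) (rep u x)\<bar> \<le> \<bar>rep u x\<bar>"
        by (auto simp: excess_def max_def min_def abs_if)
      ultimately show "norm ((rep (tail (real n) u) x)\<^sup>2) \<le> (rep u x)\<^sup>2"
        by (simp add: abs_le_square_iff)
    qed
  qed (simp_all add: rep_integrable)
  then have "(\<lambda>n. (norm (tail (real n) u))\<^sup>2) \<longlonglongrightarrow> 0" by (simp add: norm_sq)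
  from tendsto_real_sqrt[OF this] show ?thesis by simp
qed

text \<open>A Dini argument: compact subsets of \<open>L\<^sup>2\<close> have uniformly small tails.\<close>

lemma tail_uniformly_small_on_compact:
  assumes C: "compact C" and \<eta>: "\<eta> > 0"
  shows "\<exists>k::nat. \<forall>u\<in>C. norm (tail (real k) u) \<le> \<eta>"
proof -
  have "C \<subseteq> (\<Union>c\<in>C. ball c (\<eta> / 2))" using \<eta> by auto
  from compactE_image[OF C open_ball this] obtain F where F: "F \<subseteq> C" "finite F" "C \<subseteq> (\<Union>c\<in>F. ball c (\<eta> / 2))" .
  have "eventually (\<lambda>n. \<forall>c\<in>F. norm (tail (real n) c) < \<eta> / 2) sequentially"
    using F(2) \<eta> by (intro eventually_ball_finite ballI order_tendstoD(2)[OF tail_tendsto_0]) auto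
  then obtain k where k: "\<And>c. c \<in> F \<Longrightarrow> norm (tail (real k) c) < \<eta> / 2"
    by (auto simp: eventually_sequentially)
  have "norm (tail (real k) u) \<le> \<eta>" if u: "u \<in> C" for u
  proof -
    obtain c where c: "c \<in> F" "norm (u - c) < \<eta> / 2"
      using F(3) u by (auto simp: dist_norm norm_minus_commute)
    have "norm (tail (real k) u) \<le> norm (tail (real k) u - tail (real k) c) + norm (tail (real k) c)"
      by (metis norm_triangle_sub add.commute)
    then show ?thesis using tail_lipschitz[of "real k" u c] k[OF c(1)] c(2) by simp
  qed
  then show ?thesis by blast
qed

text \<open>Where \<open>v\<close> lies in a large ball, \<open>j v\<close> lies in a compact set, whose tails are uniformly small; elsewhere
  the bound \<open>C\<close> is itself a small multiple of \<open>norm v\<close>. In this form the estimate can be integrated along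
  a path that is bounded in \<open>C([0,T]; H) \<inter> L\<^sup>2(0,T; V)\<close>.\<close>

lemma tail_embedding_small:
  fixes j :: "'v::real_normed_vector \<Rightarrow> 'h"
  assumes compact: "\<And>B. bounded B \<Longrightarrow> compact (closure (j ` B))" and \<eta>: "\<eta> > 0"
  shows "\<exists>k::nat. \<forall>v. norm (j v) \<le> C \<longrightarrow> (norm (tail (real k) (j v)))\<^sup>2 \<le> \<eta> * (1 + (norm v)\<^sup>2)"
proof -
  \<comment> \<open>The radius at which \<open>C\<^sup>2 \<le> \<eta> * (norm v)\<^sup>2\<close> becomes true.\<close>
  define R where "R = sqrt (C\<^sup>2 / \<eta>)"
  have R: "C\<^sup>2 = \<eta> * R\<^sup>2" using \<eta> by (simp add: R_def)
  obtain k :: nat where k: "\<And>u. u \<in> closure (j ` cball 0 R) \<Longrightarrow> norm (tail (real k) u) \<le> sqrt \<eta>"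
    using tail_uniformly_small_on_compact[OF compact[OF bounded_cball], of "sqrt \<eta>"] \<eta> by fastforce
  have "(norm (tail (real k) (j v)))\<^sup>2 \<le> \<eta> * (1 + (norm v)\<^sup>2)" if "norm (j v) \<le> C" for v
  proof (cases "norm v \<le> R")
    case True
    then have "j v \<in> closure (j ` cball 0 R)" by (intro subsetD[OF closure_subset]) auto
    then have "(norm (tail (real k) (j v)))\<^sup>2 \<le> (sqrt \<eta>)\<^sup>2" by (intro power_mono k) auto
    moreover have "(sqrt \<eta>)\<^sup>2 = \<eta>" "0 \<le> \<eta> * (norm v)\<^sup>2" using \<eta> by simp_all
    ultimately show ?thesis unfolding distrib_left by linarith
  next
    case False
    have "0 \<le> R" unfolding R_def using \<eta> by simp
    have "(norm (tail (real k) (j v)))\<^sup>2 \<le> C\<^sup>2"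
      using tail_le[of "real k" "j v"] that by (intro power_mono) auto
    also have "\<dots> \<le> \<eta> * (norm v)\<^sup>2"
      using False \<open>0 \<le> R\<close> \<eta> unfolding R by (intro mult_left_mono power_mono) auto
    finally show ?thesis using \<eta> by (simp add: distrib_left)
  qed
  then show ?thesis by blast
qed

end

locale nemytskii_C2 = L2_class M rep for M :: "'x measure" and rep :: "'h::real_normed_vector \<Rightarrow> 'x \<Rightarrow> real" +
  fixes g g' :: "real \<Rightarrow> real" and L K :: real
  assumes g: "\<And>r. (g has_real_derivative g' r) (at r)"
    and g'_bound: "\<And>r. \<bar>g' r\<bar> \<le> L"
    and g'_lip: "\<And>r s. \<bar>g' r - g' s\<bar> \<le> K * \<bar>r - s\<bar>"
begin

lemma L_nonneg: "0 \<le> L" using order_trans[OF abs_ge_zero g'_bound[of 0]] .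

lemma K_nonneg: "0 \<le> K" using order_trans[OF abs_ge_zero g'_lip[of 1 0]] by simp

lemma g_mvt: "\<exists>\<xi>. \<bar>\<xi> - r\<bar> \<le> \<bar>s - r\<bar> \<and> g s - g r = g' \<xi> * (s - r)"
proof (cases r s rule: linorder_cases)
  case less
  obtain \<xi> where "r < \<xi>" "\<xi> < s" "g s - g r = (s - r) * g' \<xi>"
    using MVT2[OF less, of g g'] g by auto
  then show ?thesis by (intro exI[of _ \<xi>]) (auto simp: mult.commute)
next
  case greater
  obtain \<xi> where "s < \<xi>" "\<xi> < r" "g r - g s = (r - s) * g' \<xi>"
    using MVT2[OF greater, of g g'] g by auto
  then show ?thesis by (intro exI[of _ \<xi>]) (auto simp: algebra_simps)
qed auto

lemma g_lipschitz: "\<bar>g r - g s\<bar> \<le> L * \<bar>r - s\<bar>"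
  using g_mvt[of s r] g'_bound by (auto simp: abs_mult intro!: mult_right_mono)

abbreviation N :: "'h \<Rightarrow> 'h" where "N \<equiv> nemytskii g"

text \<open>The Gateaux derivative of \<open>N\<close> at \<open>u\<close>.\<close>

definition N_deriv :: "'h \<Rightarrow> 'h \<Rightarrow> 'h" where
  "N_deriv u w = class_of M rep (\<lambda>x. g' (rep u x) * rep w x)"

lemma rep_N: "AE x in M. rep (N u) x = g (rep u x)"
  by (rule rep_nemytskii[of _ L]) (rule g_lipschitz)

lemma N_lipschitz: "norm (N u - N v) \<le> L * norm (u - v)"
  by (rule nemytskii_lipschitz) (rule g_lipschitz)

lemma rep_N_deriv: "AE x in M. rep (N_deriv u w) x = g' (rep u x) * rep w x"
  unfolding N_deriv_def
proof (rule rep_class_of)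
  have "continuous_on UNIV g'"
    by (rule lipschitz_on_continuous_on[of K]) (use g'_lip K_nonneg in \<open>auto simp: lipschitz_on_def dist_real_def\<close>)
  then have [measurable]: "g' \<in> borel_measurable borel"
    by (rule borel_measurable_continuous_onI)
  show "(\<lambda>x. g' (rep u x) * rep w x) \<in> borel_measurable M" by measurable
  show "integrable M (\<lambda>x. (g' (rep u x) * rep w x)\<^sup>2)"
  proof (rule Bochner_Integration.integrable_bound)
    show "integrable M (\<lambda>x. L\<^sup>2 * (rep w x)\<^sup>2)" by (simp add: rep_integrable)
    have "(g' (rep u x) * rep w x)\<^sup>2 \<le> L\<^sup>2 * (rep w x)\<^sup>2" for x
      using g'_bound[of "rep u x"] L_nonneg unfolding power_mult_distrib
      by (intro mult_right_mono) (auto simp: abs_le_square_iff[symmetric])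
    then show "AE x in M. norm ((g' (rep u x) * rep w x)\<^sup>2) \<le> norm (L\<^sup>2 * (rep w x)\<^sup>2)" by simp
  qed measurable
qed

lemma N_deriv_diff: "N_deriv u (w - w') = N_deriv u w - N_deriv u w'"
proof (rule rep_inject)
  show "AE x in M. rep (N_deriv u (w - w')) x = rep (N_deriv u w - N_deriv u w') x"
    using rep_N_deriv[of u "w - w'"] rep_N_deriv[of u w] rep_N_deriv[of u w'] rep_diff[of w w'] rep_diff[of "N_deriv u w" "N_deriv u w'"]
    by eventually_elim (simp add: algebra_simps)
qed

lemma norm_N_deriv: "norm (N_deriv u w) \<le> L * norm w"
proof -
  have "AE x in M. \<bar>rep (N_deriv u w) x\<bar> \<le> L * \<bar>rep w x\<bar> + 0 * \<bar>rep w x\<bar>"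
    using rep_N_deriv[of u w] by eventually_elim (use g'_bound in \<open>simp add: abs_mult mult_right_mono\<close>)
  from norm_le_combination[OF L_nonneg order_refl this] show ?thesis by simp
qed

definition N_quot :: "'h \<Rightarrow> real \<Rightarrow> 'h \<Rightarrow> 'h" where
  "N_quot u \<epsilon> w = (N (u + \<epsilon> *\<^sub>R w) - N u) /\<^sub>R \<epsilon>"

lemma N_quot_lipschitz: "norm (N_quot u \<epsilon> w - N_quot u \<epsilon> w') \<le> L * norm (w - w')" if "\<epsilon> > 0"
proof -
  have "N_quot u \<epsilon> w - N_quot u \<epsilon> w' = (N (u + \<epsilon> *\<^sub>R w) - N (u + \<epsilon> *\<^sub>R w')) /\<^sub>R \<epsilon>"
    by (simp add: N_quot_def flip: scaleR_diff_right)
  also have "norm \<dots> \<le> (L * norm ((u + \<epsilon> *\<^sub>R w) - (u + \<epsilon> *\<^sub>R w'))) / \<epsilon>"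
    using N_lipschitz[of "u + \<epsilon> *\<^sub>R w" "u + \<epsilon> *\<^sub>R w'"] that
    by (simp only: norm_scaleR) (simp add: field_simps)
  also have "\<dots> = L * norm (w - w')"
    using that by (simp flip: scaleR_diff_right)
  finally show ?thesis .
qed

lemma norm_N_quot: "norm (N_quot u \<epsilon> w) \<le> L * norm w" if "\<epsilon> > 0"
  using N_quot_lipschitz[OF that, of u w 0] by (simp add: N_quot_def)

text \<open>By the mean value theorem the remainder is, pointwise, at most \<open>min (2 * L) (K * \<epsilon> * \<bar>b\<bar>) * \<bar>b\<bar>\<close> with
  \<open>b = rep w x\<close>. It is quadratic where \<open>b\<close> is bounded, and the unbounded part of \<open>w\<close> only contributes
  through its tail. A bound by a power of \<open>\<epsilon>\<close> times a power of \<open>norm w\<close> is not to be had: if the measure \<open>M\<close> is nonzero,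
  has no atoms and \<open>g\<close> is not affine, then \<open>N\<close> is nowhere Frechet differentiable.\<close>

lemma norm_N_quot_diff_le:
  assumes \<epsilon>: "\<epsilon> > 0" and k: "0 \<le> k"
  shows "norm (N_quot u \<epsilon> w - N_deriv u w) \<le> 2 * k * K * \<epsilon> * norm w + 4 * L * norm (tail k w)"
proof (rule norm_le_combination)
  show "AE x in M. \<bar>rep (N_quot u \<epsilon> w - N_deriv u w) x\<bar> \<le> 2 * k * K * \<epsilon> * \<bar>rep w x\<bar> + 4 * L * \<bar>rep (tail k w) x\<bar>"
    using rep_diff[of "N_quot u \<epsilon> w" "N_deriv u w"] rep_N_deriv[of u w] rep_tail[OF k, of w]
      rep_scale[of "inverse \<epsilon>" "N (u + \<epsilon> *\<^sub>R w) - N u"] rep_diff[of "N (u + \<epsilon> *\<^sub>R w)" "N u"]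
      rep_N[of u] rep_N[of "u + \<epsilon> *\<^sub>R w"] rep_add[of u "\<epsilon> *\<^sub>R w"] rep_scale[of \<epsilon> w]
  proof eventually_elim
    case (elim x)
    define a b where "a = rep u x" and "b = rep w x"
    obtain \<xi> where \<xi>: "\<bar>\<xi> - a\<bar> \<le> \<epsilon> * \<bar>b\<bar>" "g (a + \<epsilon> * b) - g a = g' \<xi> * (\<epsilon> * b)"
      using g_mvt[of a "a + \<epsilon> * b"] \<epsilon> by (auto simp: abs_mult)
    have "rep (N_quot u \<epsilon> w - N_deriv u w) x = (g (a + \<epsilon> * b) - g a) / \<epsilon> - g' a * b"
      using elim by (simp add: N_quot_def a_def b_def divide_inverse_commute)
    also have "\<dots> = (g' \<xi> - g' a) * b" using \<xi>(2) \<epsilon> by (simp add: algebra_simps)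
    finally have eq: "\<bar>rep (N_quot u \<epsilon> w - N_deriv u w) x\<bar> = \<bar>g' \<xi> - g' a\<bar> * \<bar>b\<bar>" by (simp add: abs_mult)
    \<comment> \<open>The cut is at \<open>2 * k\<close>, since beyond it \<open>\<bar>b\<bar>\<close> is at most twice its excess over \<open>k\<close>.\<close>
    have "\<bar>g' \<xi> - g' a\<bar> * \<bar>b\<bar> \<le> 2 * k * K * \<epsilon> * \<bar>b\<bar> + 4 * L * \<bar>excess k b\<bar>"
    proof (cases "\<bar>b\<bar> \<le> 2 * k")
      case True
      have "\<bar>g' \<xi> - g' a\<bar> \<le> K * (\<epsilon> * \<bar>b\<bar>)"
        using g'_lip[of \<xi> a] mult_left_mono[OF \<xi>(1) K_nonneg] by linarith
      also have "\<dots> \<le> K * (\<epsilon> * (2 * k))" using True \<epsilon> K_nonneg by (intro mult_left_mono) auto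
      finally have "\<bar>g' \<xi> - g' a\<bar> * \<bar>b\<bar> \<le> (K * (\<epsilon> * (2 * k))) * \<bar>b\<bar>" by (rule mult_right_mono) simp
      moreover have "0 \<le> 4 * L * \<bar>excess k b\<bar>" using L_nonneg by simp
      ultimately show ?thesis by (simp add: algebra_simps)
    next
      case False
      then have "\<bar>b\<bar> \<le> 2 * \<bar>excess k b\<bar>" using k by (auto simp: excess_def max_def min_def abs_if split: if_splits)
      moreover have "\<bar>g' \<xi> - g' a\<bar> \<le> 2 * L" using g'_bound[of \<xi>] g'_bound[of a] by linarith
      ultimately have "\<bar>g' \<xi> - g' a\<bar> * \<bar>b\<bar> \<le> (2 * L) * (2 * \<bar>excess k b\<bar>)"
        using L_nonneg by (intro mult_mono) auto
      moreover have "0 \<le> 2 * k * K * \<epsilon> * \<bar>b\<bar>" using k K_nonneg \<epsilon> by simp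
      ultimately show ?thesis by linarith
    qed
    with eq elim show ?case by (simp add: b_def)
  qed
qed (use k K_nonneg L_nonneg \<epsilon> in auto)

lemma N_quot_tendsto:
  assumes \<epsilon>: "\<And>n. \<epsilon> n > 0" "\<epsilon> \<longlonglongrightarrow> 0" and w: "w \<longlonglongrightarrow> w0"
  shows "(\<lambda>n. N_quot u (\<epsilon> n) (w n)) \<longlonglongrightarrow> N_deriv u w0"
proof -
  have "(\<lambda>n. N_quot u (\<epsilon> n) w0 - N_deriv u w0) \<longlonglongrightarrow> 0"
  proof (rule LIMSEQ_I)
    fix e :: real assume e: "e > 0"
    have "(\<lambda>k. 4 * L * norm (tail (real k) w0)) \<longlonglongrightarrow> 4 * L * 0"
      by (intro tendsto_intros tail_tendsto_0)
    then have "eventually (\<lambda>k. 4 * L * norm (tail (real k) w0) < e / 2) sequentially"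
      by (rule order_tendstoD) (use e in simp)
    then obtain k :: nat where k: "4 * L * norm (tail (real k) w0) < e / 2"
      by (auto simp: eventually_sequentially)
    have "(\<lambda>n. 2 * real k * K * \<epsilon> n * norm w0) \<longlonglongrightarrow> 2 * real k * K * 0 * norm w0"
      by (intro tendsto_intros \<epsilon>)
    then have "eventually (\<lambda>n. 2 * real k * K * \<epsilon> n * norm w0 < e / 2) sequentially"
      by (rule order_tendstoD) (use e in simp)
    then obtain n0 where n0: "\<And>n. n \<ge> n0 \<Longrightarrow> 2 * real k * K * \<epsilon> n * norm w0 < e / 2"
      by (auto simp: eventually_sequentially)
    have "norm (N_quot u (\<epsilon> n) w0 - N_deriv u w0 - 0) < e" if "n \<ge> n0" for n
      using norm_N_quot_diff_le[OF \<epsilon>(1), of "real k" u n w0] k n0[OF that] by simp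
    then show "\<exists>n0. \<forall>n\<ge>n0. norm (N_quot u (\<epsilon> n) w0 - N_deriv u w0 - 0) < e" by blast
  qed
  moreover have "(\<lambda>n. N_quot u (\<epsilon> n) (w n) - N_quot u (\<epsilon> n) w0) \<longlonglongrightarrow> 0"
  proof (rule Lim_null_comparison[OF always_eventually])
    show "\<forall>n. norm (N_quot u (\<epsilon> n) (w n) - N_quot u (\<epsilon> n) w0) \<le> L * norm (w n - w0)"
      using N_quot_lipschitz \<epsilon>(1) by blast
    show "(\<lambda>n. L * norm (w n - w0)) \<longlonglongrightarrow> 0"
      using w by (intro tendsto_mult_right_zero tendsto_norm_zero) (simp add: LIM_zero)
  qed
  ultimately have "(\<lambda>n. (N_quot u (\<epsilon> n) (w n) - N_quot u (\<epsilon> n) w0) + (N_quot u (\<epsilon> n) w0 - N_deriv u w0)) \<longlonglongrightarrow> 0 + 0"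
    by (intro tendsto_add)
  then show ?thesis by (simp add: LIM_zero_iff)
qed

end

section \<open>Uniform convergence of difference quotients\<close>

text \<open>If the difference quotients converge uniformly in the base point and in the direction, then the limit
  \<open>D x h\<close> inherits everything from them: each quotient is Lipschitz in \<open>x\<close>, uniformly for \<open>norm h \<le> 1\<close>,
  hence \<open>x \<mapsto> D x\<close> is continuous in operator norm; the quotient in direction \<open>h1 + h2\<close> is the sum of
  quotients at \<open>x\<close> and at \<open>x + \<epsilon> *\<^sub>R h1\<close>, hence \<open>D x\<close> is additive; and uniformity in \<open>h\<close> turns directional
  derivatives into a Frechet derivative.\<close>

lemma uniformly_Cauchy_quotients_imp_C1:
  fixes X :: "'h::real_normed_vector \<Rightarrow> 'p::banach" and C :: real
  assumes C: "0 \<le> C" and lip: "\<And>x y. norm (X x - X y) \<le> C * norm (x - y)"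
    and cauchy: "\<And>\<eta>. \<eta> > 0 \<Longrightarrow> \<exists>\<epsilon>0>0. \<forall>x h \<epsilon> \<epsilon>'. norm h \<le> 1 \<longrightarrow> 0 < \<epsilon> \<longrightarrow> \<epsilon> < \<epsilon>0 \<longrightarrow> 0 < \<epsilon>' \<longrightarrow> \<epsilon>' < \<epsilon>0 \<longrightarrow>
      norm ((X (x + \<epsilon> *\<^sub>R h) - X x) /\<^sub>R \<epsilon> - (X (x + \<epsilon>' *\<^sub>R h) - X x) /\<^sub>R \<epsilon>') \<le> \<eta>"
  obtains DX :: "'h \<Rightarrow> ('h \<Rightarrow>\<^sub>L 'p)" where
    "\<And>x. (X has_derivative blinfun_apply (DX x)) (at x)"
    "continuous_on UNIV DX" "bounded (range DX)"
    "\<And>x h. (\<lambda>n. (X (x + inverse (real (Suc n)) *\<^sub>R h) - X x) /\<^sub>R inverse (real (Suc n))) \<longlonglongrightarrow> DX x h"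
proof -
  define q where "q \<epsilon> x h = (X (x + \<epsilon> *\<^sub>R h) - X x) /\<^sub>R \<epsilon>" for \<epsilon> x h
  define e where "e n = inverse (real (Suc n))" for n
  define D where "D x h = lim (\<lambda>n. q (e n) x h)" for x h
  have e: "e n > 0" "e \<longlonglongrightarrow> 0" for n
    unfolding e_def[abs_def] using LIMSEQ_inverse_real_of_nat by simp_all
  have q_scale: "q \<epsilon> x (c *\<^sub>R h) = c *\<^sub>R q (\<epsilon> * c) x h" if "c > 0" for \<epsilon> c x h
    using that by (simp add: q_def)
  have q_norm: "norm (q \<epsilon> x h) \<le> C * norm h" if "\<epsilon> > 0" for \<epsilon> x h
  proof -
    have "norm (q \<epsilon> x h) = inverse \<epsilon> * norm (X (x + \<epsilon> *\<^sub>R h) - X x)"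
      using that by (simp add: q_def)
    also have "\<dots> \<le> inverse \<epsilon> * (C * (\<epsilon> * norm h))"
      using lip[of "x + \<epsilon> *\<^sub>R h" x] that by (intro mult_left_mono) auto
    also have "\<dots> = C * norm h" using that by simp
    finally show ?thesis .
  qed
  have q_lip: "norm (q \<epsilon> x h - q \<epsilon> y h) \<le> 2 * C / \<epsilon> * norm (x - y)" if "\<epsilon> > 0" for \<epsilon> x y h
  proof -
    have "norm ((X (x + \<epsilon> *\<^sub>R h) - X (y + \<epsilon> *\<^sub>R h)) - (X x - X y)) \<le> 2 * C * norm (x - y)"
      using norm_triangle_ineq4[of "X (x + \<epsilon> *\<^sub>R h) - X (y + \<epsilon> *\<^sub>R h)" "X x - X y"]
        lip[of "x + \<epsilon> *\<^sub>R h" "y + \<epsilon> *\<^sub>R h"] lip[of x y] by simp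
    moreover have "q \<epsilon> x h - q \<epsilon> y h = ((X (x + \<epsilon> *\<^sub>R h) - X (y + \<epsilon> *\<^sub>R h)) - (X x - X y)) /\<^sub>R \<epsilon>"
      by (simp add: q_def algebra_simps)
    ultimately show ?thesis using that by (simp add: divide_inverse_commute mult_left_mono)
  qed
  \<comment> \<open>Rescaling \<open>h\<close> and \<open>\<epsilon>\<close> replaces the unit ball by an arbitrary ball.\<close>
  have cauchy_R: "\<exists>\<epsilon>0>0. \<forall>x h \<epsilon> \<epsilon>'. norm h \<le> R \<longrightarrow> 0 < \<epsilon> \<longrightarrow> \<epsilon> < \<epsilon>0 \<longrightarrow> 0 < \<epsilon>' \<longrightarrow> \<epsilon>' < \<epsilon>0 \<longrightarrow>
      norm (q \<epsilon> x h - q \<epsilon>' x h) \<le> \<eta>" if R: "R > 0" and \<eta>: "\<eta> > 0" for R \<eta>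
  proof -
    obtain \<epsilon>0 where \<epsilon>0: "\<epsilon>0 > 0" "\<And>x h \<epsilon> \<epsilon>'. norm h \<le> 1 \<Longrightarrow> 0 < \<epsilon> \<Longrightarrow> \<epsilon> < \<epsilon>0 \<Longrightarrow> 0 < \<epsilon>' \<Longrightarrow> \<epsilon>' < \<epsilon>0 \<Longrightarrow>
        norm (q \<epsilon> x h - q \<epsilon>' x h) \<le> \<eta> / R"
      using cauchy[of "\<eta> / R"] R \<eta> unfolding q_def by auto
    show ?thesis
    proof (intro exI[of _ "\<epsilon>0 / R"] conjI allI impI)
      fix x h :: 'h and \<epsilon> \<epsilon>' :: real
      assume a: "norm h \<le> R" "0 < \<epsilon>" "\<epsilon> < \<epsilon>0 / R" "0 < \<epsilon>'" "\<epsilon>' < \<epsilon>0 / R"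
      have "norm (q (\<epsilon> * R) x (h /\<^sub>R R) - q (\<epsilon>' * R) x (h /\<^sub>R R)) \<le> \<eta> / R"
        using a R by (intro \<epsilon>0(2)) (auto simp: field_simps)
      moreover have "q \<epsilon> x h - q \<epsilon>' x h = R *\<^sub>R (q (\<epsilon> * R) x (h /\<^sub>R R) - q (\<epsilon>' * R) x (h /\<^sub>R R))"
        using q_scale[OF R, of \<epsilon> x "h /\<^sub>R R"] q_scale[OF R, of \<epsilon>' x "h /\<^sub>R R"] R
        by (simp add: scaleR_diff_right)
      ultimately show "norm (q \<epsilon> x h - q \<epsilon>' x h) \<le> \<eta>" using R by (simp add: le_divide_eq mult.commute)
    qed (use \<epsilon>0(1) R in simp)
  qed
  have D_lim: "(\<lambda>n. q (e n) x h) \<longlonglongrightarrow> D x h" for x h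
  proof -
    have "Cauchy (\<lambda>n. q (e n) x h)"
    proof (rule CauchyI)
      fix \<eta> :: real assume \<eta>: "\<eta> > 0"
      obtain \<epsilon>0 where \<epsilon>0: "\<epsilon>0 > 0" "\<And>\<epsilon> \<epsilon>'. 0 < \<epsilon> \<Longrightarrow> \<epsilon> < \<epsilon>0 \<Longrightarrow> 0 < \<epsilon>' \<Longrightarrow> \<epsilon>' < \<epsilon>0 \<Longrightarrow>
          norm (q \<epsilon> x h - q \<epsilon>' x h) \<le> \<eta> / 2"
        using cauchy_R[of "norm h + 1" "\<eta> / 2"] \<eta> by (auto simp: add_nonneg_pos)
      have "eventually (\<lambda>n. e n < \<epsilon>0) sequentially" using e(2) \<epsilon>0(1) by (rule order_tendstoD)
      then obtain n0 where n0: "\<And>n. n \<ge> n0 \<Longrightarrow> e n < \<epsilon>0" by (auto simp: eventually_sequentially)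
      have "norm (q (e m) x h - q (e n) x h) < \<eta>" if "m \<ge> n0" "n \<ge> n0" for m n
        using \<epsilon>0(2)[OF e(1)[of m] n0[OF that(1)] e(1)[of n] n0[OF that(2)]] \<eta> by linarith
      then show "\<exists>n0. \<forall>m\<ge>n0. \<forall>n\<ge>n0. norm (q (e m) x h - q (e n) x h) < \<eta>" by blast
    qed
    then show ?thesis unfolding D_def using Cauchy_convergent convergent_LIMSEQ_iff by blast
  qed
  have unif: "\<exists>\<epsilon>0>0. \<forall>x h \<epsilon>. norm h \<le> R \<longrightarrow> 0 < \<epsilon> \<longrightarrow> \<epsilon> < \<epsilon>0 \<longrightarrow> norm (q \<epsilon> x h - D x h) \<le> \<eta>"
    if R: "R > 0" and \<eta>: "\<eta> > 0" for R \<eta>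
  proof -
    obtain \<epsilon>0 where \<epsilon>0: "\<epsilon>0 > 0" "\<And>x h \<epsilon> \<epsilon>'. norm h \<le> R \<Longrightarrow> 0 < \<epsilon> \<Longrightarrow> \<epsilon> < \<epsilon>0 \<Longrightarrow> 0 < \<epsilon>' \<Longrightarrow> \<epsilon>' < \<epsilon>0 \<Longrightarrow>
        norm (q \<epsilon> x h - q \<epsilon>' x h) \<le> \<eta>"
      using cauchy_R[OF R \<eta>] by blast
    have "norm (q \<epsilon> x h - D x h) \<le> \<eta>" if "norm h \<le> R" "0 < \<epsilon>" "\<epsilon> < \<epsilon>0" for x h \<epsilon>
    proof (rule Lim_norm_ubound[OF trivial_limit_sequentially tendsto_diff[OF tendsto_const D_lim]])
      have "eventually (\<lambda>n. e n < \<epsilon>0) sequentially" using e(2) \<epsilon>0(1) by (rule order_tendstoD)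
      then show "eventually (\<lambda>n. norm (q \<epsilon> x h - q (e n) x h) \<le> \<eta>) sequentially"
        by eventually_elim (use that e(1) \<epsilon>0(2) in blast)
    qed
    with \<epsilon>0(1) show ?thesis by blast
  qed
  have D_cont: "\<exists>\<delta>>0. \<forall>x y h. norm h \<le> R \<longrightarrow> norm (x - y) < \<delta> \<longrightarrow> norm (D x h - D y h) \<le> \<eta>"
    if R: "R > 0" and \<eta>: "\<eta> > 0" for R \<eta>
  proof -
    obtain \<epsilon>0 where \<epsilon>0: "\<epsilon>0 > 0" "\<And>x h \<epsilon>. norm h \<le> R \<Longrightarrow> 0 < \<epsilon> \<Longrightarrow> \<epsilon> < \<epsilon>0 \<Longrightarrow> norm (q \<epsilon> x h - D x h) \<le> \<eta> / 3"
      using unif[OF R, of "\<eta> / 3"] \<eta> by auto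
    define \<epsilon> where "\<epsilon> = \<epsilon>0 / 2"
    have \<epsilon>: "0 < \<epsilon>" "\<epsilon> < \<epsilon>0" using \<epsilon>0(1) by (auto simp: \<epsilon>_def)
    define k where "k = 2 * C / \<epsilon> + 1"
    define \<delta> where "\<delta> = \<eta> / 3 / k"
    have pos: "k > 0" unfolding k_def using C \<epsilon>(1) by (intro add_nonneg_pos) auto
    have \<delta>: "\<delta> > 0" using \<eta> pos by (simp add: \<delta>_def)
    have "norm (D x h - D y h) \<le> \<eta>" if h: "norm h \<le> R" and xy: "norm (x - y) < \<delta>" for x y h
    proof -
      have "norm (q \<epsilon> x h - q \<epsilon> y h) \<le> k * norm (x - y)"
        using q_lip[OF \<epsilon>(1), of x h y] by (simp add: k_def distrib_right add_increasing2)
      also have "\<dots> \<le> k * \<delta>" using xy pos by (intro mult_left_mono) auto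
      also have "\<dots> = \<eta> / 3" using pos by (simp add: \<delta>_def)
      finally have 1: "norm (q \<epsilon> x h - q \<epsilon> y h) \<le> \<eta> / 3" .
      have "D x h - D y h = (q \<epsilon> x h - q \<epsilon> y h) - (q \<epsilon> x h - D x h) + (q \<epsilon> y h - D y h)" by simp
      also have "norm \<dots> \<le> norm (q \<epsilon> x h - q \<epsilon> y h) + norm (q \<epsilon> x h - D x h) + norm (q \<epsilon> y h - D y h)"
        by (intro order_trans[OF norm_triangle_ineq] add_mono norm_triangle_ineq4 order_refl)
      also have "\<dots> \<le> \<eta>" using 1 \<epsilon>0(2)[OF h \<epsilon>, of x] \<epsilon>0(2)[OF h \<epsilon>, of y] by linarith
      finally show ?thesis .
    qed
    with \<delta> show ?thesis by blast
  qed
  have limit: "(\<lambda>n. q (\<epsilon> n) (y n) h) \<longlonglongrightarrow> D x h"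
    if \<epsilon>: "\<And>n. \<epsilon> n > 0" "\<epsilon> \<longlonglongrightarrow> 0" and y: "y \<longlonglongrightarrow> x" for \<epsilon> y x h
  proof (rule LIMSEQ_I)
    fix \<eta> :: real assume \<eta>: "\<eta> > 0"
    have R: "norm h + 1 > 0" by (simp add: add_nonneg_pos)
    obtain \<epsilon>0 where \<epsilon>0: "\<epsilon>0 > 0" "\<And>x \<epsilon>. 0 < \<epsilon> \<Longrightarrow> \<epsilon> < \<epsilon>0 \<Longrightarrow> norm (q \<epsilon> x h - D x h) \<le> \<eta> / 3"
      using unif[OF R, of "\<eta> / 3"] \<eta> by auto
    obtain \<delta> where \<delta>: "\<delta> > 0" "\<And>x y. norm (x - y) < \<delta> \<Longrightarrow> norm (D x h - D y h) \<le> \<eta> / 3"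
      using D_cont[OF R, of "\<eta> / 3"] \<eta> by auto
    have "eventually (\<lambda>n. \<epsilon> n < \<epsilon>0) sequentially" using \<epsilon>(2) \<epsilon>0(1) by (rule order_tendstoD)
    moreover have "eventually (\<lambda>n. dist (y n) x < \<delta>) sequentially" using y \<delta>(1) by (rule tendstoD)
    ultimately have "eventually (\<lambda>n. norm (q (\<epsilon> n) (y n) h - D x h) < \<eta>) sequentially"
    proof eventually_elim
      case (elim n)
      have "norm (q (\<epsilon> n) (y n) h - D x h) \<le> norm (q (\<epsilon> n) (y n) h - D (y n) h) + norm (D (y n) h - D x h)"
        using norm_triangle_ineq[of "q (\<epsilon> n) (y n) h - D (y n) h" "D (y n) h - D x h"] by simp
      also have "\<dots> < \<eta>"
        using \<epsilon>0(2)[OF \<epsilon>(1) elim(1), of "y n"] \<delta>(2)[of "y n" x] elim(2) \<eta> by (simp add: dist_norm)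
      finally show ?case .
    qed
    then show "\<exists>n0. \<forall>n\<ge>n0. norm (q (\<epsilon> n) (y n) h - D x h) < \<eta>" by (simp add: eventually_sequentially)
  qed
  have D_norm: "norm (D x h) \<le> C * norm h" for x h
    by (rule Lim_norm_ubound[OF trivial_limit_sequentially D_lim]) (simp add: q_norm e)
  have D_add: "D x (h1 + h2) = D x h1 + D x h2" for x h1 h2
  proof -
    have "(\<lambda>n. x + e n *\<^sub>R h1) \<longlonglongrightarrow> x + 0 *\<^sub>R h1" by (intro tendsto_intros e)
    then have "(\<lambda>n. q (e n) x h1 + q (e n) (x + e n *\<^sub>R h1) h2) \<longlonglongrightarrow> D x h1 + D x h2"
      by (intro tendsto_add D_lim limit e) simp
    moreover have "q (e n) x h1 + q (e n) (x + e n *\<^sub>R h1) h2 = q (e n) x (h1 + h2)" for n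
      by (simp add: q_def algebra_simps)
    ultimately show ?thesis using LIMSEQ_unique[OF D_lim[of x "h1 + h2"]] by simp
  qed
  have D_scale_pos: "D x (c *\<^sub>R h) = c *\<^sub>R D x h" if c: "c > 0" for x c h
  proof -
    have "(\<lambda>n. e n * c) \<longlonglongrightarrow> 0 * c" by (intro tendsto_intros e)
    then have "(\<lambda>n. c *\<^sub>R q (e n * c) x h) \<longlonglongrightarrow> c *\<^sub>R D x h"
      using c e by (intro tendsto_scaleR tendsto_const limit) auto
    then show ?thesis using LIMSEQ_unique[OF D_lim[of x "c *\<^sub>R h"]] q_scale[OF c] by simp
  qed
  have D_0: "D x 0 = 0" for x using D_norm[of x 0] by simp
  have D_minus: "D x (- h) = - D x h" for x h
    using D_add[of x h "- h"] D_0 by (simp add: eq_neg_iff_add_eq_0 add.commute)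
  have D_scale: "D x (c *\<^sub>R h) = c *\<^sub>R D x h" for x c h
  proof (cases c "0::real" rule: linorder_cases)
    case less
    then show ?thesis using D_scale_pos[of "- c" x h] D_minus[of x "c *\<^sub>R h"] by simp
  qed (use D_0 D_scale_pos in auto)
  have D_linear: "bounded_linear (D x)" for x
    using D_norm D_add D_scale by (intro bounded_linear_intro[of _ C]) (simp_all add: mult.commute)
  define DX where "DX x = Blinfun (D x)" for x
  have DX: "blinfun_apply (DX x) = D x" for x
    unfolding DX_def by (rule bounded_linear_Blinfun_apply[OF D_linear])
  show thesis
  proof
    show "(X has_derivative blinfun_apply (DX x)) (at x)" for x
      unfolding DX has_derivative_at
    proof (intro conjI D_linear LIM_I)
      fix \<eta> :: real assume \<eta>: "\<eta> > 0"
      obtain \<epsilon>0 where \<epsilon>0: "\<epsilon>0 > 0" "\<And>h \<epsilon>. norm h \<le> 1 \<Longrightarrow> 0 < \<epsilon> \<Longrightarrow> \<epsilon> < \<epsilon>0 \<Longrightarrow> norm (q \<epsilon> x h - D x h) \<le> \<eta> / 2"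
        using unif[of 1 "\<eta> / 2"] \<eta> by auto
      have "norm (norm (X (x + h) - X x - D x h) / norm h - 0) < \<eta>" if h: "h \<noteq> 0" "norm h < \<epsilon>0" for h
      proof -
        have "X (x + h) - X x - D x h = norm h *\<^sub>R (q (norm h) x (h /\<^sub>R norm h) - D x (h /\<^sub>R norm h))"
          using h(1) by (simp add: q_def scaleR_diff_right D_scale)
        then have "norm (X (x + h) - X x - D x h) / norm h = norm (q (norm h) x (h /\<^sub>R norm h) - D x (h /\<^sub>R norm h))"
          using h(1) by simp
        also have "\<dots> \<le> \<eta> / 2" using h by (intro \<epsilon>0(2)) auto
        finally show ?thesis using \<eta> by (simp only: diff_0_right real_norm_def abs_divide abs_norm_cancel)
      qed
      then show "\<exists>s>0. \<forall>h. h \<noteq> 0 \<and> norm (h - 0) < s \<longrightarrow> norm (norm (X (x + h) - X x - D x h) / norm h - 0) < \<eta>"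
        using \<epsilon>0(1) by auto
    qed
    show "continuous_on UNIV DX"
      unfolding continuous_on_iff
    proof (intro ballI allI impI)
      fix x0 :: 'h and \<eta> :: real assume "\<eta> > 0"
      then obtain \<delta> where \<delta>: "\<delta> > 0" "\<And>x y h. norm h \<le> 1 \<Longrightarrow> norm (x - y) < \<delta> \<Longrightarrow> norm (D x h - D y h) \<le> \<eta> / 2"
        using D_cont[of 1 "\<eta> / 2"] by auto
      have "dist (DX y) (DX x0) < \<eta>" if "dist y x0 < \<delta>" for y
      proof -
        have "norm (DX y - DX x0) \<le> \<eta> / 2"
        proof (rule norm_blinfun_bound)
          fix h :: 'h
          show "norm (blinfun_apply (DX y - DX x0) h) \<le> \<eta> / 2 * norm h"
          proof (cases "h = 0")
            case False
            have 1: "D y h - D x0 h = norm h *\<^sub>R (D y (h /\<^sub>R norm h) - D x0 (h /\<^sub>R norm h))"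
              using False by (simp add: D_scale scaleR_diff_right)
            have 2: "norm (D y (h /\<^sub>R norm h) - D x0 (h /\<^sub>R norm h)) \<le> \<eta> / 2"
              using False that by (intro \<delta>(2)) (auto simp: dist_norm)
            show ?thesis
              unfolding blinfun.diff_left DX 1 norm_scaleR abs_norm_cancel mult.commute[of "\<eta> / 2"]
              by (rule mult_left_mono[OF 2 norm_ge_zero])
          qed (simp add: blinfun.zero_right)
        qed (use \<open>\<eta> > 0\<close> in simp)
        then show ?thesis using \<open>\<eta> > 0\<close> by (simp add: dist_norm)
      qed
      with \<delta>(1) show "\<exists>d>0. \<forall>y\<in>UNIV. dist y x0 < d \<longrightarrow> dist (DX y) (DX x0) < \<eta>" by blast
    qed
    have "norm (DX x) \<le> C" for x
      by (rule norm_blinfun_bound) (simp_all add: C DX D_norm)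
    then show "bounded (range DX)" by (auto simp: bounded_iff)
    show "(\<lambda>n. (X (x + inverse (real (Suc n)) *\<^sub>R h) - X x) /\<^sub>R inverse (real (Suc n))) \<longlonglongrightarrow> DX x h" for x h
      using D_lim[of x h] unfolding DX q_def e_def .
  qed
qed

section \<open>Linear evolution equations with paths in \<open>E\<close>\<close>

locale linear_evolution =
  fixes T :: real
    and j :: "'v::{real_inner, banach, second_countable_topology} \<Rightarrow> 'h::{real_inner, banach, second_countable_topology}"
    and A :: "'v \<Rightarrow>\<^sub>L ('v \<Rightarrow>\<^sub>L real)"
    and evE :: "'e::real_normed_vector \<Rightarrow> real \<Rightarrow> 'h"
    and c :: real
  assumes T: "T > 0"
    and embedding: "dense_compact_embedding j"
    and c: "c > 0" "\<And>v. blinfun_apply (blinfun_apply A v) v \<ge> c * (norm v)\<^sup>2"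
    and E: "is_E_space T j evE"
begin

lemma j: "bounded_linear j" and j_inj: "inj j" and j_dense: "closure (range j) = UNIV"
  and j_compact: "bounded B \<Longrightarrow> compact (closure (j ` B))"
  using embedding by (auto simp: dense_compact_embedding_def)

lemma A_bilinear: "bounded_bilinear (\<lambda>u v. blinfun_apply (blinfun_apply A u) v)"
  by (rule bounded_bilinear.comp1[OF bounded_bilinear_blinfun_apply blinfun.bounded_linear_right])

text \<open>The path in \<open>V\<close>; it has this meaning for almost every time only.\<close>

definition vpath :: "'e \<Rightarrow> real \<Rightarrow> 'v" where
  "vpath u s = inv j (evE u s)"

lemma ev_continuous: "continuous_on {0..T} (evE u)"
  and vpath_ae: "AE s in lebesgue_on {0..T}. j (vpath u s) = evE u s"
  and vpath_measurable: "vpath u \<in> borel_measurable (lebesgue_on {0..T})"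
  and vpath_sq: "integrable (lebesgue_on {0..T}) (\<lambda>s. (norm (vpath u s))\<^sup>2)"
proof -
  have p: "path_in_E T j (evE u)" using E by (simp add: is_E_space_def)
  then show "continuous_on {0..T} (evE u)" "vpath u \<in> borel_measurable (lebesgue_on {0..T})"
    "integrable (lebesgue_on {0..T}) (\<lambda>s. (norm (vpath u s))\<^sup>2)"
    by (simp_all add: path_in_E_def vpath_def[abs_def])
  have "AE s in lebesgue_on {0..T}. evE u s \<in> range j" using p by (simp add: path_in_E_def)
  then show "AE s in lebesgue_on {0..T}. j (vpath u s) = evE u s"
    by eventually_elim (simp add: vpath_def f_inv_into_f)
qed

lemma integrable_const_on: "integrable (lebesgue_on {0..T}) (\<lambda>s. b :: real)"
  by (intro finite_measure.integrable_const finite_measure_lebesgue_on) simp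

lemma vpath_integrable: "integrable (lebesgue_on {0..T}) (vpath u)"
proof (rule Bochner_Integration.integrable_bound)
  show "integrable (lebesgue_on {0..T}) (\<lambda>s. 1 + (norm (vpath u s))\<^sup>2)"
    by (intro Bochner_Integration.integrable_add integrable_const_on vpath_sq)
  have "x \<le> 1 + x\<^sup>2" if "x \<ge> 0" for x :: real
    using sum_squares_bound[of x 1] that by simp
  then show "AE s in lebesgue_on {0..T}. norm (vpath u s) \<le> norm (1 + (norm (vpath u s))\<^sup>2)"
    by (intro AE_I2) simp
qed (rule vpath_measurable)

lemma ev_diff: "t \<in> {0..T} \<Longrightarrow> evE (u - w) t = evE u t - evE w t"
  and ev_scale: "t \<in> {0..T} \<Longrightarrow> evE (b *\<^sub>R u) t = b *\<^sub>R evE u t"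
proof -
  have add: "t \<in> {0..T} \<Longrightarrow> evE (u + w) t = evE u t + evE w t" for u w
    using E by (simp add: is_E_space_def)
  from add[of "u - w" w] show "t \<in> {0..T} \<Longrightarrow> evE (u - w) t = evE u t - evE w t" by simp
  show "t \<in> {0..T} \<Longrightarrow> evE (b *\<^sub>R u) t = b *\<^sub>R evE u t"
    using E by (simp add: is_E_space_def)
qed

lemma vpath_diff: "AE s in lebesgue_on {0..T}. vpath (u - w) s = vpath u s - vpath w s"
  using vpath_ae[of u] vpath_ae[of w] vpath_ae[of "u - w"] AE_space[of "lebesgue_on {0..T}"]
proof eventually_elim
  case (elim s)
  then have "j (vpath (u - w) s) = j (vpath u s - vpath w s)"
    by (simp add: ev_diff linear_simps(2)[OF j])
  then show ?case by (rule injD[OF j_inj])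
qed

lemma vpath_scale: "AE s in lebesgue_on {0..T}. vpath (b *\<^sub>R u) s = b *\<^sub>R vpath u s"
  using vpath_ae[of u] vpath_ae[of "b *\<^sub>R u"] AE_space[of "lebesgue_on {0..T}"]
proof eventually_elim
  case (elim s)
  then have "j (vpath (b *\<^sub>R u) s) = j (b *\<^sub>R vpath u s)"
    by (simp add: ev_scale linear_simps(5)[OF j])
  then show ?case by (rule injD[OF j_inj])
qed

lemma norm_E: "norm u = (SUP t\<in>{0..T}. norm (evE u t)) + sqrt (LINT s|lebesgue_on {0..T}. (norm (vpath u s))\<^sup>2)"
  using E by (simp add: is_E_space_def vpath_def)

lemma ev_norm_le: assumes t: "t \<in> {0..T}" shows "norm (evE u t) \<le> norm u"
proof -
  have "bdd_above ((\<lambda>t. norm (evE u t)) ` {0..T})"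
    by (intro compact_imp_bounded[THEN bounded_imp_bdd_above] compact_continuous_image
        continuous_intros ev_continuous compact_Icc)
  then have "norm (evE u t) \<le> (SUP t\<in>{0..T}. norm (evE u t))" using t by (intro cSUP_upper)
  moreover have "0 \<le> (LINT s|lebesgue_on {0..T}. (norm (vpath u s))\<^sup>2)" by simp
  ultimately show ?thesis by (simp add: norm_E add_increasing2)
qed

lemma ev_tendsto:
  assumes lim: "d \<longlonglongrightarrow> Y" and t: "t \<in> {0..T}"
  shows "(\<lambda>n. evE (d n) t) \<longlonglongrightarrow> evE Y t"
proof -
  have "(\<lambda>n. norm (d n - Y)) \<longlonglongrightarrow> 0" using lim by (simp add: LIM_zero tendsto_norm_zero)
  then have "(\<lambda>n. evE (d n) t - evE Y t) \<longlonglongrightarrow> 0"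
    by (rule Lim_null_comparison[rotated]) (use ev_norm_le[OF t, of "d _ - Y"] in \<open>simp add: ev_diff[OF t]\<close>)
  then show ?thesis by (simp add: LIM_zero_iff)
qed

lemma vpath_norm_le: "(LINT s|lebesgue_on {0..T}. (norm (vpath u s))\<^sup>2) \<le> (norm u)\<^sup>2"
proof -
  have "0 \<le> norm (evE u 0)" by simp
  also have "norm (evE u 0) \<le> (SUP t\<in>{0..T}. norm (evE u t))"
    using T by (intro cSUP_upper compact_imp_bounded[THEN bounded_imp_bdd_above] compact_continuous_image
        continuous_intros ev_continuous compact_Icc) auto
  finally have "sqrt (LINT s|lebesgue_on {0..T}. (norm (vpath u s))\<^sup>2) \<le> norm u" by (simp add: norm_E)
  then show ?thesis by (simp add: sqrt_le_D)
qed

lemma norm_E_le: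
  assumes "\<And>t. t \<in> {0..T} \<Longrightarrow> (norm (evE u t))\<^sup>2 \<le> B" "(LINT s|lebesgue_on {0..T}. (norm (vpath u s))\<^sup>2) \<le> B"
  shows "norm u \<le> 2 * sqrt B"
proof -
  have "(SUP t\<in>{0..T}. norm (evE u t)) \<le> sqrt B"
    using T assms(1) by (intro cSUP_least real_le_rsqrt) auto
  moreover have "sqrt (LINT s|lebesgue_on {0..T}. (norm (vpath u s))\<^sup>2) \<le> sqrt B"
    using assms(2) by simp
  ultimately show ?thesis unfolding norm_E by linarith
qed

text \<open>The equation \<open>u' + A u = f\<close>, \<open>u 0 = z0\<close>, integrated in time and tested with \<open>v\<close>. Integrability is
  asked of the scalar products \<open>f s \<bullet> j v\<close>, the form in which it passes to limits of forcings.\<close>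

definition weak_solution :: "'h \<Rightarrow> (real \<Rightarrow> 'h) \<Rightarrow> 'e \<Rightarrow> bool" where
  "weak_solution z0 f u \<longleftrightarrow> (\<forall>v. integrable (lebesgue_on {0..T}) (\<lambda>s. f s \<bullet> j v)) \<and>
     (\<forall>t\<in>{0..T}. \<forall>v. evE u t \<bullet> j v + (LINT s|lebesgue_on {0..t}. A (vpath u s) v)
        = z0 \<bullet> j v + (LINT s|lebesgue_on {0..t}. f s \<bullet> j v))"

lemma integrable_A: "integrable (lebesgue_on {0..T}) (\<lambda>s. blinfun_apply (blinfun_apply A (vpath u s)) v)"
  by (rule integrable_bounded_linear[OF bounded_bilinear.bounded_linear_left[OF A_bilinear] vpath_integrable])

lemma integrable_on_initial:
  fixes f :: "real \<Rightarrow> 'b::{banach, second_countable_topology}"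
  assumes "integrable (lebesgue_on {0..T}) f" "t \<in> {0..T}"
  shows "integrable (lebesgue_on {0..t}) f"
  by (rule integrable_lebesgue_on_subset[OF assms(1)]) (use assms(2) in auto)

lemma AE_on_initial: "AE s in lebesgue_on {0..T}. Q s \<Longrightarrow> t \<in> {0..T} \<Longrightarrow> AE s in lebesgue_on {0..t}. Q s"
  by (auto simp: AE_restrict_space_iff elim!: eventually_mono)

lemma integral_A_diff:
  assumes t: "t \<in> {0..T}"
  shows "(LINT s|lebesgue_on {0..t}. A (vpath (u - w) s) v)
    = (LINT s|lebesgue_on {0..t}. A (vpath u s) v) - (LINT s|lebesgue_on {0..t}. A (vpath w s) v)"
proof -
  note i = integrable_on_initial[OF integrable_A t]
  have "(LINT s|lebesgue_on {0..t}. A (vpath (u - w) s) v) = (LINT s|lebesgue_on {0..t}. A (vpath u s) v - A (vpath w s) v)"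
    using i AE_on_initial[OF vpath_diff[of u w] t]
    by (intro integral_cong_AE) (auto elim!: eventually_mono simp: blinfun.diff_right blinfun.diff_left)
  also have "\<dots> = (LINT s|lebesgue_on {0..t}. A (vpath u s) v) - (LINT s|lebesgue_on {0..t}. A (vpath w s) v)"
    by (rule Bochner_Integration.integral_diff[OF i i])
  finally show ?thesis .
qed

lemma integral_A_scale:
  assumes t: "t \<in> {0..T}"
  shows "(LINT s|lebesgue_on {0..t}. A (vpath (b *\<^sub>R u) s) v) = b * (LINT s|lebesgue_on {0..t}. A (vpath u s) v)"
proof -
  note i = integrable_on_initial[OF integrable_A t]
  have "(LINT s|lebesgue_on {0..t}. A (vpath (b *\<^sub>R u) s) v) = (LINT s|lebesgue_on {0..t}. b * A (vpath u s) v)"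
    using i AE_on_initial[OF vpath_scale[of b u] t]
    by (intro integral_cong_AE borel_measurable_times)
       (auto elim!: eventually_mono simp: blinfun.scaleR_right blinfun.scaleR_left)
  then show ?thesis by simp
qed

lemma weak_solution_diff:
  assumes "weak_solution z1 f1 u1" "weak_solution z2 f2 u2"
  shows "weak_solution (z1 - z2) (\<lambda>s. f1 s - f2 s) (u1 - u2)"
  unfolding weak_solution_def
proof (intro conjI ballI allI)
  have i: "integrable (lebesgue_on {0..T}) (\<lambda>s. f1 s \<bullet> j v)" "integrable (lebesgue_on {0..T}) (\<lambda>s. f2 s \<bullet> j v)" for v
    using assms by (simp_all add: weak_solution_def)
  then show "integrable (lebesgue_on {0..T}) (\<lambda>s. (f1 s - f2 s) \<bullet> j v)" for v
    by (simp add: inner_diff_left)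
  fix t v assume t: "t \<in> {0..T}"
  have "(LINT s|lebesgue_on {0..t}. (f1 s - f2 s) \<bullet> j v) = (LINT s|lebesgue_on {0..t}. f1 s \<bullet> j v) - (LINT s|lebesgue_on {0..t}. f2 s \<bullet> j v)"
    using integrable_on_initial[OF i(1) t] integrable_on_initial[OF i(2) t] by (simp add: inner_diff_left)
  moreover have "evE u1 t \<bullet> j v + (LINT s|lebesgue_on {0..t}. A (vpath u1 s) v) = z1 \<bullet> j v + (LINT s|lebesgue_on {0..t}. f1 s \<bullet> j v)"
    "evE u2 t \<bullet> j v + (LINT s|lebesgue_on {0..t}. A (vpath u2 s) v) = z2 \<bullet> j v + (LINT s|lebesgue_on {0..t}. f2 s \<bullet> j v)"
    using assms t by (simp_all add: weak_solution_def)
  ultimately show "evE (u1 - u2) t \<bullet> j v + (LINT s|lebesgue_on {0..t}. A (vpath (u1 - u2) s) v)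
      = (z1 - z2) \<bullet> j v + (LINT s|lebesgue_on {0..t}. (f1 s - f2 s) \<bullet> j v)"
    by (simp add: integral_A_diff[OF t] ev_diff[OF t] inner_diff_left)
qed

lemma weak_solution_scale:
  assumes "weak_solution z0 f u"
  shows "weak_solution (b *\<^sub>R z0) (\<lambda>s. b *\<^sub>R f s) (b *\<^sub>R u)"
  unfolding weak_solution_def
proof (intro conjI ballI allI)
  show "integrable (lebesgue_on {0..T}) (\<lambda>s. (b *\<^sub>R f s) \<bullet> j v)" for v
    using assms by (simp add: weak_solution_def)
  fix t v assume t: "t \<in> {0..T}"
  have "evE u t \<bullet> j v + (LINT s|lebesgue_on {0..t}. A (vpath u s) v) = z0 \<bullet> j v + (LINT s|lebesgue_on {0..t}. f s \<bullet> j v)"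
    using assms t by (simp add: weak_solution_def)
  from arg_cong[OF this, of "\<lambda>x. b * x"]
  show "evE (b *\<^sub>R u) t \<bullet> j v + (LINT s|lebesgue_on {0..t}. A (vpath (b *\<^sub>R u) s) v)
      = (b *\<^sub>R z0) \<bullet> j v + (LINT s|lebesgue_on {0..t}. (b *\<^sub>R f s) \<bullet> j v)"
    by (simp add: integral_A_scale[OF t] ev_scale[OF t] distrib_left)
qed

lemma weak_solution_cong:
  assumes "\<And>s. s \<in> {0..T} \<Longrightarrow> f s = f' s"
  shows "weak_solution z0 f u \<longleftrightarrow> weak_solution z0 f' u"
proof -
  have "integrable (lebesgue_on {0..T}) (\<lambda>s. f s \<bullet> j v) = integrable (lebesgue_on {0..T}) (\<lambda>s. f' s \<bullet> j v)" for v
    by (rule Bochner_Integration.integrable_cong) (simp_all add: assms)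
  moreover have "(LINT s|lebesgue_on {0..t}. f s \<bullet> j v) = (LINT s|lebesgue_on {0..t}. f' s \<bullet> j v)" if "t \<in> {0..T}" for t v
    by (rule Bochner_Integration.integral_cong) (use that in \<open>auto simp: assms\<close>)
  ultimately show ?thesis by (simp add: weak_solution_def)
qed

lemma dense_orthogonal_eq: assumes "\<And>v. x \<bullet> j v = y \<bullet> j v" shows "x = y"
proof -
  have "closed {w. (x - y) \<bullet> w = 0}"
    by (intro closed_Collect_eq continuous_intros)
  moreover have "range j \<subseteq> {w. (x - y) \<bullet> w = 0}" using assms by (auto simp: inner_diff_left)
  ultimately have "closure (range j) \<subseteq> {w. (x - y) \<bullet> w = 0}" by (rule closure_minimal[rotated])
  then have "x - y \<in> {w. (x - y) \<bullet> w = 0}" using j_dense by blast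
  then show ?thesis by simp
qed

lemma weak_solution_initial: assumes "weak_solution z0 f u" shows "evE u 0 = z0"
proof (rule dense_orthogonal_eq)
  fix v
  have z: "(LINT s|lebesgue_on {0..0}. k s) = 0" for k :: "real \<Rightarrow> real"
    by (rule integral_eq_zero_null_sets) (simp add: negligible_iff_null_sets[symmetric])
  have "evE u 0 \<bullet> j v + (LINT s|lebesgue_on {0..0}. A (vpath u s) v) = z0 \<bullet> j v + (LINT s|lebesgue_on {0..0}. f s \<bullet> j v)"
    using assms less_imp_le[OF T] unfolding weak_solution_def by (meson atLeastAtMost_iff order_refl)
  then show "evE u 0 \<bullet> j v = z0 \<bullet> j v" by (simp only: z add_0_right)
qed

lemma weak_solution_estimate:
  assumes u: "weak_solution z0 f u" and r: "continuous_on {0..T} r"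
    "\<And>s. s \<in> {0..T} \<Longrightarrow> norm (f s) \<le> L * norm (evE u s) + r s" and L: "L \<ge> 0"
  shows "norm u \<le> 2 * sqrt (parabolic_const T c L * ((norm z0)\<^sup>2 + integral {0..T} (\<lambda>s. (r s)\<^sup>2)))"
proof (rule norm_E_le)
  have f: "integrable (lebesgue_on {0..T}) (\<lambda>s. f s \<bullet> j v)" for v
    using u by (simp add: weak_solution_def)
  have eq: "(evE u t - evE u s) \<bullet> j v = (LINT x|lebesgue_on {s..t}. f x \<bullet> j v - A (vpath u x) v)"
    if st: "0 \<le> s" "s \<le> t" "t \<le> T" for s t v
  proof -
    have "t \<in> {0..T}" "s \<in> {0..T}" using st by auto
    note i = integrable_on_initial[OF f this(1), of v] integrable_on_initial[OF f this(2), of v]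
      integrable_on_initial[OF integrable_A this(1), of u v] integrable_on_initial[OF integrable_A this(2), of u v]
    have "evE u t \<bullet> j v + (LINT s|lebesgue_on {0..t}. A (vpath u s) v) = z0 \<bullet> j v + (LINT s|lebesgue_on {0..t}. f s \<bullet> j v)"
      "evE u s \<bullet> j v + (LINT s|lebesgue_on {0..s}. A (vpath u s) v) = z0 \<bullet> j v + (LINT s|lebesgue_on {0..s}. f s \<bullet> j v)"
      using u st by (simp_all add: weak_solution_def)
    then have "(evE u t - evE u s) \<bullet> j v = (LINT x|lebesgue_on {0..t}. f x \<bullet> j v - A (vpath u x) v)
        - (LINT x|lebesgue_on {0..s}. f x \<bullet> j v - A (vpath u x) v)"
      using i by (simp add: inner_diff_left)
    also have "\<dots> = (LINT x|lebesgue_on {s..t}. f x \<bullet> j v - A (vpath u x) v)"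
      using f integrable_A st by (intro integral_combine_increment Bochner_Integration.integrable_diff) auto
    finally show ?thesis .
  qed
  note est = parabolic_a_priori_estimate[OF j A_bilinear c ev_continuous vpath_integrable vpath_ae vpath_sq f eq r L T,
      unfolded weak_solution_initial[OF u]]
  show "(norm (evE u t))\<^sup>2 \<le> parabolic_const T c L * ((norm z0)\<^sup>2 + integral {0..T} (\<lambda>s. (r s)\<^sup>2))"
    if "t \<in> {0..T}" for t
    by (rule est(1)) (use that in simp_all)
  show "(LINT s|lebesgue_on {0..T}. (norm (vpath u s))\<^sup>2) \<le> parabolic_const T c L * ((norm z0)\<^sup>2 + integral {0..T} (\<lambda>s. (r s)\<^sup>2))"
    by (rule est(2)) simp_all
qed

lemma to_dual_apply [simp]: "blinfun_apply (to_dual j h) v = h \<bullet> j v"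
  unfolding to_dual_def
  by (rule fun_cong[OF bounded_linear_Blinfun_apply]) (rule bounded_linear_compose[OF bounded_linear_inner_right j])

text \<open>The bound \<open>b\<close> makes the tested integral a bounded functional of \<open>v\<close>, which gives \<open>Blinfun\<close> its meaning.\<close>

lemma dual_integral_apply:
  fixes \<phi> :: "real \<Rightarrow> ('v \<Rightarrow>\<^sub>L real)"
  assumes i: "\<And>v. integrable (lebesgue_on {0..t}) (\<lambda>s. \<phi> s v)"
    and b: "integrable (lebesgue_on {0..t}) b" "\<And>s. s \<in> {0..t} \<Longrightarrow> norm (\<phi> s) \<le> b s"
  shows "blinfun_apply (dual_integral t \<phi>) v = (LINT s|lebesgue_on {0..t}. \<phi> s v)"
  unfolding dual_integral_def
proof (rule fun_cong[OF bounded_linear_Blinfun_apply], rule bounded_linear_intro)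
  show "(LINT s|lebesgue_on {0..t}. \<phi> s (v + w)) = (LINT s|lebesgue_on {0..t}. \<phi> s v) + (LINT s|lebesgue_on {0..t}. \<phi> s w)" for v w
    using i by (simp add: blinfun.add_right)
  show "(LINT s|lebesgue_on {0..t}. \<phi> s (a *\<^sub>R v)) = a *\<^sub>R (LINT s|lebesgue_on {0..t}. \<phi> s v)" for a v
    by (simp add: blinfun.scaleR_right)
  fix v
  have "norm (LINT s|lebesgue_on {0..t}. \<phi> s v) \<le> (LINT s|lebesgue_on {0..t}. norm v * b s)"
  proof (rule Bochner_Integration.integral_norm_bound_integral[OF i])
    show "integrable (lebesgue_on {0..t}) (\<lambda>s. norm v * b s)" using b(1) by simp
    fix s assume "s \<in> space (lebesgue_on {0..t})"
    then have "norm (\<phi> s v) \<le> b s * norm v"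
      using b(2)[of s] by (intro order_trans[OF norm_blinfun] mult_right_mono) auto
    then show "norm (\<phi> s v) \<le> norm v * b s" by (simp add: mult.commute)
  qed
  then show "norm (LINT s|lebesgue_on {0..t}. \<phi> s v) \<le> norm v * (LINT s|lebesgue_on {0..t}. b s)" by simp
qed

lemma evolution_equation_iff:
  assumes f: "\<And>v. integrable (lebesgue_on {0..T}) (\<lambda>s. f s \<bullet> j v)" "\<And>s. s \<in> {0..T} \<Longrightarrow> norm (f s) \<le> B"
    and t: "t \<in> {0..T}"
  shows "to_dual j (evE u t) + dual_integral t (\<lambda>s. blinfun_apply A (inv j (evE u s)))
        = to_dual j x + dual_integral t (\<lambda>s. to_dual j (f s)) + to_dual j y \<longleftrightarrow>
     (\<forall>v. evE u t \<bullet> j v + (LINT s|lebesgue_on {0..t}. A (vpath u s) v)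
        = x \<bullet> j v + (LINT s|lebesgue_on {0..t}. f s \<bullet> j v) + y \<bullet> j v)"
proof -
  have 1: "blinfun_apply (dual_integral t (\<lambda>s. blinfun_apply A (inv j (evE u s)))) v = (LINT s|lebesgue_on {0..t}. A (vpath u s) v)" for v
    unfolding vpath_def[symmetric]
  proof (rule dual_integral_apply[OF integrable_on_initial[OF integrable_A t]])
    show "integrable (lebesgue_on {0..t}) (\<lambda>s. norm A * norm (vpath u s))"
      using integrable_on_initial[OF vpath_integrable t] by simp
  qed (rule norm_blinfun)
  obtain C where C: "C \<ge> 0" "\<And>v. norm (j v) \<le> norm v * C"
    using bounded_linear.nonneg_bounded[OF j] by auto
  have B: "B \<ge> 0" using order_trans[OF norm_ge_zero f(2)[of 0]] T by simp
  have 2: "blinfun_apply (dual_integral t (\<lambda>s. to_dual j (f s))) v = (LINT s|lebesgue_on {0..t}. f s \<bullet> j v)" for v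
  proof -
    have "blinfun_apply (dual_integral t (\<lambda>s. to_dual j (f s))) v = (LINT s|lebesgue_on {0..t}. to_dual j (f s) v)"
    proof (rule dual_integral_apply)
      show "integrable (lebesgue_on {0..t}) (\<lambda>s. to_dual j (f s) v)" for v
        using integrable_on_initial[OF f(1) t] by simp
      show "integrable (lebesgue_on {0..t}) (\<lambda>s. B * C)"
        by (rule integrable_on_initial[OF integrable_const_on t])
      fix s assume "s \<in> {0..t}"
      then have s: "s \<in> {0..T}" using t by auto
      show "norm (to_dual j (f s)) \<le> B * C"
      proof (rule norm_blinfun_bound)
        fix v
        have "norm (f s \<bullet> j v) \<le> norm (f s) * norm (j v)" by (simp add: Cauchy_Schwarz_ineq2)
        also have "\<dots> \<le> B * (norm v * C)" using f(2)[OF s] C B by (intro mult_mono) auto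
        finally show "norm (to_dual j (f s) v) \<le> B * C * norm v" by (simp add: ac_simps)
      qed (use B C in simp)
    qed
    then show ?thesis by simp
  qed
  have "a = b \<longleftrightarrow> (\<forall>v. blinfun_apply a v = blinfun_apply b v)" for a b :: "'v \<Rightarrow>\<^sub>L real"
    by (auto intro: blinfun_eqI)
  then show ?thesis by (simp add: blinfun.add_left 1 2)
qed

end

section \<open>The semilinear equation along one noise path\<close>

locale semilinear_flow = linear_evolution T j A evE c + nemytskii_C2 M rep g g' L K
  for T :: real
    and j :: "'v::{real_inner, banach, second_countable_topology} \<Rightarrow> 'h::{real_inner, banach, second_countable_topology}"
    and A :: "'v \<Rightarrow>\<^sub>L ('v \<Rightarrow>\<^sub>L real)"
    and evE :: "'e::real_normed_vector \<Rightarrow> real \<Rightarrow> 'h"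
    and c :: real
    and M :: "'x measure" and rep :: "'h \<Rightarrow> 'x \<Rightarrow> real"
    and g g' :: "real \<Rightarrow> real" and L K :: real
begin

text \<open>The solutions for one \<open>\<omega>\<close>; \<open>y\<close> is the path of the noise, which enters additively.\<close>

definition flow_solution :: "(real \<Rightarrow> 'h) \<Rightarrow> 'h \<Rightarrow> 'e \<Rightarrow> bool" where
  "flow_solution y x u \<longleftrightarrow> (\<forall>t\<in>{0..T}. \<forall>v. evE u t \<bullet> j v + (LINT s|lebesgue_on {0..t}. A (vpath u s) v)
     = x \<bullet> j v + (LINT s|lebesgue_on {0..t}. N (evE u s) \<bullet> j v) + y t \<bullet> j v)"

lemma N_path: "continuous_on {0..T} (\<lambda>s. N (evE u s))"
proof (rule continuous_on_compose2[of UNIV N])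
  show "continuous_on UNIV N"
    by (rule lipschitz_on_continuous_on[of L]) (auto simp: lipschitz_on_def dist_norm N_lipschitz L_nonneg)
qed (simp_all add: ev_continuous)

lemma N_path_integrable: "integrable (lebesgue_on {0..T}) (\<lambda>s. N (evE u s) \<bullet> j v)"
  by (intro continuous_imp_integrable_real continuous_on_inner N_path continuous_on_const)

text \<open>The noise cancels in the difference of two solutions, which is what makes a pathwise analysis possible.\<close>

lemma flow_solution_diff:
  assumes u: "flow_solution y x u" and w: "flow_solution y x' w"
  shows "weak_solution (x' - x) (\<lambda>s. N (evE w s) - N (evE u s)) (w - u)"
  unfolding weak_solution_def
proof (intro conjI ballI allI)
  show "integrable (lebesgue_on {0..T}) (\<lambda>s. (N (evE w s) - N (evE u s)) \<bullet> j v)" for v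
    using N_path_integrable by (simp add: inner_diff_left)
  fix t v assume t: "t \<in> {0..T}"
  have "(LINT s|lebesgue_on {0..t}. (N (evE w s) - N (evE u s)) \<bullet> j v)
      = (LINT s|lebesgue_on {0..t}. N (evE w s) \<bullet> j v) - (LINT s|lebesgue_on {0..t}. N (evE u s) \<bullet> j v)"
    using integrable_on_initial[OF N_path_integrable t] by (simp add: inner_diff_left)
  moreover have
    "evE u t \<bullet> j v + (LINT s|lebesgue_on {0..t}. A (vpath u s) v) = x \<bullet> j v + (LINT s|lebesgue_on {0..t}. N (evE u s) \<bullet> j v) + y t \<bullet> j v"
    "evE w t \<bullet> j v + (LINT s|lebesgue_on {0..t}. A (vpath w s) v) = x' \<bullet> j v + (LINT s|lebesgue_on {0..t}. N (evE w s) \<bullet> j v) + y t \<bullet> j v"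
    using u w t by (simp_all add: flow_solution_def)
  ultimately show "evE (w - u) t \<bullet> j v + (LINT s|lebesgue_on {0..t}. A (vpath (w - u) s) v)
      = (x' - x) \<bullet> j v + (LINT s|lebesgue_on {0..t}. (N (evE w s) - N (evE u s)) \<bullet> j v)"
    by (simp add: integral_A_diff[OF t] ev_diff[OF t] inner_diff_left)
qed

definition flow_const :: real where "flow_const = 2 * sqrt (parabolic_const T c L)"

lemma parabolic_const_pos: "parabolic_const T c L > 0"
  unfolding parabolic_const_def using T c(1) L_nonneg by (intro add_pos_nonneg divide_nonneg_nonneg) auto

lemma flow_const_nonneg: "flow_const \<ge> 0"
  using parabolic_const_pos by (simp add: flow_const_def)

lemma flow_solution_lipschitz:
  assumes u: "flow_solution y x u" and w: "flow_solution y x' w"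
  shows "norm (w - u) \<le> flow_const * norm (x' - x)"
proof -
  have "norm (w - u) \<le> 2 * sqrt (parabolic_const T c L * ((norm (x' - x))\<^sup>2 + integral {0..T} (\<lambda>s. 0\<^sup>2)))"
  proof (rule weak_solution_estimate[OF flow_solution_diff[OF u w]])
    fix s assume "s \<in> {0..T}"
    then show "norm (N (evE w s) - N (evE u s)) \<le> L * norm (evE (w - u) s) + 0"
      using N_lipschitz[of "evE w s" "evE u s"] by (simp add: ev_diff)
  qed (simp_all add: L_nonneg)
  then show ?thesis by (simp add: flow_const_def real_sqrt_mult)
qed

text \<open>The quotient \<open>d\<close> solves an equation whose forcing is \<open>N_quot (evE u s) \<epsilon> (evE d s)\<close>, which has linear growth
  in \<open>d\<close> and differs from \<open>N_deriv (evE u s) (evE d s)\<close> by the remainder estimated above.\<close>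

lemma difference_quotient_solution:
  assumes u: "flow_solution y x u" and w: "flow_solution y (x + \<epsilon> *\<^sub>R h) w" and \<epsilon>: "\<epsilon> > 0"
  defines "d \<equiv> (w - u) /\<^sub>R \<epsilon>"
  shows "weak_solution h (\<lambda>s. N_quot (evE u s) \<epsilon> (evE d s)) d" and "norm d \<le> flow_const * norm h"
proof -
  have "weak_solution (x + \<epsilon> *\<^sub>R h - x) (\<lambda>s. N (evE w s) - N (evE u s)) (w - u)"
    by (rule flow_solution_diff[OF u w])
  from weak_solution_scale[OF this, of "inverse \<epsilon>"]
  have "weak_solution h (\<lambda>s. (N (evE w s) - N (evE u s)) /\<^sub>R \<epsilon>) d"
    using \<epsilon> by (simp add: d_def)
  also have "?this \<longleftrightarrow> weak_solution h (\<lambda>s. N_quot (evE u s) \<epsilon> (evE d s)) d"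
    by (rule weak_solution_cong) (use \<epsilon> in \<open>simp add: N_quot_def d_def ev_scale ev_diff\<close>)
  finally show "weak_solution h (\<lambda>s. N_quot (evE u s) \<epsilon> (evE d s)) d" .
  have "norm d = inverse \<epsilon> * norm (w - u)" using \<epsilon> by (simp add: d_def)
  also have "\<dots> \<le> inverse \<epsilon> * (flow_const * norm (x + \<epsilon> *\<^sub>R h - x))"
    using flow_solution_lipschitz[OF u w] \<epsilon> by (intro mult_left_mono) auto
  also have "\<dots> = flow_const * norm h" using \<epsilon> by simp
  finally show "norm d \<le> flow_const * norm h" .
qed

lemma tail_path: "continuous_on {0..T} (\<lambda>s. norm (tail (real k) (evE u s)))"
proof (rule continuous_on_compose2[of UNIV "\<lambda>x. norm (tail (real k) x)"])
  have "continuous_on UNIV (tail (real k))"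
    by (rule lipschitz_on_continuous_on[of 1]) (auto simp: lipschitz_on_def dist_norm tail_lipschitz)
  then show "continuous_on UNIV (\<lambda>x. norm (tail (real k) x))" by (intro continuous_intros)
qed (simp_all add: ev_continuous)

text \<open>Uniform integrability of the squares of paths that are bounded in \<open>E\<close>.\<close>

lemma tail_path_integral_le:
  assumes k: "\<And>v. norm (j v) \<le> C \<Longrightarrow> (norm (tail (real k) (j v)))\<^sup>2 \<le> \<eta> * (1 + (norm v)\<^sup>2)"
    and u: "norm u \<le> C" and \<eta>: "\<eta> > 0"
  shows "integral {0..T} (\<lambda>s. (norm (tail (real k) (evE u s)))\<^sup>2) \<le> \<eta> * (T + C\<^sup>2)"
proof -
  have i: "integrable (lebesgue_on {0..T}) (\<lambda>s. (norm (tail (real k) (evE u s)))\<^sup>2)"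
    by (intro continuous_imp_integrable_real continuous_on_power tail_path)
  have "integral {0..T} (\<lambda>s. (norm (tail (real k) (evE u s)))\<^sup>2) = (LINT s|lebesgue_on {0..T}. (norm (tail (real k) (evE u s)))\<^sup>2)"
    by (rule lebesgue_integral_eq_integral[OF i, symmetric]) simp
  also have "\<dots> \<le> (LINT s|lebesgue_on {0..T}. \<eta> * (1 + (norm (vpath u s))\<^sup>2))"
  proof (rule integral_mono_AE[OF i])
    show "integrable (lebesgue_on {0..T}) (\<lambda>s. \<eta> * (1 + (norm (vpath u s))\<^sup>2))"
      using vpath_sq integrable_const_on by (intro integrable_mult_right Bochner_Integration.integrable_add) auto
    show "AE s in lebesgue_on {0..T}. (norm (tail (real k) (evE u s)))\<^sup>2 \<le> \<eta> * (1 + (norm (vpath u s))\<^sup>2)"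
      using vpath_ae[of u] AE_space[of "lebesgue_on {0..T}"]
    proof eventually_elim
      case (elim s)
      then have "norm (evE u s) \<le> C" using ev_norm_le[of s u] u by simp
      then show ?case using k[of "vpath u s"] elim(1) by simp
    qed
  qed
  also have "\<dots> = \<eta> * (T + (LINT s|lebesgue_on {0..T}. (norm (vpath u s))\<^sup>2))"
    using T by (simp add: vpath_sq integrable_const_on measure_restrict_space)
  also have "\<dots> \<le> \<eta> * (T + C\<^sup>2)"
    using vpath_norm_le[of u] power_mono[OF u norm_ge_zero, of 2] \<eta> by (intro mult_left_mono add_left_mono) auto
  finally show ?thesis .
qed

text \<open>The difference of two quotients \<open>d\<close> and \<open>d'\<close> at the same base point has initial value \<open>0\<close>, and its
  forcing is \<open>N_deriv (evE u s) (evE (d - d') s)\<close> up to two remainders. The first part is absorbed by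
  Gronwall's inequality. The remainders are small in \<open>L\<^sup>2(0,T; H)\<close>, since quotients in directions of the unit ball are
  bounded in \<open>E\<close> by \<open>flow_const\<close> and thus have uniformly small tails. The threshold \<open>\<epsilon>0\<close> depends neither on
  \<open>x\<close> nor on the noise path \<open>y\<close>.\<close>

lemma quotients_uniformly_Cauchy:
  assumes \<eta>: "\<eta> > 0"
  shows "\<exists>\<epsilon>0>0. \<forall>y x h u \<epsilon> w \<epsilon>' w'. norm h \<le> 1 \<longrightarrow> 0 < \<epsilon> \<longrightarrow> \<epsilon> < \<epsilon>0 \<longrightarrow> 0 < \<epsilon>' \<longrightarrow> \<epsilon>' < \<epsilon>0 \<longrightarrow>
    flow_solution y x u \<longrightarrow> flow_solution y (x + \<epsilon> *\<^sub>R h) w \<longrightarrow> flow_solution y (x + \<epsilon>' *\<^sub>R h) w' \<longrightarrow>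
    norm ((w - u) /\<^sub>R \<epsilon> - (w' - u) /\<^sub>R \<epsilon>') \<le> \<eta>"
proof -
  define C where "C = flow_const"
  \<comment> \<open>\<open>\<kappa>\<close> is the square integral of the remainders that is allowed for. One half of it is spent on the tails,
      which fixes the level \<open>k\<close>, and then the other half on the quadratic part, which fixes \<open>\<epsilon>0\<close>.\<close>
  define \<kappa> where "\<kappa> = (\<eta> / 2)\<^sup>2 / parabolic_const T c L"
  have \<kappa>: "\<kappa> > 0" using \<eta> parabolic_const_pos by (simp add: \<kappa>_def)
  define S where "S = 128 * L\<^sup>2 * (T + C\<^sup>2) + 1"
  have S: "S > 0" unfolding S_def using T by (intro add_nonneg_pos mult_nonneg_nonneg) auto
  define \<eta>1 where "\<eta>1 = \<kappa> / 2 / S"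
  have \<eta>1: "\<eta>1 > 0" using \<kappa> S by (simp add: \<eta>1_def)
  obtain k :: nat where k: "\<And>v. norm (j v) \<le> C \<Longrightarrow> (norm (tail (real k) (j v)))\<^sup>2 \<le> \<eta>1 * (1 + (norm v)\<^sup>2)"
    using tail_embedding_small[of j \<eta>1 C, OF j_compact \<eta>1] by blast
  define \<alpha> where "\<alpha> = sqrt (\<kappa> / (4 * T))"
  have \<alpha>: "\<alpha> > 0" using \<kappa> T by (simp add: \<alpha>_def)
  define b where "b = 2 * real k * K * C"
  have b: "b \<ge> 0" using K_nonneg flow_const_nonneg by (simp add: b_def C_def)
  define \<epsilon>0 where "\<epsilon>0 = \<alpha> / (2 * b + 1)"
  have \<epsilon>0: "\<epsilon>0 > 0" using \<alpha> b by (simp add: \<epsilon>0_def)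
  have main: "norm ((w - u) /\<^sub>R \<epsilon> - (w' - u) /\<^sub>R \<epsilon>') \<le> \<eta>"
    if h: "norm h \<le> 1" and \<epsilon>: "0 < \<epsilon>" "\<epsilon> < \<epsilon>0" and \<epsilon>': "0 < \<epsilon>'" "\<epsilon>' < \<epsilon>0"
      and u: "flow_solution y x u" and w: "flow_solution y (x + \<epsilon> *\<^sub>R h) w" and w': "flow_solution y (x + \<epsilon>' *\<^sub>R h) w'"
    for y x h u \<epsilon> w \<epsilon>' w'
  proof -
    define d d' where "d = (w - u) /\<^sub>R \<epsilon>" and "d' = (w' - u) /\<^sub>R \<epsilon>'"
    note dq = difference_quotient_solution[OF u w \<epsilon>(1), folded d_def]
    note dq' = difference_quotient_solution[OF u w' \<epsilon>'(1), folded d'_def]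
    have "C * norm h \<le> C" using h flow_const_nonneg by (simp add: C_def mult_left_le)
    then have dC: "norm d \<le> C" "norm d' \<le> C" using dq(2) dq'(2) by (auto simp: C_def)
    define \<tau> where "\<tau> e s = norm (tail (real k) (evE e s))" for e s
    define a where "a = b * (\<epsilon> + \<epsilon>')"
    define r where "r s = a + 4 * L * (\<tau> d s + \<tau> d' s)" for s
    have \<tau>: "continuous_on {0..T} (\<tau> e)" for e unfolding \<tau>_def by (rule tail_path)
    have r: "continuous_on {0..T} r" unfolding r_def by (intro continuous_intros \<tau>)
    have sol: "weak_solution 0 (\<lambda>s. N_quot (evE u s) \<epsilon> (evE d s) - N_quot (evE u s) \<epsilon>' (evE d' s)) (d - d')"
      using weak_solution_diff[OF dq(1) dq'(1)] by simp
    have bound: "norm (N_quot (evE u s) \<epsilon> (evE d s) - N_quot (evE u s) \<epsilon>' (evE d' s)) \<le> L * norm (evE (d - d') s) + r s"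
      if s: "s \<in> {0..T}" for s
    proof -
      have rem: "norm (N_quot (evE u s) \<epsilon> (evE e s) - N_deriv (evE u s) (evE e s)) \<le> b * \<epsilon> + 4 * L * \<tau> e s"
        if "norm e \<le> C" "\<epsilon> > 0" for e \<epsilon>
      proof -
        have "2 * real k * K * \<epsilon> * norm (evE e s) \<le> 2 * real k * K * \<epsilon> * C"
          using ev_norm_le[OF s, of e] that K_nonneg by (intro mult_left_mono) auto
        then show ?thesis
          using norm_N_quot_diff_le[OF \<open>\<epsilon> > 0\<close>, of "real k" "evE u s" "evE e s"] by (simp add: b_def \<tau>_def algebra_simps)
      qed
      have split: "N_quot (evE u s) \<epsilon> (evE d s) - N_quot (evE u s) \<epsilon>' (evE d' s)
          = N_deriv (evE u s) (evE (d - d') s) + (N_quot (evE u s) \<epsilon> (evE d s) - N_deriv (evE u s) (evE d s))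
            - (N_quot (evE u s) \<epsilon>' (evE d' s) - N_deriv (evE u s) (evE d' s))"
        by (simp add: ev_diff[OF s] N_deriv_diff)
      have "norm (N_quot (evE u s) \<epsilon> (evE d s) - N_quot (evE u s) \<epsilon>' (evE d' s)) \<le> norm (N_deriv (evE u s) (evE (d - d') s))
          + norm (N_quot (evE u s) \<epsilon> (evE d s) - N_deriv (evE u s) (evE d s))
          + norm (N_quot (evE u s) \<epsilon>' (evE d' s) - N_deriv (evE u s) (evE d' s))"
        by (subst split) (intro order_trans[OF norm_triangle_ineq4] add_mono norm_triangle_ineq order_refl)
      also have "\<dots> \<le> L * norm (evE (d - d') s) + (b * \<epsilon> + 4 * L * \<tau> d s) + (b * \<epsilon>' + 4 * L * \<tau> d' s)"
        by (intro add_mono norm_N_deriv rem dC \<epsilon> \<epsilon>')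
      finally show ?thesis by (simp add: r_def a_def algebra_simps)
    qed
    have a: "2 * T * a\<^sup>2 \<le> \<kappa> / 2"
    proof -
      have "a \<le> b * (2 * \<epsilon>0)" unfolding a_def using \<epsilon> \<epsilon>' b by (intro mult_left_mono) auto
      also have "\<dots> \<le> \<alpha>" using \<alpha> b by (simp add: \<epsilon>0_def field_simps)
      finally have "a\<^sup>2 \<le> \<alpha>\<^sup>2" using b \<epsilon> \<epsilon>' by (intro power_mono) (auto simp: a_def)
      also have "\<alpha>\<^sup>2 = \<kappa> / (4 * T)" using \<kappa> T by (simp add: \<alpha>_def)
      finally show ?thesis using T by (simp add: field_simps)
    qed
    have \<tau>i: "(\<lambda>s. (\<tau> e s)\<^sup>2) integrable_on {0..T}" for e
      by (intro integrable_continuous_real continuous_on_power \<tau>)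
    have "integral {0..T} (\<lambda>s. (r s)\<^sup>2) \<le> integral {0..T} (\<lambda>s. 2 * a\<^sup>2 + 64 * L\<^sup>2 * ((\<tau> d s)\<^sup>2 + (\<tau> d' s)\<^sup>2))"
    proof (rule integral_le)
      show "(\<lambda>s. (r s)\<^sup>2) integrable_on {0..T}"
        "(\<lambda>s. 2 * a\<^sup>2 + 64 * L\<^sup>2 * ((\<tau> d s)\<^sup>2 + (\<tau> d' s)\<^sup>2)) integrable_on {0..T}"
        by (intro integrable_continuous_real continuous_intros r \<tau>)+
      have sq: "(p + q)\<^sup>2 \<le> 2 * p\<^sup>2 + 2 * q\<^sup>2" for p q :: real
        using sum_squares_bound[of p q] by (simp add: power2_sum)
      fix s
      have "(r s)\<^sup>2 \<le> 2 * a\<^sup>2 + 2 * (4 * L * (\<tau> d s + \<tau> d' s))\<^sup>2" unfolding r_def by (rule sq)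
      also have "\<dots> = 2 * a\<^sup>2 + 32 * L\<^sup>2 * (\<tau> d s + \<tau> d' s)\<^sup>2" by (simp add: power_mult_distrib)
      also have "\<dots> \<le> 2 * a\<^sup>2 + 32 * L\<^sup>2 * (2 * (\<tau> d s)\<^sup>2 + 2 * (\<tau> d' s)\<^sup>2)"
        by (intro add_left_mono mult_left_mono sq) simp
      finally show "(r s)\<^sup>2 \<le> 2 * a\<^sup>2 + 64 * L\<^sup>2 * ((\<tau> d s)\<^sup>2 + (\<tau> d' s)\<^sup>2)" by (simp add: algebra_simps)
    qed
    also have "\<dots> = 2 * T * a\<^sup>2 + 64 * L\<^sup>2 * (integral {0..T} (\<lambda>s. (\<tau> d s)\<^sup>2) + integral {0..T} (\<lambda>s. (\<tau> d' s)\<^sup>2))"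
    proof -
      have s: "(\<lambda>s. (\<tau> d s)\<^sup>2 + (\<tau> d' s)\<^sup>2) integrable_on {0..T}"
        by (intro Henstock_Kurzweil_Integration.integrable_add \<tau>i)
      have "integral {0..T} (\<lambda>s. 2 * a\<^sup>2 + 64 * L\<^sup>2 * ((\<tau> d s)\<^sup>2 + (\<tau> d' s)\<^sup>2))
          = integral {0..T} (\<lambda>s. 2 * a\<^sup>2) + integral {0..T} (\<lambda>s. 64 * L\<^sup>2 * ((\<tau> d s)\<^sup>2 + (\<tau> d' s)\<^sup>2))"
        by (rule Henstock_Kurzweil_Integration.integral_add[OF _ integrable_on_mult_right[OF s]]) auto
      also have "integral {0..T} (\<lambda>s. 64 * L\<^sup>2 * ((\<tau> d s)\<^sup>2 + (\<tau> d' s)\<^sup>2))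
          = 64 * L\<^sup>2 * integral {0..T} (\<lambda>s. (\<tau> d s)\<^sup>2 + (\<tau> d' s)\<^sup>2)"
        by (rule integral_mult_right)
      also have "integral {0..T} (\<lambda>s. (\<tau> d s)\<^sup>2 + (\<tau> d' s)\<^sup>2)
          = integral {0..T} (\<lambda>s. (\<tau> d s)\<^sup>2) + integral {0..T} (\<lambda>s. (\<tau> d' s)\<^sup>2)"
        by (rule Henstock_Kurzweil_Integration.integral_add[OF \<tau>i \<tau>i])
      finally show ?thesis using T by simp
    qed
    also have "\<dots> \<le> 2 * T * a\<^sup>2 + 64 * L\<^sup>2 * (\<eta>1 * (T + C\<^sup>2) + \<eta>1 * (T + C\<^sup>2))"
      unfolding \<tau>_def by (intro add_left_mono mult_left_mono add_mono tail_path_integral_le k dC \<eta>1) simp_all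
    also have "\<dots> = 2 * T * a\<^sup>2 + \<eta>1 * (S - 1)" by (simp add: S_def algebra_simps)
    also have "\<dots> \<le> \<kappa> / 2 + \<eta>1 * S" using a \<eta>1 by (intro add_mono mult_left_mono) auto
    also have "\<eta>1 * S = \<kappa> / 2" using S by (simp add: \<eta>1_def)
    finally have I: "integral {0..T} (\<lambda>s. (r s)\<^sup>2) \<le> \<kappa>" by simp
    have "norm (d - d') \<le> 2 * sqrt (parabolic_const T c L * ((norm (0 :: 'h))\<^sup>2 + integral {0..T} (\<lambda>s. (r s)\<^sup>2)))"
      by (rule weak_solution_estimate[OF sol r bound L_nonneg])
    also have "\<dots> \<le> 2 * sqrt (parabolic_const T c L * \<kappa>)"
      using I parabolic_const_pos by simp
    also have "\<dots> = \<eta>" using parabolic_const_pos \<eta> by (simp add: \<kappa>_def)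
    finally show ?thesis by (simp add: d_def d'_def)
  qed
  show ?thesis by (intro exI[of _ \<epsilon>0] conjI \<epsilon>0 allI impI main)
qed

text \<open>Cauchy--Schwarz in time, by \<open>norm v \<le> m + (norm v)\<^sup>2 / m\<close> with \<open>m = norm u\<close>.\<close>

lemma integral_A_bound:
  assumes t: "t \<in> {0..T}"
  shows "norm (LINT s|lebesgue_on {0..t}. A (vpath u s) v) \<le> norm A * norm v * ((1 + T) * norm u)"
proof (cases "norm u = 0")
  case True
  then have "integral\<^sup>L (lebesgue_on {0..T}) (\<lambda>s. (norm (vpath u s))\<^sup>2) = 0"
    using vpath_norm_le[of u] by (simp add: antisym)
  then have "AE s in lebesgue_on {0..T}. (norm (vpath u s))\<^sup>2 = 0"
    using integral_nonneg_eq_0_iff_AE[OF vpath_sq] by simp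
  from AE_on_initial[OF this t] have "(LINT s|lebesgue_on {0..t}. A (vpath u s) v) = (LINT s|lebesgue_on {0..t}. 0)"
    using integrable_on_initial[OF integrable_A t, of u v]
    by (intro integral_cong_AE) (auto elim!: eventually_mono simp: blinfun.zero_left blinfun.zero_right)
  then show ?thesis using T by simp
next
  case False
  define m where "m = norm u"
  have m: "m > 0" using False by (simp add: m_def)
  have "norm (LINT s|lebesgue_on {0..t}. A (vpath u s) v) \<le> (LINT s|lebesgue_on {0..t}. norm (A (vpath u s) v))"
    by (rule integral_norm_bound)
  also have "\<dots> \<le> (LINT s|lebesgue_on {0..T}. norm (A (vpath u s) v))"
    using integral_subset_le[of "{0..t}" "{0..T}" "\<lambda>s. norm (A (vpath u s) v)"] t
      integrable_norm[OF integrable_A[of u v]] integrable_norm[OF integrable_on_initial[OF integrable_A t, of u v]]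
    by (simp add: lebesgue_integral_eq_integral integrable_on_lebesgue_on)
  also have "\<dots> \<le> (LINT s|lebesgue_on {0..T}. norm A * norm v * (m + (norm (vpath u s))\<^sup>2 / m))"
  proof (rule integral_mono[OF integrable_norm[OF integrable_A]])
    show "integrable (lebesgue_on {0..T}) (\<lambda>s. norm A * norm v * (m + (norm (vpath u s))\<^sup>2 / m))"
      by (intro integrable_mult_right Bochner_Integration.integrable_add integrable_const_on
          integrable_divide_zero vpath_sq)
    fix s
    have "norm (vpath u s) \<le> m + (norm (vpath u s))\<^sup>2 / m"
    proof (cases "norm (vpath u s) \<le> m")
      case False
      then have "norm (vpath u s) * m \<le> norm (vpath u s) * norm (vpath u s)" by (intro mult_left_mono) auto
      then have "norm (vpath u s) \<le> (norm (vpath u s))\<^sup>2 / m" using m by (simp add: le_divide_eq power2_eq_square)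
      then show ?thesis using m by linarith
    qed (use m in \<open>simp add: add_increasing2\<close>)
    moreover have "norm (A (vpath u s) v) \<le> norm A * norm (vpath u s) * norm v"
      by (intro order_trans[OF norm_blinfun] mult_right_mono norm_blinfun norm_ge_zero)
    ultimately show "norm (A (vpath u s) v) \<le> norm A * norm v * (m + (norm (vpath u s))\<^sup>2 / m)"
      by (smt (verit) mult.assoc mult.commute mult_left_mono norm_ge_zero mult_nonneg_nonneg)
  qed
  also have "\<dots> = norm A * norm v * (T * m + (LINT s|lebesgue_on {0..T}. (norm (vpath u s))\<^sup>2) / m)"
    using T by (simp add: vpath_sq integrable_const_on measure_restrict_space)
  also have "\<dots> \<le> norm A * norm v * (T * m + m\<^sup>2 / m)"
    using vpath_norm_le[of u] m by (intro mult_left_mono add_left_mono divide_right_mono) (auto simp: m_def)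
  also have "\<dots> = norm A * norm v * ((1 + T) * norm u)"
    using m by (simp add: m_def power2_eq_square algebra_simps)
  finally show ?thesis .
qed

text \<open>For fixed \<open>s\<close> the forcings converge in \<open>H\<close>, as only the Gateaux derivative is involved there, and they
  are bounded uniformly in \<open>s\<close>. Dominated convergence then gives the limit equation, and the
  measurability of its forcing as well.\<close>

lemma linearized_limit:
  assumes d: "\<And>n. weak_solution h (\<lambda>s. N_quot (evE u s) (\<epsilon> n) (evE (d n) s)) (d n)"
    and \<epsilon>: "\<And>n. \<epsilon> n > 0" "\<epsilon> \<longlonglongrightarrow> 0" and lim: "d \<longlonglongrightarrow> Y"
  shows "weak_solution h (\<lambda>s. N_deriv (evE u s) (evE Y s)) Y"
proof -
  note ev = ev_tendsto[OF lim]
  have F: "(\<lambda>n. N_quot (evE u s) (\<epsilon> n) (evE (d n) s)) \<longlonglongrightarrow> N_deriv (evE u s) (evE Y s)" if "s \<in> {0..T}" for s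
    by (rule N_quot_tendsto[OF \<epsilon> ev[OF that]])
  obtain B where B: "\<And>n. norm (d n) \<le> B"
    using convergent_imp_Bseq[OF convergentI[OF lim]] by (auto simp: Bseq_def)
  have bound: "norm (N_quot (evE u s) (\<epsilon> n) (evE (d n) s) \<bullet> j v) \<le> L * B * norm (j v)" if s: "s \<in> {0..T}" for s n v
  proof -
    have "norm (N_quot (evE u s) (\<epsilon> n) (evE (d n) s) \<bullet> j v) \<le> norm (N_quot (evE u s) (\<epsilon> n) (evE (d n) s)) * norm (j v)"
      by (simp add: Cauchy_Schwarz_ineq2)
    also have "\<dots> \<le> L * B * norm (j v)"
    proof (rule mult_right_mono)
      have "L * norm (evE (d n) s) \<le> L * B"
        using ev_norm_le[OF s, of "d n"] B[of n] L_nonneg by (intro mult_left_mono) auto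
      then show "norm (N_quot (evE u s) (\<epsilon> n) (evE (d n) s)) \<le> L * B"
        using norm_N_quot[OF \<epsilon>(1), of "evE u s" n "evE (d n) s"] by linarith
    qed simp
    finally show ?thesis .
  qed
  have di: "integrable (lebesgue_on {0..T}) (\<lambda>s. N_quot (evE u s) (\<epsilon> n) (evE (d n) s) \<bullet> j v)" for n v
    using d by (simp add: weak_solution_def)
  have Pm: "(\<lambda>s. N_deriv (evE u s) (evE Y s) \<bullet> j v) \<in> borel_measurable (lebesgue_on {0..t})" if t: "t \<in> {0..T}" for t v
  proof (rule borel_measurable_LIMSEQ_metric)
    show "(\<lambda>s. N_quot (evE u s) (\<epsilon> n) (evE (d n) s) \<bullet> j v) \<in> borel_measurable (lebesgue_on {0..t})" for n
      using integrable_on_initial[OF di t] by (rule borel_measurable_integrable)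
    show "(\<lambda>n. N_quot (evE u s) (\<epsilon> n) (evE (d n) s) \<bullet> j v) \<longlonglongrightarrow> N_deriv (evE u s) (evE Y s) \<bullet> j v"
      if "s \<in> space (lebesgue_on {0..t})" for s
      using that t by (intro tendsto_inner F tendsto_const) auto
  qed
  have conv: "integrable (lebesgue_on {0..t}) (\<lambda>s. N_deriv (evE u s) (evE Y s) \<bullet> j v)"
    "(\<lambda>n. LINT s|lebesgue_on {0..t}. N_quot (evE u s) (\<epsilon> n) (evE (d n) s) \<bullet> j v)
      \<longlonglongrightarrow> (LINT s|lebesgue_on {0..t}. N_deriv (evE u s) (evE Y s) \<bullet> j v)" if t: "t \<in> {0..T}" for t v
  proof -
    have A: "AE s in lebesgue_on {0..t}. (\<lambda>n. N_quot (evE u s) (\<epsilon> n) (evE (d n) s) \<bullet> j v) \<longlonglongrightarrow> N_deriv (evE u s) (evE Y s) \<bullet> j v"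
      using t by (intro AE_I2 tendsto_inner F tendsto_const) auto
    have Bd: "AE s in lebesgue_on {0..t}. norm (N_quot (evE u s) (\<epsilon> n) (evE (d n) s) \<bullet> j v) \<le> L * B * norm (j v)" for n
      using t by (intro AE_I2 bound) auto
    note * = Pm[OF t] borel_measurable_integrable[OF integrable_on_initial[OF di t]]
      integrable_on_initial[OF integrable_const_on t] A Bd
    show "integrable (lebesgue_on {0..t}) (\<lambda>s. N_deriv (evE u s) (evE Y s) \<bullet> j v)"
      by (rule integrable_dominated_convergence[OF *])
    show "(\<lambda>n. LINT s|lebesgue_on {0..t}. N_quot (evE u s) (\<epsilon> n) (evE (d n) s) \<bullet> j v)
      \<longlonglongrightarrow> (LINT s|lebesgue_on {0..t}. N_deriv (evE u s) (evE Y s) \<bullet> j v)"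
      by (rule integral_dominated_convergence[OF *])
  qed
  have convA: "(\<lambda>n. LINT s|lebesgue_on {0..t}. A (vpath (d n) s) v) \<longlonglongrightarrow> (LINT s|lebesgue_on {0..t}. A (vpath Y s) v)"
    if t: "t \<in> {0..T}" for t v
  proof -
    have "(\<lambda>n. norm A * norm v * ((1 + T) * norm (d n - Y))) \<longlonglongrightarrow> 0"
      using lim by (intro tendsto_mult_right_zero) (simp add: LIM_zero tendsto_norm_zero)
    then have "(\<lambda>n. (LINT s|lebesgue_on {0..t}. A (vpath (d n) s) v) - (LINT s|lebesgue_on {0..t}. A (vpath Y s) v)) \<longlonglongrightarrow> 0"
      by (rule Lim_null_comparison[rotated])
        (use integral_A_bound[OF t, of "d _ - Y" v] in \<open>simp add: integral_A_diff[OF t]\<close>)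
    then show ?thesis by (simp add: LIM_zero_iff)
  qed
  show ?thesis
    unfolding weak_solution_def
  proof (intro conjI ballI allI)
    show "integrable (lebesgue_on {0..T}) (\<lambda>s. N_deriv (evE u s) (evE Y s) \<bullet> j v)" for v
      using conv(1)[of T] T by simp
    fix t v assume t: "t \<in> {0..T}"
    have "(\<lambda>n. evE (d n) t \<bullet> j v + (LINT s|lebesgue_on {0..t}. A (vpath (d n) s) v))
        \<longlonglongrightarrow> evE Y t \<bullet> j v + (LINT s|lebesgue_on {0..t}. A (vpath Y s) v)"
      by (intro tendsto_add tendsto_inner ev[OF t] tendsto_const convA[OF t])
    moreover have "(\<lambda>n. h \<bullet> j v + (LINT s|lebesgue_on {0..t}. N_quot (evE u s) (\<epsilon> n) (evE (d n) s) \<bullet> j v))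
        \<longlonglongrightarrow> h \<bullet> j v + (LINT s|lebesgue_on {0..t}. N_deriv (evE u s) (evE Y s) \<bullet> j v)"
      by (intro tendsto_add conv(2)[OF t] tendsto_const)
    moreover have "evE (d n) t \<bullet> j v + (LINT s|lebesgue_on {0..t}. A (vpath (d n) s) v)
        = h \<bullet> j v + (LINT s|lebesgue_on {0..t}. N_quot (evE u s) (\<epsilon> n) (evE (d n) s) \<bullet> j v)" for n
      using d[of n] t by (simp add: weak_solution_def)
    ultimately show "evE Y t \<bullet> j v + (LINT s|lebesgue_on {0..t}. A (vpath Y s) v)
        = h \<bullet> j v + (LINT s|lebesgue_on {0..t}. N_deriv (evE u s) (evE Y s) \<bullet> j v)"
      using LIMSEQ_unique by simp
  qed
qed

end

section \<open>Random solutions\<close>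

lemma Lp_diff_scale:
  assumes "is_Lp_space p M rep"
  shows "AE x in M. rep (u - v) x = rep u x - rep v x"
    and "AE x in M. rep (b *\<^sub>R u) x = b *\<^sub>R rep u x"
proof -
  have "AE x in M. rep (u - v + v) x = rep (u - v) x + rep v x"
    using assms unfolding is_Lp_space_def by blast
  then show "AE x in M. rep (u - v) x = rep u x - rep v x" by eventually_elim simp
  show "AE x in M. rep (b *\<^sub>R u) x = b *\<^sub>R rep u x"
    using assms unfolding is_Lp_space_def by blast
qed

lemma L2_norm_le_of_AE_bound:
  assumes M: "prob_space M" and rep: "is_Lp_space 2 M rep" and b: "0 \<le> b"
    and le: "AE x in M. norm (rep u x) \<le> b"
  shows "norm u \<le> b"
proof -
  interpret prob_space M by fact
  have "(norm u)\<^sup>2 = (LINT x|M. (norm (rep u x))\<^sup>2)" and i: "integrable M (\<lambda>x. (norm (rep u x))\<^sup>2)"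
    using rep unfolding is_Lp_space_def by blast+
  note this(1)
  also have "(LINT x|M. (norm (rep u x))\<^sup>2) \<le> (LINT x|M. b\<^sup>2)"
    using le by (intro integral_mono_AE i integrable_const) (auto elim!: eventually_mono intro: power_mono)
  also have "\<dots> = b\<^sup>2" by (simp add: prob_space)
  finally show ?thesis using b by (rule power2_le_imp_le)
qed

lemma L2_convergent_AE_subsequence:
  fixes rep :: "'p::real_normed_vector \<Rightarrow> 'x \<Rightarrow> 'b::{banach, second_countable_topology}"
  assumes rep: "is_Lp_space 2 M rep" and lim: "u \<longlonglongrightarrow> w"
  obtains r :: "nat \<Rightarrow> nat" where "strict_mono r" "AE x in M. (\<lambda>n. rep (u (r n)) x) \<longlonglongrightarrow> rep w x"
proof -
  have sq: "(norm v)\<^sup>2 = (LINT x|M. (norm (rep v x))\<^sup>2)" "integrable M (\<lambda>x. (norm (rep v x))\<^sup>2)" for v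
    using rep unfolding is_Lp_space_def by blast+
  have "(\<lambda>n. (norm (u n - w))\<^sup>2) \<longlonglongrightarrow> 0"
    using tendsto_power[OF tendsto_norm_zero[OF LIM_zero[OF lim]], of 2] by simp
  then have "(\<lambda>n. LINT x|M. norm ((norm (rep (u n - w) x))\<^sup>2)) \<longlonglongrightarrow> 0" by (simp add: sq(1))
  then obtain r :: "nat \<Rightarrow> nat" where r: "strict_mono r" "AE x in M. (\<lambda>n. (norm (rep (u (r n) - w) x))\<^sup>2) \<longlonglongrightarrow> 0"
    using tendsto_L1_AE_subseq[of M "\<lambda>n x. (norm (rep (u n - w) x))\<^sup>2"] sq(2) by blast
  have "AE x in M. \<forall>n. rep (u (r n) - w) x = rep (u (r n)) x - rep w x"
    by (subst AE_all_countable) (intro allI Lp_diff_scale(1)[OF rep])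
  with r(2) have "AE x in M. (\<lambda>n. rep (u (r n)) x) \<longlonglongrightarrow> rep w x"
  proof eventually_elim
    case (elim x)
    from tendsto_real_sqrt[OF elim(1)] have "(\<lambda>n. norm (rep (u (r n)) x - rep w x)) \<longlonglongrightarrow> 0"
      using elim(2) by simp
    then show ?case by (simp add: tendsto_norm_zero_iff LIM_zero_iff)
  qed
  with r(1) show thesis by (rule that)
qed

text \<open>The filtration contains every subset of a null set, so measurability is not affected by the exceptional set.\<close>

lemma adapted_AE_limit:
  fixes f :: "'w \<Rightarrow> 'h::{real_normed_vector, second_countable_topology}"
  assumes F: "usual_conditions M T F" and t: "t \<in> {0..T}"
    and meas: "\<And>n. f' n \<in> borel_measurable (F t)"
    and lim: "AE \<omega> in M. (\<lambda>n. f' n \<omega>) \<longlonglongrightarrow> f \<omega>"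
  shows "f \<in> borel_measurable (F t)"
proof -
  have sub: "subalgebra M (F t)" and mono: "sets (F 0) \<subseteq> sets (F t)"
    and null: "\<And>N S. N \<in> null_sets M \<Longrightarrow> S \<subseteq> N \<Longrightarrow> S \<in> sets (F 0)"
    using F t unfolding usual_conditions_def by auto
  have sp: "space (F t) = space M" using sub by (simp add: subalgebra_def)
  from lim obtain N where N: "{\<omega> \<in> space M. \<not> (\<lambda>n. f' n \<omega>) \<longlonglongrightarrow> f \<omega>} \<subseteq> N" "N \<in> null_sets M"
    by (rule AE_E) auto
  have NF: "S \<in> sets (F t)" if "S \<subseteq> N" for S using null[OF N(2) that] mono by blast
  have [measurable]: "N \<in> sets (F t)" by (rule NF) simp
  define k where "k \<omega> = (if \<omega> \<in> N then 0 else f \<omega>)" for \<omega>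
  have k: "k \<in> borel_measurable (F t)"
  proof (rule borel_measurable_LIMSEQ_metric)
    show "(\<lambda>\<omega>. if \<omega> \<in> N then 0 else f' n \<omega>) \<in> borel_measurable (F t)" for n
      using meas[of n] by measurable
    show "(\<lambda>n. if \<omega> \<in> N then 0 else f' n \<omega>) \<longlonglongrightarrow> k \<omega>" if "\<omega> \<in> space (F t)" for \<omega>
      using N(1) that by (auto simp: k_def sp)
  qed
  show ?thesis
  proof (rule measurableI)
    fix B :: "'h set" assume B: "B \<in> sets borel"
    have split: "f -` B \<inter> space (F t) = (k -` B \<inter> space (F t) - N) \<union> (f -` B \<inter> space (F t) \<inter> N)"
      by (auto simp: k_def)
    have "k -` B \<inter> space (F t) - N \<in> sets (F t)" using measurable_sets[OF k B] by auto
    moreover have "f -` B \<inter> space (F t) \<inter> N \<in> sets (F t)" by (rule NF) auto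
    ultimately show "f -` B \<inter> space (F t) \<in> sets (F t)" by (subst split) (rule sets.Un)
  qed simp
qed

lemma C2_b_bounds:
  assumes "C2_b g"
  obtains L K where "\<And>r. (g has_real_derivative deriv g r) (at r)" "\<And>r. \<bar>deriv g r\<bar> \<le> L"
    "\<And>r s. \<bar>deriv g r - deriv g s\<bar> \<le> K * \<bar>r - s\<bar>"
proof -
  have d: "(g has_real_derivative deriv g r) (at r)" "(deriv g has_real_derivative deriv (deriv g) r) (at r)" for r
    using assms unfolding C2_b_def by (auto intro: DERIV_deriv_iff_field_differentiable[THEN iffD2])
  obtain L where L: "\<And>r. \<bar>deriv g r\<bar> \<le> L" using assms by (auto simp: C2_b_def bounded_iff)
  obtain K where K: "\<And>r. \<bar>deriv (deriv g) r\<bar> \<le> K" using assms by (auto simp: C2_b_def bounded_iff)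
  have "\<bar>deriv g r - deriv g s\<bar> \<le> K * \<bar>r - s\<bar>" for r s
    using field_differentiable_bound[of UNIV "deriv g" "deriv (deriv g)" K r s] d(2) K by simp
  with d(1) L show thesis by (rule that)
qed

theorem theorem4p4:
  fixes D :: "(real ^ 'n) set"
    and repH :: "'h::{real_inner, banach, second_countable_topology} \<Rightarrow> real ^ 'n \<Rightarrow> real"
    and rep1 :: "'l::banach \<Rightarrow> real ^ 'n \<Rightarrow> real"
    and j :: "'v::{real_inner, banach, second_countable_topology} \<Rightarrow> 'h"
    and A :: "'v \<Rightarrow>\<^sub>L ('v \<Rightarrow>\<^sub>L real)"
    and A1 :: "('l \<times> 'l) set"
    and M :: "'w measure"
    and F :: "real \<Rightarrow> 'w measure"
    and W :: "real \<Rightarrow> 'u::{real_inner, banach, second_countable_topology} \<Rightarrow> 'w \<Rightarrow> real"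
    and G :: "'u \<Rightarrow>\<^sub>L 'h"
    and I :: "real \<Rightarrow> 'w \<Rightarrow> 'h"
    and T :: real
    and g :: "real \<Rightarrow> real"
    and evE :: "'e::{banach, second_countable_topology} \<Rightarrow> real \<Rightarrow> 'h"
    and rep\<Omega> :: "'p::banach \<Rightarrow> 'w \<Rightarrow> 'e"
    and X :: "'h \<Rightarrow> 'p"
  assumes "smooth_bounded_domain D"
    and "is_Lp_space 2 (lebesgue_on D) repH"
    and "is_Lp_space 1 (lebesgue_on D) rep1"
    and "dense_compact_embedding j"
    and "coercive A"
    and "m_accretive A1"
    and "part_graph_L1 D repH rep1 j A \<subseteq> A1"
    and "\<And>B. m_accretive B \<Longrightarrow> part_graph_L1 D repH rep1 j A \<subseteq> B \<Longrightarrow> B = A1"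
    and "\<And>\<delta>. \<delta> > 0 \<Longrightarrow> sub_Markovian D rep1 (resolvent A1 \<delta>)"
    and "\<exists>m. \<forall>\<delta>>0. bounded_L1_Linf D rep1 (resolvent A1 \<delta> ^^ m)"
    and "T > 0"
    and "prob_space M"
    and "usual_conditions M T F"
    and "cylindrical_Wiener_process M T F W"
    and "Hilbert_Schmidt G"
    and "stochastic_integral M T F W G I"
    and "C2_b g"
    and "is_E_space T j evE"
    and "is_Lp_space 2 M rep\<Omega>"
    and "\<And>x. variational_solution M T F j A evE
           (\<lambda>\<omega> s u. class_of (lebesgue_on D) repH (\<lambda>y. g (repH u y))) I x (rep\<Omega> (X x))"
    and "\<And>x Z. variational_solution M T F j A evE
           (\<lambda>\<omega> s u. class_of (lebesgue_on D) repH (\<lambda>y. g (repH u y))) I x (rep\<Omega> Z) \<Longrightarrow> Z = X x"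
  shows "\<exists>DX :: 'h \<Rightarrow> ('h \<Rightarrow>\<^sub>L 'p).
           (\<forall>x. (X has_derivative blinfun_apply (DX x)) (at x)) \<and>
           continuous_on UNIV DX \<and>
           bounded (range DX) \<and>
           (\<forall>x h. variational_solution M T F j A evE
              (\<lambda>\<omega> s u. class_of (lebesgue_on D) repH
                 (\<lambda>y. deriv g (repH (evE (rep\<Omega> (X x) \<omega>) s) y) * repH u y))
              (\<lambda>t \<omega>. 0) h (rep\<Omega> (blinfun_apply (DX x) h)))"
proof -
  note D = assms(1) and repH = assms(2) and jj = assms(4) and AA = assms(5) and T = assms(11)
    and M = assms(12) and F = assms(13) and g = assms(17) and EE = assms(18) and rep\<Omega> = assms(19)
    and X = assms(20)
  obtain c where c: "c > 0" "\<And>v. blinfun_apply (blinfun_apply A v) v \<ge> c * (norm v)\<^sup>2"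
    using AA by (auto simp: coercive_def)
  obtain L K where LK: "\<And>r. (g has_real_derivative deriv g r) (at r)" "\<And>r. \<bar>deriv g r\<bar> \<le> L"
    "\<And>r s. \<bar>deriv g r - deriv g s\<bar> \<le> K * \<bar>r - s\<bar>"
    using C2_b_bounds[OF g] by blast
  have "D \<in> lmeasurable" using D by (auto simp: smooth_bounded_domain_def intro: lmeasurable_open)
  then have "finite_measure (lebesgue_on D)" by (rule finite_measure_lebesgue_on)
  then interpret semilinear_flow T j A evE c "lebesgue_on D" repH g "deriv g" L K
    by (intro semilinear_flow.intro linear_evolution.intro nemytskii_C2.intro nemytskii_C2_axioms.intro
        L2_class.intro L2_class_axioms.intro T jj c EE repH LK)
  define R where "R x \<omega> = rep\<Omega> (X x) \<omega>" for x \<omega>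
  \<comment> \<open>Almost every path of \<open>X x\<close> solves the pathwise equation in the tested form.\<close>
  have flow: "AE \<omega> in M. flow_solution (\<lambda>t. I t \<omega>) x (R x \<omega>)" for x
  proof -
    have "AE \<omega> in M. \<forall>t\<in>{0..T}. to_dual j (evE (R x \<omega>) t) + dual_integral t (\<lambda>s. blinfun_apply A (inv j (evE (R x \<omega>) s)))
        = to_dual j x + dual_integral t (\<lambda>s. to_dual j (N (evE (R x \<omega>) s))) + to_dual j (I t \<omega>)"
      using X[of x] by (simp add: variational_solution_def R_def nemytskii_def)
    then show ?thesis
    proof eventually_elim
      case (elim \<omega>)
      obtain B where "\<forall>z \<in> (\<lambda>s. N (evE (R x \<omega>) s)) ` {0..T}. norm z \<le> B"
        using compact_imp_bounded[OF compact_continuous_image[OF N_path[of "R x \<omega>"] compact_Icc]]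
        unfolding bounded_iff by blast
      then have B: "norm (N (evE (R x \<omega>) s)) \<le> B" if "s \<in> {0..T}" for s
        using that by blast
      show ?case
        unfolding flow_solution_def using elim evolution_equation_iff[OF N_path_integrable B] by blast
    qed
  qed
  define e where "e n = inverse (real (Suc n))" for n
  have e: "e n > 0" "e \<longlonglongrightarrow> 0" for n
    unfolding e_def[abs_def] using LIMSEQ_inverse_real_of_nat by simp_all
  have quotient: "AE \<omega> in M. rep\<Omega> ((X y - X x) /\<^sub>R b) \<omega> = (R y \<omega> - R x \<omega>) /\<^sub>R b" for x y b
    using Lp_diff_scale(1)[OF rep\<Omega>, of "X y" "X x"] Lp_diff_scale(2)[OF rep\<Omega>, of "inverse b" "X y - X x"]
    by eventually_elim (simp add: R_def)
  have lip: "norm (X x - X y) \<le> flow_const * norm (x - y)" for x y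
  proof (rule L2_norm_le_of_AE_bound[OF M rep\<Omega>])
    show "AE \<omega> in M. norm (rep\<Omega> (X x - X y) \<omega>) \<le> flow_const * norm (x - y)"
      using flow[of x] flow[of y] Lp_diff_scale(1)[OF rep\<Omega>, of "X x" "X y"]
      by eventually_elim (simp add: R_def[symmetric] flow_solution_lipschitz)
  qed (simp add: flow_const_nonneg)
  have cauchy: "\<exists>\<epsilon>0>0. \<forall>x h \<epsilon> \<epsilon>'. norm h \<le> 1 \<longrightarrow> 0 < \<epsilon> \<longrightarrow> \<epsilon> < \<epsilon>0 \<longrightarrow> 0 < \<epsilon>' \<longrightarrow> \<epsilon>' < \<epsilon>0 \<longrightarrow>
      norm ((X (x + \<epsilon> *\<^sub>R h) - X x) /\<^sub>R \<epsilon> - (X (x + \<epsilon>' *\<^sub>R h) - X x) /\<^sub>R \<epsilon>') \<le> \<eta>" if \<eta>: "\<eta> > 0" for \<eta>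
  proof -
    obtain \<epsilon>0 where \<epsilon>0: "\<epsilon>0 > 0" "\<And>y x h u \<epsilon> w \<epsilon>' w'. norm h \<le> 1 \<Longrightarrow> 0 < \<epsilon> \<Longrightarrow> \<epsilon> < \<epsilon>0 \<Longrightarrow> 0 < \<epsilon>' \<Longrightarrow> \<epsilon>' < \<epsilon>0 \<Longrightarrow>
        flow_solution y x u \<Longrightarrow> flow_solution y (x + \<epsilon> *\<^sub>R h) w \<Longrightarrow> flow_solution y (x + \<epsilon>' *\<^sub>R h) w' \<Longrightarrow>
        norm ((w - u) /\<^sub>R \<epsilon> - (w' - u) /\<^sub>R \<epsilon>') \<le> \<eta>"
      using quotients_uniformly_Cauchy[OF \<eta>] by blast
    have "norm ((X (x + \<epsilon> *\<^sub>R h) - X x) /\<^sub>R \<epsilon> - (X (x + \<epsilon>' *\<^sub>R h) - X x) /\<^sub>R \<epsilon>') \<le> \<eta>"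
      if h: "norm h \<le> 1" and \<epsilon>: "0 < \<epsilon>" "\<epsilon> < \<epsilon>0" "0 < \<epsilon>'" "\<epsilon>' < \<epsilon>0" for x h \<epsilon> \<epsilon>'
    proof (rule L2_norm_le_of_AE_bound[OF M rep\<Omega>])
      show "AE \<omega> in M. norm (rep\<Omega> ((X (x + \<epsilon> *\<^sub>R h) - X x) /\<^sub>R \<epsilon> - (X (x + \<epsilon>' *\<^sub>R h) - X x) /\<^sub>R \<epsilon>') \<omega>) \<le> \<eta>"
        using Lp_diff_scale(1)[OF rep\<Omega>, of "(X (x + \<epsilon> *\<^sub>R h) - X x) /\<^sub>R \<epsilon>" "(X (x + \<epsilon>' *\<^sub>R h) - X x) /\<^sub>R \<epsilon>'"]
          quotient[of \<epsilon> "x + \<epsilon> *\<^sub>R h" x] quotient[of \<epsilon>' "x + \<epsilon>' *\<^sub>R h" x]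
          flow[of x] flow[of "x + \<epsilon> *\<^sub>R h"] flow[of "x + \<epsilon>' *\<^sub>R h"]
      proof eventually_elim
        case (elim \<omega>)
        from \<epsilon>0(2)[OF h \<epsilon> elim(4-6)] show ?case unfolding elim(1-3) .
      qed
    qed (use \<eta> in simp)
    with \<epsilon>0(1) show ?thesis by blast
  qed
  obtain DX :: "'h \<Rightarrow> ('h \<Rightarrow>\<^sub>L 'p)" where DX: "\<And>x. (X has_derivative blinfun_apply (DX x)) (at x)"
    "continuous_on UNIV DX" "bounded (range DX)"
    "\<And>x h. (\<lambda>n. (X (x + inverse (real (Suc n)) *\<^sub>R h) - X x) /\<^sub>R inverse (real (Suc n))) \<longlonglongrightarrow> DX x h"
    using uniformly_Cauchy_quotients_imp_C1[OF flow_const_nonneg lip cauchy] by blast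
  have "variational_solution M T F j A evE
      (\<lambda>\<omega> s u. class_of (lebesgue_on D) repH (\<lambda>y. deriv g (repH (evE (rep\<Omega> (X x) \<omega>) s) y) * repH u y))
      (\<lambda>t \<omega>. 0) h (rep\<Omega> (blinfun_apply (DX x) h))" for x h
  proof -
    \<comment> \<open>The derivative is a limit of quotients in \<open>L\<^sup>2(\<Omega>; E)\<close>, hence along a subsequence almost surely in \<open>E\<close>. For such
        \<open>\<omega>\<close> the limit solves the linearized equation and is adapted, like the quotients.\<close>
    define Y where "Y \<omega> = rep\<Omega> (blinfun_apply (DX x) h) \<omega>" for \<omega>
    define \<delta> where "\<delta> n = (X (x + e n *\<^sub>R h) - X x) /\<^sub>R e n" for n
    have "\<delta> \<longlonglongrightarrow> blinfun_apply (DX x) h"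
      using DX(4)[of x h] unfolding \<delta>_def[abs_def] e_def .
    then obtain r :: "nat \<Rightarrow> nat" where r: "strict_mono r" "AE \<omega> in M. (\<lambda>n. rep\<Omega> (\<delta> (r n)) \<omega>) \<longlonglongrightarrow> Y \<omega>"
      unfolding Y_def by (rule L2_convergent_AE_subsequence[OF rep\<Omega>])
    define b where "b n = e (r n)" for n
    have b: "b n > 0" "b \<longlonglongrightarrow> 0" for n
      using e(1) LIMSEQ_subseq_LIMSEQ[OF e(2) r(1)] by (simp_all add: b_def[abs_def] o_def)
    define d where "d n \<omega> = (R (x + b n *\<^sub>R h) \<omega> - R x \<omega>) /\<^sub>R b n" for n \<omega>
    have d: "AE \<omega> in M. (\<lambda>n. d n \<omega>) \<longlonglongrightarrow> Y \<omega>"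
    proof -
      have "AE \<omega> in M. \<forall>n. rep\<Omega> (\<delta> (r n)) \<omega> = d n \<omega>"
        unfolding AE_all_countable d_def \<delta>_def b_def using quotient by blast
      with r(2) show ?thesis by eventually_elim simp
    qed
    have sols: "AE \<omega> in M. \<forall>n. flow_solution (\<lambda>t. I t \<omega>) (x + b n *\<^sub>R h) (R (x + b n *\<^sub>R h) \<omega>)"
      unfolding AE_all_countable using flow by blast
    have Y: "AE \<omega> in M. weak_solution h (\<lambda>s. N_deriv (evE (R x \<omega>) s) (evE (Y \<omega>) s)) (Y \<omega>)"
      using d sols flow[of x]
    proof eventually_elim
      case (elim \<omega>)
      show ?case
      proof (rule linearized_limit[OF _ b elim(1)])
        show "weak_solution h (\<lambda>s. N_quot (evE (R x \<omega>) s) (b n) (evE (d n \<omega>) s)) (d n \<omega>)" for n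
          unfolding d_def using elim(2) by (intro difference_quotient_solution(1)[OF elim(3) _ b(1)]) blast
      qed
    qed
    have eq: "AE \<omega> in M. \<forall>t\<in>{0..T}. to_dual j (evE (Y \<omega>) t) + dual_integral t (\<lambda>s. blinfun_apply A (inv j (evE (Y \<omega>) s)))
        = to_dual j h + dual_integral t (\<lambda>s. to_dual j (N_deriv (evE (R x \<omega>) s) (evE (Y \<omega>) s))) + to_dual j 0"
      using Y
    proof eventually_elim
      case (elim \<omega>)
      have i: "integrable (lebesgue_on {0..T}) (\<lambda>s. N_deriv (evE (R x \<omega>) s) (evE (Y \<omega>) s) \<bullet> j v)" for v
        using elim by (simp add: weak_solution_def)
      have B: "norm (N_deriv (evE (R x \<omega>) s) (evE (Y \<omega>) s)) \<le> L * norm (Y \<omega>)" if "s \<in> {0..T}" for s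
        by (rule order_trans[OF norm_N_deriv mult_left_mono[OF ev_norm_le[OF that] L_nonneg]])
      have "\<forall>t\<in>{0..T}. \<forall>v. evE (Y \<omega>) t \<bullet> j v + (LINT s|lebesgue_on {0..t}. A (vpath (Y \<omega>) s) v)
          = h \<bullet> j v + (LINT s|lebesgue_on {0..t}. N_deriv (evE (R x \<omega>) s) (evE (Y \<omega>) s) \<bullet> j v) + 0 \<bullet> j v"
        using elim by (simp add: weak_solution_def)
      then show ?case using evolution_equation_iff[OF i B] by blast
    qed
    have adapted: "(\<lambda>\<omega>. evE (Y \<omega>) t) \<in> borel_measurable (F t)" if t: "t \<in> {0..T}" for t
    proof (rule adapted_AE_limit[OF F t])
      have [measurable]: "(\<lambda>\<omega>. evE (R y \<omega>) t) \<in> borel_measurable (F t)" for y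
        using X[of y] t by (simp add: variational_solution_def R_def)
      show "(\<lambda>\<omega>. (evE (R (x + b n *\<^sub>R h) \<omega>) t - evE (R x \<omega>) t) /\<^sub>R b n) \<in> borel_measurable (F t)" for n
        by measurable
      show "AE \<omega> in M. (\<lambda>n. (evE (R (x + b n *\<^sub>R h) \<omega>) t - evE (R x \<omega>) t) /\<^sub>R b n) \<longlonglongrightarrow> evE (Y \<omega>) t"
        using d
      proof eventually_elim
        case (elim \<omega>)
        have "(\<lambda>n. evE (d n \<omega>) t) \<longlonglongrightarrow> evE (Y \<omega>) t" by (rule ev_tendsto[OF elim t])
        then show ?case by (simp add: d_def ev_scale[OF t] ev_diff[OF t])
      qed
    qed
    show ?thesis
      unfolding variational_solution_def
      using eq adapted by (simp add: Y_def R_def N_deriv_def)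
  qed
  with DX(1-3) show ?thesis by blast
qed

end
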